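(* For all $y\in\mathbb R^2$ and $x\in\Delta$, $$(1+y^Tx)^3=\sum_{i=1}^{28}\psi_i(y)B_i(x),$$ where, writing $\ell_p(y):=1+y^Tp$ for a point $p\in\mathbb R^2$, $\psi_1=\ell_{p_1}^3$, $\psi_2=\ell_{p_2}^3$, $\psi_3=\ell_{p_3}^3$, $\psi_4=\ell_{p_1}^2\ell_{p_{3,1}}$, $\psi_5=\ell_{p_1}^2\ell_{p_{2,1}}$, $\psi_6=\ell_{p_2}^2\ell_{p_{1,2}}$, $\psi_7=\ell_{p_2}^2\ell_{p_{3,2}}$, $\psi_8=\ell_{p_3}^2\ell_{p_{2,3}}$, $\psi_9=\ell_{p_3}^2\ell_{p_{1,3}}$, $\psi_{10}=\ell_{p_1}\ell_{p_{3,1}}\ell_{p_{3,2}}$, $\psi_{11}=\ell_{p_1}\ell_{p_{2,3}}\ell_{p_{2,1}}$, $\psi_{12}=\ell_{p_2}\ell_{p_{1,2}}\ell_{p_{1,3}}$, $\psi_{13}=\ell_{p_2}\ell_{p_{3,1}}\ell_{p_{3,2}}$, $\psi_{14}=\ell_{p_3}\ell_{p_{2,3}}\ell_{p_{2,1}}$, $\psi_{15}=\ell_{p_3}\ell_{p_{1,2}}\ell_{p_{1,3}}$, $\psi_{16}=\ell_{p_1}\ell_{p_{3,1}}\ell_{p_{2,1}}$, $\psi_{17}=\ell_{p_2}\ell_{p_{3,2}}\ell_{p_{1,2}}$, $\psi_{18}=\ell_{p_3}\ell_{p_{1,3}}\ell_{p_{2,3}}$, $\psi_{19}=\ell_{p_{3,1}}\ell_{p_{3,2}}\ell_{m_1}$,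 $\psi_{20}=\ell_{p_{1,2}}\ell_{p_{1,3}}\ell_{m_2}$, $\psi_{21}=\ell_{p_{2,3}}\ell_{p_{2,1}}\ell_{m_3}$, $\psi_{22}=\ell_{p_{3,1}}\ell_{p_{3,2}}\ell_{p_{2,1}}$, $\psi_{23}=\ell_{p_{3,1}}\ell_{p_{2,3}}\ell_{p_{2,1}}$, $\psi_{24}=\ell_{p_{3,2}}\ell_{p_{1,2}}\ell_{p_{1,3}}$, $\psi_{25}=\ell_{p_{3,1}}\ell_{p_{3,2}}\ell_{p_{1,2}}$, $\psi_{26}=\ell_{p_{1,3}}\ell_{p_{2,3}}\ell_{p_{2,1}}$, $\psi_{27}=\ell_{p_{1,2}}\ell_{p_{1,3}}\ell_{p_{2,3}}$, $\psi_{28}=\ell_q\Big[2\ell_q^2-\tfrac13\big(\ell_{p_{1,3}}\ell_{p_{2,3}}+\ell_{p_{3,2}}\ell_{p_{1,2}}+\ell_{p_{3,1}}\ell_{p_{2,1}}\big)\Big]$, with $m_1=\tfrac25p_1+\tfrac25p_2+\tfrac15p_3$, $m_2=\tfrac15p_1+\tfrac25p_2+\tfrac25p_3$, $m_3=\tfrac25p_1+\tfrac15p_2+\tfrac25p_3$, $q=\tfrac13(p_1+p_2+p_3)$.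
   Context: Let $\Delta=\langle p_1,p_2,p_3\rangle\subset\mathbb R^2$ be a nondegenerate triangle with area $|\Delta|$. Define $p_{1,2}=\tfrac23p_2+\tfrac13p_3$, $p_{1,3}=\tfrac13p_2+\tfrac23p_3$, $p_{2,1}=\tfrac23p_1+\tfrac13p_3$, $p_{2,3}=\tfrac13p_1+\tfrac23p_3$, $p_{3,1}=\tfrac23p_1+\tfrac13p_2$, $p_{3,2}=\tfrac13p_1+\tfrac23p_2$. Simplex splines: for a multiset $\Xi=\{\xi_1,\dots,\xi_6\}\subset\mathbb R^2$ with convex hull of positive area, choose any simplex $\sigma=\langle\bar\xi_1,\dots,\bar\xi_6\rangle\subset\mathbb R^5$ of positive volume projecting (onto the first two coordinates, $\pi$) to the $\xi_i$, and set $M_\Xi(x)=\mathrm{vol}_3(\sigma\cap\pi^{-1}(x))/\mathrm{vol}_5(\sigma)$. $B_i=w_iM_{\Xi_i}$ (on $\Delta$, boundary values by continuity from the interior) with $\Xi_1=\{p_1^{(4)},p_{3,1},p_{2,1}\}$, $\Xi_2=\{p_2^{(4)},p_{3,2},p_{1,2}\}$, $\Xi_3=\{p_3^{(4)},p_{1,3},p_{2,3}\}$, $\Xi_4=\{p_1^{(3)},p_{3,1},p_{3,2},p_{2,1}\}$, $\Xi_5=\{p_1^{(3)},p_{2,1},p_{2,3},p_{3,1}\}$, $\Xi_6=\{p_2^{(3)},p_{1,2},p_{1,3},p_{3,2}\}$, $\Xi_7=\{p_2^{(3)},p_{3,2},p_{3,1},p_{1,2}\}$, $\Xi_8=\{p_3^{(3)},p_{2,3},p_{2,1},p_{1,3}\}$,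 $\Xi_9=\{p_3^{(3)},p_{1,3},p_{1,2},p_{2,3}\}$, $\Xi_{10}=\{p_1^{(2)},p_{3,1},p_{3,2},p_2,p_{2,1}\}$, $\Xi_{11}=\{p_1^{(2)},p_{2,1},p_{2,3},p_3,p_{3,1}\}$, $\Xi_{12}=\{p_2^{(2)},p_{1,2},p_{1,3},p_3,p_{3,2}\}$, $\Xi_{13}=\{p_2^{(2)},p_{3,2},p_{3,1},p_1,p_{1,2}\}$, $\Xi_{14}=\{p_3^{(2)},p_{2,3},p_{2,1},p_1,p_{1,3}\}$, $\Xi_{15}=\{p_3^{(2)},p_{1,3},p_{1,2},p_2,p_{2,3}\}$, $\Xi_{16}=\{p_1^{(2)},p_{3,1},p_{3,2},p_{2,1},p_{2,3}\}$, $\Xi_{17}=\{p_2^{(2)},p_{3,2},p_{3,1},p_{1,2},p_{1,3}\}$, $\Xi_{18}=\{p_3^{(2)},p_{1,3},p_{1,2},p_{2,3},p_{2,1}\}$, $\Xi_{19}=\{p_1,p_2,p_{3,1},p_{3,2},p_{2,1},p_{1,2}\}$, $\Xi_{20}=\{p_2,p_3,p_{1,2},p_{1,3},p_{3,2},p_{2,3}\}$, $\Xi_{21}=\{p_3,p_1,p_{2,3},p_{2,1},p_{1,3},p_{3,1}\}$, $\Xi_{22}=\{p_1,p_{3,1},p_{3,2},p_{1,2},p_{2,3},p_{2,1}\}$, $\Xi_{23}=\{p_1,p_{2,1},p_{2,3},p_{1,3},p_{3,2},p_{3,1}\}$, $\Xi_{24}=\{p_2,p_{1,2},p_{1,3},p_{2,3},p_{3,1},p_{3,2}\}$,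 $\Xi_{25}=\{p_2,p_{3,1},p_{3,2},p_{1,2},p_{1,3},p_{2,1}\}$, $\Xi_{26}=\{p_3,p_{2,3},p_{2,1},p_{3,1},p_{1,2},p_{1,3}\}$, $\Xi_{27}=\{p_3,p_{1,2},p_{1,3},p_{2,3},p_{2,1},p_{3,2}\}$, $\Xi_{28}=\{p_{3,1},p_{3,2},p_{1,2},p_{1,3},p_{2,3},p_{2,1}\}$ (superscript $(m)$ = multiplicity $m$), and $w_i=\frac{|\Delta|}{15}c_i$, $c=(\tfrac16^{\times3},\tfrac13^{\times6},\tfrac12^{\times6},\tfrac23^{\times3},\tfrac56^{\times3},\tfrac23^{\times6},1)$. *)

theory Defs
  imports "HOL-Analysis.Analysis"
begin

text \<open>Simplex spline M_Xi for a knot multiset Xi given as a list of 6 points: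
  choose any lift of the knots to R^5 whose convex hull has positive 5-volume and
  take vol_3 of the fibre over x divided by vol_5 of the simplex (the paper says the
  value does not depend on the choice).\<close>
definition simplex_spline :: "(real^2) list \<Rightarrow> real^2 \<Rightarrow> real" where
  "simplex_spline Xi x =
     (SOME v. \<exists>zs :: (real^3) list. length zs = length Xi \<and>
        (let \<sigma> = convex hull (set (zip Xi zs))
         in measure lborel \<sigma> > 0 \<and>
            v = measure lborel {z. (x, z) \<in> \<sigma>} / measure lborel \<sigma>))"

definition interior_ext :: "(real^2) set \<Rightarrow> (real^2 \<Rightarrow> real) \<Rightarrow> real^2 \<Rightarrow> real" where
  "interior_ext T f x = (if x \<in> interior T then f x else Lim (at x within interior T) f)"

definition tp :: "real^2 \<Rightarrow> real^2 \<Rightarrow> real^2" where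
  "tp a b = (2/3) *\<^sub>R a + (1/3) *\<^sub>R b"

definition knot_lists :: "real^2 \<Rightarrow> real^2 \<Rightarrow> real^2 \<Rightarrow> (real^2) list list" where
  "knot_lists p1 p2 p3 =
    (let a12 = tp p2 p3; a13 = tp p3 p2; a21 = tp p1 p3;
         a23 = tp p3 p1; a31 = tp p1 p2; a32 = tp p2 p1 in
     [ replicate 4 p1 @ [a31, a21],
       replicate 4 p2 @ [a32, a12],
       replicate 4 p3 @ [a13, a23],
       replicate 3 p1 @ [a31, a32, a21],
       replicate 3 p1 @ [a21, a23, a31],
       replicate 3 p2 @ [a12, a13, a32],
       replicate 3 p2 @ [a32, a31, a12],
       replicate 3 p3 @ [a23, a21, a13],
       replicate 3 p3 @ [a13, a12, a23],
       replicate 2 p1 @ [a31, a32, p2, a21],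
       replicate 2 p1 @ [a21, a23, p3, a31],
       replicate 2 p2 @ [a12, a13, p3, a32],
       replicate 2 p2 @ [a32, a31, p1, a12],
       replicate 2 p3 @ [a23, a21, p1, a13],
       replicate 2 p3 @ [a13, a12, p2, a23],
       replicate 2 p1 @ [a31, a32, a21, a23],
       replicate 2 p2 @ [a32, a31, a12, a13],
       replicate 2 p3 @ [a13, a12, a23, a21],
       [p1, p2, a31, a32, a21, a12],
       [p2, p3, a12, a13, a32, a23],
       [p3, p1, a23, a21, a13, a31],
       [p1, a31, a32, a12, a23, a21],
       [p1, a21, a23, a13, a32, a31],
       [p2, a12, a13, a23, a31, a32],
       [p2, a31, a32, a12, a13, a21],
       [p3, a23, a21, a31, a12, a13],
       [p3, a12, a13, a23, a21, a32],
       [a31, a32, a12, a13, a23, a21] ])"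

definition coeffs :: "real list" where
  "coeffs = replicate 3 (1/6) @ replicate 6 (1/3) @ replicate 6 (1/2) @
            replicate 3 (2/3) @ replicate 3 (5/6) @ replicate 6 (2/3) @ [1]"

text \<open>B_i (0-based index i, i.e. B_{i+1} of the paper) on the triangle.\<close>
definition Bspl :: "real^2 \<Rightarrow> real^2 \<Rightarrow> real^2 \<Rightarrow> nat \<Rightarrow> real^2 \<Rightarrow> real" where
  "Bspl p1 p2 p3 i x =
     (measure lborel (convex hull {p1, p2, p3}) / 15 * coeffs ! i) *
     interior_ext (convex hull {p1, p2, p3}) (simplex_spline (knot_lists p1 p2 p3 ! i)) x"

definition ell :: "real^2 \<Rightarrow> real^2 \<Rightarrow> real" where
  "ell y p = 1 + y \<bullet> p"

definition psis :: "real^2 \<Rightarrow> real^2 \<Rightarrow> real^2 \<Rightarrow> real^2 \<Rightarrow> real list" where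
  "psis p1 p2 p3 y =
    (let a12 = tp p2 p3; a13 = tp p3 p2; a21 = tp p1 p3;
         a23 = tp p3 p1; a31 = tp p1 p2; a32 = tp p2 p1;
         m1 = (2/5) *\<^sub>R p1 + (2/5) *\<^sub>R p2 + (1/5) *\<^sub>R p3;
         m2 = (1/5) *\<^sub>R p1 + (2/5) *\<^sub>R p2 + (2/5) *\<^sub>R p3;
         m3 = (2/5) *\<^sub>R p1 + (1/5) *\<^sub>R p2 + (2/5) *\<^sub>R p3;
         q = (1/3) *\<^sub>R (p1 + p2 + p3);
         l = ell y in
     [ l p1 ^ 3, l p2 ^ 3, l p3 ^ 3,
       l p1 ^ 2 * l a31, l p1 ^ 2 * l a21, l p2 ^ 2 * l a12,
       l p2 ^ 2 * l a32, l p3 ^ 2 * l a23, l p3 ^ 2 * l a13,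
       l p1 * l a31 * l a32, l p1 * l a23 * l a21, l p2 * l a12 * l a13,
       l p2 * l a31 * l a32, l p3 * l a23 * l a21, l p3 * l a12 * l a13,
       l p1 * l a31 * l a21, l p2 * l a32 * l a12, l p3 * l a13 * l a23,
       l a31 * l a32 * l m1, l a12 * l a13 * l m2, l a23 * l a21 * l m3,
       l a31 * l a32 * l a21, l a31 * l a23 * l a21, l a32 * l a12 * l a13,
       l a31 * l a32 * l a12, l a13 * l a23 * l a21, l a12 * l a13 * l a23,
       l q * (2 * l q ^ 2 - (1/3) * (l a13 * l a23 + l a32 * l a12 + l a31 * l a21)) ])"

end

(* The volume of a simplex in R^5 and the volumes of its fibres over R^2 are additive under
   subdivision, so splines satisfy knot insertion: if e is an affine combination of the knots with
   weights g i, then M(Xi) is the sum of g i * M(Xi with knot i replaced by e). This holds pointwise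
   at x unless x lies on a line carrying five of the knots involved.
   The power (1 + y . x)^3 is the Bernstein form with coefficients ell(p1)^a ell(p2)^b ell(p3)^c, and
   the Bernstein polynomials are the splines with knots p1^(a+1), p2^(b+1), p3^(c+1). Finitely many
   insertions rewrite each of them in terms of the 28 splines, and all of these can be chosen so that
   the exceptional lines miss the interior of the triangle. Comparing coefficients gives the identity
   in the interior. On the boundary it follows by passing to the limit, which exists for every single
   spline by dominated convergence. *)
theory Submission
  imports Defs
begin

section \<open>Barycentric coordinates\<close>

text \<open>Knot insertion is proved over a fixed \<open>x\<close>, as an identity between indicator
  functions of fibres in R^3 that holds for almost every height \<open>z\<close>. In barycentric
  coordinates a simplex is a list of affine inequalities, and exchanging a vertex changes them by an
  explicit formula. The heights to be discarded lie on hyperplanes of R^5. Such a hyperplane cuts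
  the fibre over \<open>x\<close> in a null set unless it is vertical and passes over
  \<open>x\<close>; a vertical one projects to a line that carries all the knots below it. This is
  the source of the exceptional lines: over them two closed simplices can share a whole fibre, and
  the signed count can go wrong. Every insertion is applied at the interior points themselves, so
  the identity there is pointwise. The edges resist this treatment, because splines with five knots
  on an edge jump there. Volumes enter as ratios, apart from one absolute normalisation: the lifts
  used for the Bernstein polynomials have volume area / 60.\<close>

definition barycentric :: "nat \<Rightarrow> (nat \<Rightarrow> 'a::euclidean_space) \<Rightarrow> (nat \<Rightarrow> 'a \<Rightarrow> real) \<Rightarrow> bool" where
  "barycentric n v g \<longleftrightarrow>
     (\<forall>i<n. \<exists>c a. \<forall>p. g i p = c + a \<bullet> p) \<and>
     (\<forall>p. (\<Sum>i<n. g i p) = 1) \<and>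
     (\<forall>p. (\<Sum>i<n. g i p *\<^sub>R v i) = p) \<and>
     (\<forall>i<n. \<forall>j<n. g i (v j) = (if i = j then 1 else 0))"

lemma barycentricD:
  assumes "barycentric n v g"
  shows "i < n \<Longrightarrow> \<exists>c a. \<forall>p. g i p = c + a \<bullet> p"
    and "(\<Sum>i<n. g i p) = 1"
    and "(\<Sum>i<n. g i p *\<^sub>R v i) = p"
    and "i < n \<Longrightarrow> j < n \<Longrightarrow> g i (v j) = (if i = j then 1 else 0)"
  using assms unfolding barycentric_def by blast+

text \<open>Affine functions commute with affine combinations, and \<open>g i\<close> is 1 at
  \<open>v i\<close> and 0 at the other vertices.\<close>

lemma barycentric_coordinate_of_sum:
  assumes "barycentric n v g" "i < n" "(\<Sum>j<n. \<gamma> j) = 1"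
  shows "g i (\<Sum>j<n. \<gamma> j *\<^sub>R v j) = \<gamma> i"
proof -
  obtain c a where g: "\<And>p. g i p = c + a \<bullet> p"
    using barycentricD(1)[OF assms(1,2)] by blast
  have "g i (\<Sum>j<n. \<gamma> j *\<^sub>R v j) = (\<Sum>j<n. \<gamma> j) * c + (\<Sum>j<n. \<gamma> j * (a \<bullet> v j))"
    using assms(3) by (simp add: g inner_sum_right)
  also have "\<dots> = (\<Sum>j<n. \<gamma> j * g i (v j))"
    by (simp add: g sum_distrib_left sum.distrib algebra_simps)
  also have "\<dots> = (\<Sum>j<n. if j = i then \<gamma> j else 0)"
    using assms(2) by (intro sum.cong) (auto simp: barycentricD(4)[OF assms(1)])
  finally show ?thesis using assms(2) by simp
qed

lemma barycentric_convex_hull: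
  assumes "barycentric n v g"
  shows "convex hull (v ` {..<n}) = {p. \<forall>i<n. 0 \<le> g i p}"
proof
  show "convex hull (v ` {..<n}) \<subseteq> {p. \<forall>i<n. 0 \<le> g i p}"
  proof (rule hull_minimal)
    show "v ` {..<n} \<subseteq> {p. \<forall>i<n. 0 \<le> g i p}"
      using barycentricD(4)[OF assms] by auto
    have "convex {p. 0 \<le> g i p}" if i: "i < n" for i
    proof -
      obtain c a where g: "\<And>p. g i p = c + a \<bullet> p"
        using barycentricD(1)[OF assms i] by blast
      have "{p. 0 \<le> g i p} = {p. a \<bullet> p \<ge> - c}" by (auto simp: g)
      then show ?thesis by (simp add: convex_halfspace_ge)
    qed
    then have "convex (\<Inter>i\<in>{..<n}. {p. 0 \<le> g i p})" by (intro convex_INT) auto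
    moreover have "(\<Inter>i\<in>{..<n}. {p. 0 \<le> g i p}) = {p. \<forall>i<n. 0 \<le> g i p}" by auto
    ultimately show "convex {p. \<forall>i<n. 0 \<le> g i p}" by simp
  qed
  show "{p. \<forall>i<n. 0 \<le> g i p} \<subseteq> convex hull (v ` {..<n})"
  proof
    fix p assume p: "p \<in> {p. \<forall>i<n. 0 \<le> g i p}"
    have "(\<Sum>i<n. g i p *\<^sub>R v i) \<in> convex hull (v ` {..<n})"
      using p barycentricD(2)[OF assms]
      by (intro convex_sum) (auto intro: hull_inc convex_convex_hull)
    then show "p \<in> convex hull (v ` {..<n})" using barycentricD(3)[OF assms] by simp
  qed
qed

lemma barycentric_continuous:
  assumes "barycentric n v g" "i < n"
  shows "continuous_on S (g i)"
proof -
  obtain c a where g: "\<And>p. g i p = c + a \<bullet> p"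
    using barycentricD(1)[OF assms] by blast
  show ?thesis unfolding g[abs_def] by (intro continuous_intros)
qed

lemma compact_vertex_hull: "compact (convex hull ((v :: nat \<Rightarrow> 'a::euclidean_space) ` {..<n}))"
  by (intro finite_imp_compact_convex_hull) auto

lemma measure_compact_pos:
  fixes S :: "'a::euclidean_space set"
  assumes "compact S" "interior S \<noteq> {}"
  shows "measure lborel S > 0"
proof -
  have "\<not> negligible S"
    using assms(2) interior_subset negligible_subset open_not_negligible open_interior by metis
  then have "measure lebesgue S \<noteq> 0"
    using negligible_iff_measure0 lmeasurable_compact[OF assms(1)] by blast
  moreover have "measure lebesgue S = measure lborel S"
    using assms(1) by (intro measure_completion) (auto dest: compact_imp_closed)
  ultimately show ?thesis using measure_nonneg[of lborel S] by linarith
qed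

lemma barycentric_measure_pos:
  assumes "barycentric n v g"
  shows "measure lborel (convex hull (v ` {..<n})) > 0"
proof (rule measure_compact_pos[OF compact_vertex_hull])
  have n: "n > 0" using barycentricD(2)[OF assms] by (cases n) auto
  \<comment> \<open>The centroid lies in the open set where all coordinates are positive.\<close>
  define c where "c = (\<Sum>j<n. (1 / real n) *\<^sub>R v j)"
  have c: "g i c = 1 / n" if "i < n" for i
    unfolding c_def using that n by (subst barycentric_coordinate_of_sum[OF assms]) auto
  have "open {p. 0 < g i p}" if "i < n" for i
    using barycentric_continuous[OF assms that, of UNIV] by (intro open_Collect_less) auto
  then have "open (\<Inter>i\<in>{..<n}. {p. 0 < g i p})" by (intro open_INT) auto
  moreover have "(\<Inter>i\<in>{..<n}. {p. 0 < g i p}) \<subseteq> convex hull (v ` {..<n})"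
    unfolding barycentric_convex_hull[OF assms] by (auto intro: less_imp_le)
  moreover have "c \<in> (\<Inter>i\<in>{..<n}. {p. 0 < g i p})" using c n by auto
  ultimately show "interior (convex hull (v ` {..<n})) \<noteq> {}"
    by (metis empty_iff interior_maximal subsetD)
qed

text \<open>The hypothesis \<open>hyp\<close> says that no hyperplane contains all the vertices.
  Then the edges from \<open>v 0\<close> span the space, and as there are only
  \<open>DIM('a)\<close> of them they form a basis. Its dual basis, moved to \<open>v 0\<close>,
  gives the coordinates.\<close>

lemma barycentric_exists:
  fixes v :: "nat \<Rightarrow> 'a::euclidean_space"
  assumes n: "n = Suc DIM('a)"
    and hyp: "\<And>a b. (\<And>i. i < n \<Longrightarrow> a \<bullet> v i = b) \<Longrightarrow> a = 0"
  shows "\<exists>g. barycentric n v g"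
proof -
  define e where "e = (\<lambda>i. v i - v 0)"
  define B where "B = e ` {1..<n}"
  have spanB: "span B = UNIV"
  proof (rule ccontr)
    assume "span B \<noteq> UNIV"
    then obtain a where a: "a \<noteq> 0" "\<forall>x\<in>span B. a \<bullet> x = 0"
      using span_not_univ_subset_hyperplane by blast
    have "a \<bullet> v i = a \<bullet> v 0" if "i < n" for i
    proof (cases "i = 0")
      case False
      then have "e i \<in> span B" using that by (auto simp: B_def intro: span_base)
      then have "a \<bullet> e i = 0" using a(2) by blast
      then show ?thesis by (simp add: e_def inner_diff_right)
    qed simp
    then show False using hyp a(1) by blast
  qed
  have cB: "card B \<le> DIM('a)"
    using card_image_le[of "{1..<n}" e] n by (simp add: B_def)
  have finB: "finite B" by (simp add: B_def)
  have dimB: "dim B = DIM('a)" using spanB dim_span[of B] by simp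
  have cB': "card B = DIM('a)" using cB dim_le_card'[OF finB] dimB by simp
  have indep: "independent B"
    using card_le_dim_spanning[of B UNIV] finB spanB cB' by simp
  have inj: "inj_on e {1..<n}"
    by (rule eq_card_imp_inj_on) (use cB' n in \<open>auto simp: B_def\<close>)
  have "\<exists>f. linear f \<and> (\<forall>x\<in>B. f x = (if x = e i then 1 else 0 :: real))" for i
    by (rule linear_independent_extend[OF indep])
  then obtain f where f: "\<And>i. linear (f i)" "\<And>i x. x \<in> B \<Longrightarrow> f i x = (if x = e i then 1 else 0 :: real)"
    by metis
  \<comment> \<open>The coordinate of \<open>v 0\<close> is what the others leave of 1.\<close>
  define g where "g = (\<lambda>i p. if i = 0 then 1 - (\<Sum>j=1..<n. f j (p - v 0)) else f i (p - v 0))"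
  have split: "(\<Sum>i<n. h i) = h 0 + (\<Sum>i=1..<n. h i)" for h :: "nat \<Rightarrow> 'b::comm_monoid_add"
    using n by (metis atLeast0LessThan One_nat_def sum.atLeast_Suc_lessThan zero_less_Suc)
  have fe: "f i (e j) = (if i = j then 1 else 0)" if "i \<in> {1..<n}" "j \<in> {1..<n}" for i j
    using f(2)[of "e j" i] that inj by (auto simp: B_def inj_on_def)
  have aff: "\<exists>c a. \<forall>p. f i (p - v 0) = c + a \<bullet> p" for i
  proof -
    have "f i (p - v 0) = - f i (v 0) + (adjoint (f i) 1) \<bullet> p" for p
      using adjoint_works[OF f(1)[of i], of p 1] linear_diff[OF f(1)[of i], of p "v 0"]
      by (simp add: inner_commute)
    then show ?thesis by blast
  qed
  then obtain C A where CA: "\<And>i p. f i (p - v 0) = C i + A i \<bullet> p" by metis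
  have "barycentric n v g"
    unfolding barycentric_def
  proof (intro conjI allI impI)
    fix i assume "i < n"
    show "\<exists>c a. \<forall>p. g i p = c + a \<bullet> p"
    proof (cases "i = 0")
      case True
      have "g i p = (1 - (\<Sum>j=1..<n. C j)) + (- (\<Sum>j=1..<n. A j)) \<bullet> p" for p
        using True by (simp add: g_def CA sum.distrib inner_sum_left)
      then show ?thesis by blast
    next
      case False
      then show ?thesis using CA by (auto simp: g_def)
    qed
  next
    fix p
    show "(\<Sum>i<n. g i p) = 1" by (simp add: split g_def)
    have lin: "linear (\<lambda>x. \<Sum>i=1..<n. f i x *\<^sub>R e i)"
      by (intro linear_compose_sum) (auto simp: linear_iff linear_add[OF f(1)] linear_scale[OF f(1)] algebra_simps)
    have "(\<Sum>i=1..<n. f i x *\<^sub>R e i) = x" for x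
    proof (rule linear_eq_on_span[OF lin linear_id[unfolded id_def], where B=B])
      fix x assume "x \<in> B"
      then obtain j where j: "j \<in> {1..<n}" "x = e j" by (auto simp: B_def)
      have "(\<Sum>i=1..<n. f i x *\<^sub>R e i) = (\<Sum>i=1..<n. if i = j then e i else 0)"
        using j by (intro sum.cong) (auto simp: fe)
      then show "(\<Sum>i=1..<n. f i x *\<^sub>R e i) = x" using j by simp
    qed (simp add: spanB)
    then have *: "(\<Sum>i=1..<n. f i (p - v 0) *\<^sub>R e i) = p - v 0" .
    have "(\<Sum>i<n. g i p *\<^sub>R v i) = v 0 + (\<Sum>i=1..<n. f i (p - v 0) *\<^sub>R e i)"
      by (simp add: split g_def e_def algebra_simps sum_subtractf scaleR_left.sum)
    then show "(\<Sum>i<n. g i p *\<^sub>R v i) = p" using * by simp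
  next
    fix i j assume ij: "i < n" "j < n"
    have f0: "f k 0 = 0" for k using linear_0[OF f(1)] .
    have s: "(\<Sum>k=1..<n. f k (v j - v 0)) = (if j = 0 then 0 else 1)"
    proof (cases "j = 0")
      case False
      have "(\<Sum>k=1..<n. f k (v j - v 0)) = (\<Sum>k=1..<n. if k = j then 1 else 0)"
        using False ij fe[unfolded e_def] by (intro sum.cong) auto
      then show ?thesis using False ij by simp
    qed (simp add: f0)
    show "g i (v j) = (if i = j then 1 else 0)"
      using s ij f0 fe[unfolded e_def, of i j]
      by (cases "i = 0"; cases "j = 0") (auto simp: g_def)
  qed
  then show ?thesis by blast
qed

text \<open>A simplex inside a hyperplane is negligible. In this way the positive volume demanded in
  \<open>simplex_spline\<close> yields coordinates for an arbitrary admissible lift.\<close>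

lemma barycentric_exists_of_measure_pos:
  fixes v :: "nat \<Rightarrow> 'a::euclidean_space"
  assumes n: "n = Suc DIM('a)" and pos: "measure lborel (convex hull (v ` {..<n})) > 0"
  shows "\<exists>g. barycentric n v g"
proof (rule barycentric_exists[OF n])
  fix a b assume ab: "\<And>i. i < n \<Longrightarrow> a \<bullet> v i = b"
  show "a = 0"
  proof (rule ccontr)
    assume "a \<noteq> 0"
    have "convex hull (v ` {..<n}) \<subseteq> {x. a \<bullet> x = b}"
      by (rule hull_minimal) (use ab convex_hyperplane in auto)
    then have "negligible (convex hull (v ` {..<n}))"
      using negligible_hyperplane \<open>a \<noteq> 0\<close> negligible_subset by blast
    then have "measure lebesgue (convex hull (v ` {..<n})) = 0"
      using negligible_imp_measure0 by blast
    moreover have "measure lebesgue (convex hull (v ` {..<n})) = measure lborel (convex hull (v ` {..<n}))"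
      using compact_vertex_hull[of v n] by (intro measure_completion) (auto dest: compact_imp_closed)
    ultimately show False using pos by simp
  qed
qed

text \<open>Solve \<open>w = (\<Sum>i<n. g i w *\<^sub>R v i)\<close> for \<open>v j\<close> and
  substitute the result in the expansion of \<open>p\<close>.\<close>

lemma barycentric_replace_vertex:
  assumes b: "barycentric n v g" and j: "j < n" and w: "g j w \<noteq> 0"
  shows "barycentric n (v(j := w))
           (\<lambda>i p. if i = j then g j p / g j w else g i p - g i w * (g j p / g j w))"
    (is "barycentric n ?v ?g")
  unfolding barycentric_def
proof (intro conjI allI impI)
  fix i assume i: "i < n"
  obtain c a where g: "\<And>p. g i p = c + a \<bullet> p"
    using barycentricD(1)[OF b i] by blast
  obtain c' a' where g': "\<And>p. g j p = c' + a' \<bullet> p"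
    using barycentricD(1)[OF b j] by blast
  show "\<exists>c a. \<forall>p. ?g i p = c + a \<bullet> p"
  proof (cases "i = j")
    case True
    have "?g i p = c' / g j w + ((1 / g j w) *\<^sub>R a') \<bullet> p" for p
      using True by (simp add: g' add_divide_distrib)
    then show ?thesis by blast
  next
    case False
    have "?g i p = (c - g i w * c' / g j w) + (a - (g i w / g j w) *\<^sub>R a') \<bullet> p" for p
      using False by (simp add: g[of p] g'[of p] add_divide_distrib algebra_simps)
    then show ?thesis by blast
  qed
next
  fix p
  have split: "(\<Sum>i<n. h i) = h j + (\<Sum>i\<in>{..<n} - {j}. h i)" for h :: "nat \<Rightarrow> 'b::comm_monoid_add"
    using j by (simp add: sum.remove)
  have s: "(\<Sum>i\<in>{..<n} - {j}. g i p) = 1 - g j p" for p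
    using split[of "\<lambda>i. g i p"] barycentricD(2)[OF b, of p] by simp
  have t: "(\<Sum>i\<in>{..<n} - {j}. g i p *\<^sub>R v i) = p - g j p *\<^sub>R v j" for p
    using split[of "\<lambda>i. g i p *\<^sub>R v i"] barycentricD(3)[OF b, of p] by (simp add: algebra_simps)
  have "(\<Sum>i<n. ?g i p) = g j p / g j w + (\<Sum>i\<in>{..<n} - {j}. g i p - g i w * (g j p / g j w))"
    by (simp add: split)
  also have "\<dots> = g j p / g j w + ((1 - g j p) - (1 - g j w) * (g j p / g j w))"
    by (simp only: sum_subtractf sum_distrib_right[symmetric] s)
  also have "\<dots> = 1"
    using w by (simp add: field_simps)
  finally show "(\<Sum>i<n. ?g i p) = 1" .
  have "(\<Sum>i<n. ?g i p *\<^sub>R ?v i)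
      = (g j p / g j w) *\<^sub>R w + (\<Sum>i\<in>{..<n} - {j}. (g i p - g i w * (g j p / g j w)) *\<^sub>R v i)"
    by (simp add: split)
  also have "(\<Sum>i\<in>{..<n} - {j}. (g i p - g i w * (g j p / g j w)) *\<^sub>R v i)
      = (\<Sum>i\<in>{..<n} - {j}. g i p *\<^sub>R v i) - (g j p / g j w) *\<^sub>R (\<Sum>i\<in>{..<n} - {j}. g i w *\<^sub>R v i)"
    by (simp add: scaleR_sum_right sum_subtractf[symmetric] algebra_simps)
  also have "\<dots> = (p - g j p *\<^sub>R v j) - (g j p / g j w) *\<^sub>R (w - g j w *\<^sub>R v j)"
    by (simp add: t)
  finally show "(\<Sum>i<n. ?g i p *\<^sub>R ?v i) = p"
    using w by (simp add: algebra_simps)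
next
  fix i k assume "i < n" "k < n"
  then show "?g i (?v k) = (if i = k then 1 else 0)"
    using w j barycentricD(4)[OF b] by auto
qed

section \<open>Volume of a simplex under exchange of a vertex\<close>

text \<open>The determinant formula for simplices speaks of vectors indexed by a finite type,
  whereas lifted knots live in a product space. Reading off coordinates along \<open>Basis\<close>
  pulls boxes back to boxes with the same edge lengths, so it transports Lebesgue measure.\<close>

lemma distr_lborel_coordinates:
  fixes b :: "'n::finite \<Rightarrow> 'a::euclidean_space"
  assumes b: "bij_betw b UNIV Basis"
  defines "\<phi> \<equiv> (\<lambda>p. \<chi> i. p \<bullet> b i) :: 'a \<Rightarrow> real^'n"
  shows "distr lborel borel \<phi> = lborel"
proof (rule sym, rule lborel_eqI)
  have lin: "linear \<phi>" by (auto simp: linear_iff \<phi>_def vec_eq_iff inner_simps)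
  have meas [measurable]: "\<phi> \<in> borel_measurable borel"
    using linear_continuous_on[of \<phi> UNIV] lin
    by (intro borel_measurable_continuous_onI) (simp add: linear_conv_bounded_linear)
  have [simp]: "b i \<in> Basis" for i using b by (auto simp: bij_betw_def)
  have inj: "inj b" using b by (auto simp: bij_betw_def)
  fix l u :: "real^'n" assume le: "\<And>c. c \<in> Basis \<Longrightarrow> l \<bullet> c \<le> u \<bullet> c"
  then have le': "l $ i \<le> u $ i" for i
    using le[of "axis i 1"] by (simp add: inner_axis axis_in_Basis_iff)
  \<comment> \<open>\<open>L\<close> inverts the coordinate map, so it carries the corners of a box
    to those of its preimage.\<close>
  define L where "L = (\<lambda>z :: real^'n. \<Sum>i\<in>UNIV. (z $ i) *\<^sub>R b i)"
  have Lb: "L z \<bullet> b i = z $ i" for z i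
  proof -
    have "L z \<bullet> b i = (\<Sum>j\<in>UNIV. if j = i then z $ j else 0)"
      using inj unfolding L_def inner_sum_left
      by (intro sum.cong) (auto simp: inner_Basis inj_eq)
    then show ?thesis by simp
  qed
  have Bas: "(\<forall>c\<in>Basis. P c) \<longleftrightarrow> (\<forall>i. P (b i))" for P
    using b unfolding bij_betw_def by (metis UNIV_I image_iff)
  have "\<phi> p \<in> box l u \<longleftrightarrow> p \<in> box (L l) (L u)" for p
    unfolding mem_box_cart mem_box(1)[of p] Bas by (simp add: Lb \<phi>_def)
  then have "\<phi> -` box l u = box (L l) (L u)" by auto
  then have "emeasure (distr lborel borel \<phi>) (box l u) = emeasure lborel (box (L l) (L u))"
    by (subst emeasure_distr) auto
  also have "\<dots> = (\<Prod>c\<in>Basis. (L u - L l) \<bullet> c)"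
    using Bas[of "\<lambda>c. L l \<bullet> c \<le> L u \<bullet> c"] le' Lb by (intro emeasure_lborel_box) auto
  also have "(\<Prod>c\<in>Basis. (L u - L l) \<bullet> c) = (\<Prod>i\<in>UNIV. u $ i - l $ i)"
    by (subst prod.reindex_bij_betw[OF b, symmetric]) (simp add: inner_diff_left Lb)
  also have "(\<Prod>i\<in>UNIV. u $ i - l $ i) = (\<Prod>c\<in>Basis. (u - l) \<bullet> c)"
  proof -
    have "bij_betw (\<lambda>i::'n. axis i (1::real)) UNIV Basis"
      by (auto simp: bij_betw_def inj_on_def axis_eq_axis Basis_vec_def)
    from prod.reindex_bij_betw[OF this, of "\<lambda>c. (u - l) \<bullet> c"]
    show ?thesis by (simp add: inner_axis)
  qed
  finally show "emeasure (distr lborel borel \<phi>) (box l u) = (\<Prod>c\<in>Basis. (u - l) \<bullet> c)" .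
qed simp

text \<open>The volume is a multiple of the determinant of the edges from a fixed vertex. By
  Cramer's rule, replacing a column of \<open>M\<close> by \<open>M *v x\<close> multiplies the
  determinant by the matching entry of \<open>x\<close>, here \<open>g j w\<close>.\<close>

lemma measure_simplex_replace_vertex:
  fixes v :: "nat \<Rightarrow> 'a::euclidean_space" and b :: "'n::{finite,wellorder} \<Rightarrow> 'a"
  assumes b: "bij_betw b UNIV Basis"
    and n: "n = Suc DIM('a)"
    and bary: "barycentric n v g" and j: "j < n" and w: "g j w \<noteq> 0"
  shows "measure lborel (convex hull ((v(j := w)) ` {..<n}))
       = \<bar>g j w\<bar> * measure lborel (convex hull (v ` {..<n}))"
proof -
  define \<phi> :: "'a \<Rightarrow> (real, 'n) vec" where "\<phi> = (\<lambda>p. \<chi> i. p \<bullet> b i)"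
  have lin: "linear \<phi>" by (auto simp: linear_iff \<phi>_def vec_eq_iff inner_simps)
  have meas [measurable]: "\<phi> \<in> borel_measurable borel"
    using linear_continuous_on[of \<phi> UNIV] lin
    by (intro borel_measurable_continuous_onI) (simp add: linear_conv_bounded_linear)
  have inj: "inj \<phi>"
  proof (rule injI)
    fix p q assume "\<phi> p = \<phi> q"
    then have "\<forall>i. p \<bullet> b i = q \<bullet> b i" by (simp add: \<phi>_def vec_eq_iff)
    then have "\<forall>c\<in>range b. p \<bullet> c = q \<bullet> c" by auto
    then have "\<forall>c\<in>Basis. p \<bullet> c = q \<bullet> c" by (simp only: bij_betw_imp_surj_on[OF b])
    then show "p = q" by (auto intro: euclidean_eqI)
  qed
  have card: "CARD('n) = DIM('a)" using b bij_betw_same_card by blast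
  have meq: "measure lborel (convex hull (u ` {..<n})) = measure lborel (convex hull ((\<phi> \<circ> u) ` {..<n}))" for u
  proof -
    have "convex hull ((\<phi> \<circ> u) ` {..<n}) = \<phi> ` (convex hull (u ` {..<n}))"
      using convex_hull_linear_image[OF lin, of "u ` {..<n}"] by (simp add: image_comp)
    moreover have "compact (convex hull ((\<phi> \<circ> u) ` {..<n}))" by (rule compact_vertex_hull)
    then have "convex hull ((\<phi> \<circ> u) ` {..<n}) \<in> sets borel" by (simp add: compact_imp_closed)
    then have "measure (distr lborel borel \<phi>) (convex hull ((\<phi> \<circ> u) ` {..<n}))
        = measure lborel (\<phi> -` (convex hull ((\<phi> \<circ> u) ` {..<n})))"
      by (subst measure_distr) auto
    ultimately show ?thesis
      using inj distr_lborel_coordinates[OF b] by (simp add: inj_vimage_image_eq \<phi>_def)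
  qed
  \<comment> \<open>The edges start at a vertex \<open>k\<close> other than \<open>j\<close>, so
    that moving \<open>v j\<close> changes a single column.\<close>
  have "n \<ge> 2" using n DIM_positive[where 'a='a] by linarith
  then obtain k where k: "k < n" "k \<noteq> j"
    using that[of "if j = 0 then 1 else 0"] by (auto split: if_splits)
  have "card ({..<n} - {k}) = CARD('n)" using k n card by simp
  then obtain f :: "'n \<Rightarrow> nat" where f: "bij_betw f UNIV ({..<n} - {k})"
    using finite_same_card_bij[of "UNIV :: 'n set" "{..<n} - {k}"] by auto
  have fn: "f i < n" "f i \<noteq> k" for i using f by (auto simp: bij_betw_def)
  have vol: "measure lborel (convex hull (u ` {..<n}))
       = \<bar>det (\<chi> i. \<chi> r. \<phi> (u (f r)) $ i - \<phi> (u k) $ i)\<bar> / fact CARD('n)"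
    if "barycentric n u h" for u h
  proof -
    have iu: "inj_on u {..<n}"
    proof (rule inj_onI)
      fix x y assume "x \<in> {..<n}" "y \<in> {..<n}" "u x = u y"
      then show "x = y"
        using barycentricD(4)[OF that, of x x] barycentricD(4)[OF that, of x y]
        by (auto split: if_splits)
    qed
    have iu: "inj_on (\<phi> \<circ> u) {..<n}"
      using comp_inj_on[OF iu, of \<phi>] inj inj_on_subset by blast
    have "bij_betw (\<phi> \<circ> u) ({..<n} - {k}) ((\<phi> \<circ> u) ` ({..<n} - {k}))"
      using iu by (auto simp: bij_betw_def inj_on_def)
    then have bb: "bij_betw ((\<phi> \<circ> u) \<circ> f) UNIV ((\<phi> \<circ> u) ` {..<n} - {(\<phi> \<circ> u) k})"
      using bij_betw_trans[OF f] k inj_on_image_set_diff[OF iu, of "{..<n}" "{k}"] by auto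
    have c: "card ((\<phi> \<circ> u) ` {..<n}) = Suc CARD('n)"
      using card_image[OF iu] n card by simp
    show ?thesis
      unfolding meq
      using content_simplex[OF _ c _ bb] k by simp
  qed
  have "j \<in> range f" using k j by (simp add: bij_betw_imp_surj_on[OF f])
  then obtain r where r: "f r = j" by auto
  have fr: "f i = j \<longleftrightarrow> i = r" for i
    using bij_betw_imp_inj_on[OF f] r by (auto dest: injD)
  define M :: "((real, 'n) vec, 'n) vec" where "M = (\<chi> i. \<chi> r. \<phi> (v (f r)) $ i - \<phi> (v k) $ i)"
  have Mnth: "M $ i $ l = \<phi> (v (f l)) $ i - \<phi> (v k) $ i" for i l by (simp add: M_def)
  define x :: "(real, 'n) vec" where "x = (\<chi> i. g (f i) w)"
  have split: "(\<Sum>i<n. h i) = h k + (\<Sum>i\<in>UNIV. h (f i))" for h :: "nat \<Rightarrow> 'c::comm_monoid_add"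
    using k sum.reindex_bij_betw[OF f, of h] sum.remove[of "{..<n}" k h] by simp
  \<comment> \<open>The coordinates of \<open>w\<close> sum to 1; this eliminates the coordinate of
    the base vertex \<open>v k\<close> and leaves only edges.\<close>
  have Mx: "M *v x = \<phi> w - \<phi> (v k)"
  proof -
    have s: "(\<Sum>i\<in>UNIV. g (f i) w) = 1 - g k w"
      using split[of "\<lambda>i. g i w"] barycentricD(2)[OF bary, of w] by simp
    have "w = (\<Sum>i<n. g i w *\<^sub>R v i)" using barycentricD(3)[OF bary] by simp
    then have "\<phi> w = \<phi> (\<Sum>i<n. g i w *\<^sub>R v i)" by simp
    also have "\<dots> = (\<Sum>i<n. g i w *\<^sub>R \<phi> (v i))"
      by (simp add: linear_sum[OF lin] linear_scale[OF lin])
    finally have "\<phi> w = (\<Sum>i<n. g i w *\<^sub>R \<phi> (v i))" .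
    then have "\<phi> w = g k w *\<^sub>R \<phi> (v k) + (\<Sum>i\<in>UNIV. g (f i) w *\<^sub>R \<phi> (v (f i)))"
      by (simp add: split)
    then have "\<phi> w $ i = g k w * \<phi> (v k) $ i + (\<Sum>l\<in>UNIV. g (f l) w * \<phi> (v (f l)) $ i)" for i
      by (simp add: vec_eq_iff)
    moreover have "(M *v x) $ i = (\<Sum>l\<in>UNIV. g (f l) w * \<phi> (v (f l)) $ i) - (\<Sum>l\<in>UNIV. g (f l) w) * \<phi> (v k) $ i" for i
      by (simp add: M_def x_def matrix_vector_mult_def sum_subtractf sum_distrib_left right_diff_distrib mult_ac)
    ultimately show ?thesis by (simp add: vec_eq_iff s algebra_simps)
  qed
  have "det (\<chi> i. \<chi> l. \<phi> ((v(j := w)) (f l)) $ i - \<phi> ((v(j := w)) k) $ i)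
      = det (\<chi> i l. if l = r then (M *v x) $ i else M $ i $ l)"
    using k Mnth by (intro arg_cong[where f=det]) (auto simp: vec_eq_iff Mx fr)
  also have "\<dots> = g j w * det M"
    by (simp add: cramer_lemma x_def r)
  finally show ?thesis
    using vol[OF barycentric_replace_vertex[OF bary j w]] vol[OF bary]
    by (simp add: M_def abs_mult)
qed

section \<open>Fibres and lifts\<close>

lemma measure_lebesgue_compact:
  fixes S :: "'a::euclidean_space set"
  assumes "compact S"
  shows "measure lebesgue S = measure lborel S"
  using assms by (intro measure_completion) (auto dest: compact_imp_closed)

lemma compact_fibre:
  fixes S :: "('a::euclidean_space \<times> 'b::euclidean_space) set"
  assumes "compact S"
  shows "compact {z. (x, z) \<in> S}"
proof -
  have "closed (Pair x -` S)"
    by (intro continuous_closed_vimage compact_imp_closed assms) (auto intro!: continuous_intros)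
  moreover have "bounded (Pair x -` S)"
    by (rule bounded_subset[OF bounded_snd[OF compact_imp_bounded[OF assms]]]) force
  ultimately show ?thesis by (simp add: compact_eq_bounded_closed vimage_def)
qed

lemma emeasure_fibre:
  fixes S :: "('a::euclidean_space \<times> 'b::euclidean_space) set"
  assumes "compact S"
  shows "emeasure lborel {z. (x, z) \<in> S} = ennreal (measure lborel {z. (x, z) \<in> S})"
  using emeasure_compact_finite[OF compact_fibre[OF assms, of x]]
  by (simp add: emeasure_eq_ennreal_measure less_top[symmetric])

lemma emeasure_fibres:
  fixes S :: "('a::euclidean_space \<times> 'b::euclidean_space) set"
  assumes "compact S"
  shows "emeasure lborel S = (\<integral>\<^sup>+x. ennreal (measure lborel {z. (x, z) \<in> S}) \<partial>lborel)"
proof -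
  have "S \<in> sets (lborel \<Otimes>\<^sub>M lborel)"
    using assms unfolding lborel_prod by (simp add: compact_imp_closed)
  from lborel.emeasure_pair_measure_alt[OF this] show ?thesis
    by (simp add: lborel_prod vimage_def emeasure_fibre[OF assms])
qed

text \<open>The affine map between two lifts of the same knots fixes the first component, so on
  every fibre it acts by one and the same linear map up to translation.\<close>
lemma lift_change:
  fixes v v' :: "nat \<Rightarrow> (real^2) \<times> (real^3)"
  assumes b: "barycentric n v g" and b': "barycentric n v' g'"
    and eq: "\<And>i. i < n \<Longrightarrow> fst (v i) = fst (v' i)"
  shows "\<exists>d. (\<forall>x. measure lborel {z. (x, z) \<in> convex hull (v' ` {..<n})}
                = d * measure lborel {z. (x, z) \<in> convex hull (v ` {..<n})}) \<and>
             measure lborel (convex hull (v' ` {..<n})) = d * measure lborel (convex hull (v ` {..<n}))"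
proof -
  let ?S = "convex hull (v ` {..<n})" and ?S' = "convex hull (v' ` {..<n})"
  have "\<exists>c a. \<forall>p. g i p = c + a \<bullet> p" if "i < n" for i using barycentricD(1)[OF b that] .
  then obtain c a where g: "\<And>i p. i < n \<Longrightarrow> g i p = c i + a i \<bullet> p" by metis
  define L where "L = (\<lambda>p. \<Sum>i<n. g i p *\<^sub>R v' i)"
  define A where "A = (\<lambda>z. \<Sum>i<n. (snd (a i) \<bullet> z) *\<^sub>R snd (v' i))"
  define K where "K = (\<lambda>x. \<Sum>i<n. (c i + fst (a i) \<bullet> x) *\<^sub>R snd (v' i))"
  have L1: "fst (L p) = fst p" for p
  proof -
    have "fst (L p) = (\<Sum>i<n. g i p *\<^sub>R fst (v i))" by (simp add: L_def fst_sum eq)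
    also have "\<dots> = fst (\<Sum>i<n. g i p *\<^sub>R v i)" by (simp add: fst_sum)
    finally show ?thesis using barycentricD(3)[OF b] by simp
  qed
  have L2: "snd (L (x, z)) = A z + K x" for x z
    by (simp add: L_def A_def K_def snd_sum g inner_prod_def sum.distrib[symmetric]
        scaleR_left_distrib[symmetric] add_ac)
  have L: "L (x, z) = (x, A z + K x)" for x z
    using L1[of "(x, z)"] L2[of x z] by (simp add: prod_eq_iff)
  have fib: "{z. (x, z) \<in> ?S'} = (\<lambda>z. K x + z) ` A ` {z. (x, z) \<in> ?S}" for x
  proof (intro equalityI subsetI)
    fix z' assume z': "z' \<in> {z. (x, z) \<in> ?S'}"
    \<comment> \<open>The preimage under \<open>L\<close> is the point with the same barycentric
      coordinates with respect to \<open>v\<close>.\<close>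
    define p where "p = (\<Sum>i<n. g' i (x, z') *\<^sub>R v i)"
    have "fst p = fst (\<Sum>i<n. g' i (x, z') *\<^sub>R v' i)" by (simp add: p_def fst_sum eq)
    then have p: "p = (x, snd p)" using barycentricD(3)[OF b'] by (simp add: prod_eq_iff)
    have gp: "g i p = g' i (x, z')" if "i < n" for i
      unfolding p_def using that by (intro barycentric_coordinate_of_sum[OF b]) (auto simp: barycentricD(2)[OF b'])
    then have "L p = (x, z')"
      using barycentricD(3)[OF b', of "(x, z')"] by (simp add: L_def)
    moreover have "p \<in> ?S"
      using z' gp by (auto simp: barycentric_convex_hull[OF b] barycentric_convex_hull[OF b'])
    ultimately show "z' \<in> (\<lambda>z. K x + z) ` A ` {z. (x, z) \<in> ?S}"
      using p L[of x "snd p"] by (auto simp: image_iff add.commute intro!: exI[of _ "snd p"])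
  next
    fix z' assume "z' \<in> (\<lambda>z. K x + z) ` A ` {z. (x, z) \<in> ?S}"
    then obtain z where z: "(x, z) \<in> ?S" "(x, z') = L (x, z)" by (auto simp: L add.commute)
    have "g' i (L (x, z)) = g i (x, z)" if "i < n" for i
      unfolding L_def using that by (intro barycentric_coordinate_of_sum[OF b']) (auto simp: barycentricD(2)[OF b])
    then show "z' \<in> {z. (x, z) \<in> ?S'}"
      using z by (auto simp: barycentric_convex_hull[OF b] barycentric_convex_hull[OF b'])
  qed
  have lin: "linear A"
    by (auto simp: linear_iff A_def inner_add_right scaleR_left_distrib sum.distrib scaleR_sum_right)
  define d where "d = \<bar>det (matrix A)\<bar>"
  have F: "measure lborel {z. (x, z) \<in> ?S'} = d * measure lborel {z. (x, z) \<in> ?S}" for x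
  proof -
    have c: "compact {z. (x, z) \<in> ?S}" "compact {z. (x, z) \<in> ?S'}"
      by (intro compact_fibre compact_vertex_hull)+
    have "measure lebesgue {z. (x, z) \<in> ?S'} = measure lebesgue (A ` {z. (x, z) \<in> ?S})"
      unfolding fib by (rule measure_translation)
    also have "\<dots> = d * measure lebesgue {z. (x, z) \<in> ?S}"
      unfolding d_def by (rule measure_linear_image[OF lin lmeasurable_compact[OF c(1)]])
    finally show ?thesis by (simp add: measure_lebesgue_compact c)
  qed
  have "(\<lambda>x. ennreal (measure lborel {z. (x, z) \<in> ?S})) \<in> borel_measurable lborel"
  proof -
    have "?S \<in> sets (lborel \<Otimes>\<^sub>M lborel)"
      unfolding lborel_prod using compact_vertex_hull[of v n] by (simp add: compact_imp_closed)
    from lborel.measurable_emeasure_Pair[OF this]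
    show ?thesis
      unfolding vimage_def emeasure_fibre[OF compact_vertex_hull, symmetric] .
  qed
  then have "emeasure lborel ?S' = ennreal d * emeasure lborel ?S"
    by (simp add: emeasure_fibres compact_vertex_hull F ennreal_mult d_def nn_integral_cmult)
  then have "measure lborel ?S' = d * measure lborel ?S"
    by (simp add: measure_def enn2real_mult d_def)
  with F show ?thesis by blast
qed

lemma set_zip_nth:
  assumes "length xs = n" "length ys = n"
  shows "set (zip xs ys) = (\<lambda>i. (xs ! i, ys ! i)) ` {..<n}"
  using assms by (auto simp: set_zip)

text \<open>Two admissible lifts differ by the factor \<open>d\<close> of \<open>lift_change\<close>
  in numerator and denominator alike, and \<open>d\<close> is nonzero because the volumes are
  positive. So \<open>SOME\<close> has a single candidate, and a spline may be computed from any
  convenient lift.\<close>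

lemma simplex_spline_eq:
  fixes v :: "nat \<Rightarrow> (real^2) \<times> (real^3)"
  assumes b: "barycentric 6 v g" and len: "length Xs = 6"
    and fst: "\<And>i. i < 6 \<Longrightarrow> fst (v i) = Xs ! i"
  shows "simplex_spline Xs x
       = measure lborel {z. (x, z) \<in> convex hull (v ` {..<6})} / measure lborel (convex hull (v ` {..<6}))"
  unfolding simplex_spline_def Let_def
proof (rule some_equality)
  define zs where "zs = map (snd \<circ> v) [0..<6]"
  have zs: "length zs = 6" by (simp add: zs_def)
  have "(Xs ! i, zs ! i) = v i" if "i < 6" for i
    using that fst by (simp add: zs_def prod_eq_iff)
  then have "set (zip Xs zs) = v ` {..<6}"
    unfolding set_zip_nth[OF len zs] by auto
  then show "\<exists>zs :: (real^3) list. length zs = length Xs \<and> 0 < measure lborel (convex hull set (zip Xs zs)) \<and>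
      measure lborel {z. (x, z) \<in> convex hull (v ` {..<6})} / measure lborel (convex hull (v ` {..<6})) =
      measure lborel {z. (x, z) \<in> convex hull set (zip Xs zs)} / measure lborel (convex hull set (zip Xs zs))"
    using zs len barycentric_measure_pos[OF b] by (intro exI[of _ zs]) simp
next
  fix r assume "\<exists>zs :: (real^3) list. length zs = length Xs \<and> 0 < measure lborel (convex hull set (zip Xs zs)) \<and>
      r = measure lborel {z. (x, z) \<in> convex hull set (zip Xs zs)} / measure lborel (convex hull set (zip Xs zs))"
  then obtain zs :: "(real^3) list" where zs: "length zs = 6"
    and pos: "0 < measure lborel (convex hull set (zip Xs zs))"
    and r: "r = measure lborel {z. (x, z) \<in> convex hull set (zip Xs zs)} / measure lborel (convex hull set (zip Xs zs))"
    using len by auto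
  define v' where "v' = (\<lambda>i. (Xs ! i, zs ! i))"
  have S: "set (zip Xs zs) = v' ` {..<6}" unfolding v'_def by (rule set_zip_nth[OF len zs])
  obtain g' where b': "barycentric 6 v' g'"
    using barycentric_exists_of_measure_pos[of 6 v'] pos unfolding S by auto
  obtain d where d: "\<And>x. measure lborel {z. (x, z) \<in> convex hull (v' ` {..<6})}
                = d * measure lborel {z. (x, z) \<in> convex hull (v ` {..<6})}"
      "measure lborel (convex hull (v' ` {..<6})) = d * measure lborel (convex hull (v ` {..<6}))"
    using lift_change[OF b b'] fst by (auto simp: v'_def)
  have "d \<noteq> 0" using pos d(2) unfolding S by auto
  then show "r = measure lborel {z. (x, z) \<in> convex hull (v ` {..<6})} / measure lborel (convex hull (v ` {..<6}))"
    unfolding r S d by simp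
qed

text \<open>Permuting the heights together with the knots gives the same set of lifted
  vertices.\<close>

lemma simplex_spline_mset:
  assumes "mset Xs = mset Ys"
  shows "simplex_spline Xs = simplex_spline Ys"
proof -
  have imp: "\<exists>zs :: (real^3) list. length zs = length Ys \<and> P (set (zip Ys zs))"
    if m: "mset Xs = mset Ys" and ex: "\<exists>zs :: (real^3) list. length zs = length Xs \<and> P (set (zip Xs zs))"
    for P and Xs Ys :: "(real^2) list"
  proof -
    obtain zs :: "(real^3) list" where zs: "length zs = length Xs" "P (set (zip Xs zs))" using ex by blast
    obtain \<pi> where \<pi>: "\<pi> permutes {..<length Xs}" "permute_list \<pi> Xs = Ys"
      using mset_eq_permutation[OF m[symmetric]] by blast
    have "zip Ys (permute_list \<pi> zs) = permute_list \<pi> (zip Xs zs)"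
      using permute_list_zip[OF \<pi>(1) refl zs(1)[symmetric]] \<pi>(2) by simp
    moreover have "set (permute_list \<pi> (zip Xs zs)) = set (zip Xs zs)"
      using \<pi>(1) zs(1) by simp
    ultimately show ?thesis
      using zs \<pi> by (intro exI[of _ "permute_list \<pi> zs"]) auto
  qed
  have "(\<exists>zs :: (real^3) list. length zs = length Xs \<and> P (set (zip Xs zs)))
      = (\<exists>zs :: (real^3) list. length zs = length Ys \<and> P (set (zip Ys zs)))" for P
    using imp[OF assms] imp[OF assms[symmetric]] by metis
  from this[of "\<lambda>S. 0 < measure lborel (convex hull S) \<and>
      r = measure lborel {z. (x, z) \<in> convex hull S} / measure lborel (convex hull S)" for r x]
  show ?thesis
    unfolding simplex_spline_def Let_def by (intro ext) (simp only:)
qed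

section \<open>Knot insertion\<close>

lemma collinear_hyperplane2:
  fixes a :: "real^2"
  assumes "a \<noteq> 0"
  shows "collinear {u. a \<bullet> u = b}"
  using aff_dim_hyperplane[OF assms, of b] by (simp add: collinear_aff_dim)

text \<open>If \<open>h\<close> varies along the fibre, its zeros there form a plane. Otherwise
  \<open>h\<close> comes from an affine function on R^2. If that one vanished at \<open>x\<close>,
  it would be nonconstant because of \<open>h p0\<close>, and its zero line would contain
  \<open>x\<close> and the projection of \<open>S\<close>.\<close>

lemma negligible_affine_zero_fibre:
  fixes S :: "((real^2) \<times> (real^3)) set"
  assumes h: "\<And>p. h p = c + a \<bullet> p" and S: "\<And>p. p \<in> S \<Longrightarrow> h p = 0"
    and nz: "h p0 \<noteq> 0" and col: "\<not> collinear (insert x (fst ` S))"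
  shows "negligible {z. h (x, z) = 0}"
proof (cases "snd a = 0")
  case False
  have eq: "{z. h (x, z) = 0} = {z. snd a \<bullet> z = - (c + fst a \<bullet> x)}"
    by (auto simp: h inner_prod_def)
  show ?thesis unfolding eq by (rule negligible_hyperplane) (use False in simp)
next
  case True
  have hx: "h p = c + fst a \<bullet> fst p" for p using True by (simp add: h inner_prod_def)
  have "c + fst a \<bullet> x \<noteq> 0"
  proof
    assume 0: "c + fst a \<bullet> x = 0"
    have "fst a \<noteq> 0"
    proof
      assume "fst a = 0"
      then show False using 0 nz hx[of p0] by simp
    qed
    then have "collinear {u. fst a \<bullet> u = - c}" by (rule collinear_hyperplane2)
    moreover have "insert x (fst ` S) \<subseteq> {u. fst a \<bullet> u = - c}"
      using 0 S by (auto simp: hx eq_neg_iff_add_eq_0 add.commute[of _ c])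
    ultimately show False using col collinear_subset by blast
  qed
  then have "{z. h (x, z) = 0} = {}" by (simp add: hx)
  then show ?thesis by simp
qed

text \<open>For points in general position, the two facets of the simplex that see the ray from \<open>w\<close>
  through the given point are the last one with positive and the first one with negative weight.\<close>
lemma signed_indicator_identity:
  fixes \<gamma> u :: "'i \<Rightarrow> real"
  assumes fin: "finite I" and sum: "sum \<gamma> I = 1"
    and nz: "\<And>i. i \<in> I \<Longrightarrow> \<gamma> i \<noteq> 0 \<Longrightarrow> u i \<noteq> 0"
    and gen: "\<And>i k. i \<in> I \<Longrightarrow> k \<in> I \<Longrightarrow> i \<noteq> k \<Longrightarrow> \<gamma> i \<noteq> 0 \<Longrightarrow> \<gamma> k \<noteq> 0 \<Longrightarrow>
                \<gamma> k * u i \<noteq> \<gamma> i * u k"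
  defines "ok \<equiv> \<lambda>i. 0 \<le> u i / \<gamma> i \<and> (\<forall>k\<in>I - {i}. 0 \<le> u k - \<gamma> k * (u i / \<gamma> i))"
  shows "of_bool (\<forall>i\<in>I. 0 \<le> u i) = (\<Sum>i\<in>I. sgn (\<gamma> i) * of_bool (ok i))"
proof -
  define P where "P = {i\<in>I. \<gamma> i > 0}"
  define N where "N = {i\<in>I. \<gamma> i < 0}"
  define Z where "Z = {i\<in>I. \<gamma> i = 0}"
  \<comment> \<open>\<open>t i\<close> is the value of \<open>s\<close> at which coordinate
    \<open>i\<close> of \<open>u - s * \<gamma>\<close> vanishes. For positive weight the coordinate
    is nonnegative up to that value, for negative weight from it on.\<close>
  define t where "t = (\<lambda>i. u i / \<gamma> i)"
  have I: "I = P \<union> N \<union> Z" by (auto simp: P_def N_def Z_def)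
  have finPN: "finite P" "finite N" using fin by (auto simp: P_def N_def)
  have tne: "t i \<noteq> t k" if "i \<in> P \<union> N" "k \<in> P \<union> N" "i \<noteq> k" for i k
    using gen[of i k] that by (auto simp: P_def N_def t_def field_simps)
  have t0: "t i \<noteq> 0" if "i \<in> P \<union> N" for i
    using nz[of i] that by (auto simp: P_def N_def t_def)
  have up: "u k = \<gamma> k * t k" if "k \<in> P \<union> N" for k
    using that by (auto simp: P_def N_def t_def)
  have pos: "0 \<le> u k - \<gamma> k * s \<longleftrightarrow> s \<le> t k" if "k \<in> P" for k s
    using that by (auto simp: P_def t_def field_simps)
  have neg: "0 \<le> u k - \<gamma> k * s \<longleftrightarrow> t k \<le> s" if "k \<in> N" for k s
    using that by (auto simp: N_def t_def field_simps)
  have zero: "0 \<le> u k - \<gamma> k * s \<longleftrightarrow> 0 \<le> u k" if "k \<in> Z" for k s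
    using that by (auto simp: Z_def)
  have ok: "ok i \<longleftrightarrow> 0 \<le> t i \<and> (\<forall>k\<in>P. t i \<le> t k) \<and> (\<forall>k\<in>N. t k \<le> t i) \<and> (\<forall>k\<in>Z. 0 \<le> u k)"
    if "i \<in> P \<union> N" for i
  proof -
    have "(\<forall>k\<in>I - {i}. 0 \<le> u k - \<gamma> k * t i) \<longleftrightarrow> (\<forall>k\<in>I. 0 \<le> u k - \<gamma> k * t i)"
      using up[OF that] by (auto simp: Ball_def)
    also have "\<dots> \<longleftrightarrow> (\<forall>k\<in>P. t i \<le> t k) \<and> (\<forall>k\<in>N. t k \<le> t i) \<and> (\<forall>k\<in>Z. 0 \<le> u k)"
      unfolding I ball_Un using pos neg zero by auto
    finally have *: "(\<forall>k\<in>I - {i}. 0 \<le> u k - \<gamma> k * t i) \<longleftrightarrow>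
      (\<forall>k\<in>P. t i \<le> t k) \<and> (\<forall>k\<in>N. t k \<le> t i) \<and> (\<forall>k\<in>Z. 0 \<le> u k)" .
    have "u i / \<gamma> i = t i" by (simp add: t_def)
    then show ?thesis by (simp only: ok_def *)
  qed
  have L: "(\<forall>i\<in>I. 0 \<le> u i) \<longleftrightarrow> (\<forall>k\<in>P. 0 \<le> t k) \<and> (\<forall>k\<in>N. t k \<le> 0) \<and> (\<forall>k\<in>Z. 0 \<le> u k)"
    unfolding I ball_Un using pos[of _ 0] neg[of _ 0] by auto
  have "P \<noteq> {}"
  proof
    assume "P = {}"
    then have "sum \<gamma> I \<le> 0" by (intro sum_nonpos) (auto simp: P_def not_less)
    with sum show False by simp
  qed
  \<comment> \<open>All \<open>t\<close> are distinct on \<open>P\<close> and \<open>N\<close>.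
    Among the positive weights only the index with the smallest \<open>t\<close> can satisfy
    \<open>ok\<close>, among the negative ones only that with the largest.\<close>
  define a where "a = arg_min_on t P"
  have a: "a \<in> P" "\<And>k. k \<in> P \<Longrightarrow> t a \<le> t k"
    using arg_min_if_finite(1)[OF finPN(1) \<open>P \<noteq> {}\<close>, of t] arg_min_least[OF finPN(1) \<open>P \<noteq> {}\<close>, of _ t]
    by (auto simp: a_def)
  have oka: "ok a \<longleftrightarrow> 0 \<le> t a \<and> (\<forall>k\<in>N. t k \<le> t a) \<and> (\<forall>k\<in>Z. 0 \<le> u k)"
    using ok[of a] a by auto
  have other: "\<not> ok i" if "i \<in> P" "i \<noteq> a" for i
    using ok[of i] a that tne[of i a] by force
  have "(\<Sum>i\<in>I. sgn (\<gamma> i) * of_bool (ok i))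
      = (\<Sum>i\<in>P. of_bool (ok i)) - (\<Sum>i\<in>N. of_bool (ok i :: bool) :: real)"
  proof -
    have "(\<Sum>i\<in>I. sgn (\<gamma> i) * of_bool (ok i)) = (\<Sum>i\<in>P. sgn (\<gamma> i) * of_bool (ok i))
        + (\<Sum>i\<in>N. sgn (\<gamma> i) * of_bool (ok i)) + (\<Sum>i\<in>Z. sgn (\<gamma> i) * of_bool (ok i))"
      unfolding I using finPN fin by (subst sum.union_disjoint; (subst sum.union_disjoint)?)
        (auto simp: P_def N_def Z_def)
    moreover have "(\<Sum>i\<in>P. sgn (\<gamma> i) * of_bool (ok i)) = (\<Sum>i\<in>P. of_bool (ok i) :: real)"
      by (intro sum.cong) (auto simp: P_def)
    moreover have "(\<Sum>i\<in>N. sgn (\<gamma> i) * of_bool (ok i)) = (\<Sum>i\<in>N. - of_bool (ok i) :: real)"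
      by (intro sum.cong) (auto simp: N_def)
    moreover have "(\<Sum>i\<in>Z. sgn (\<gamma> i) * of_bool (ok i)) = 0"
      by (intro sum.neutral) (auto simp: Z_def)
    ultimately show ?thesis by (simp add: sum_negf)
  qed
  also have "(\<Sum>i\<in>P. of_bool (ok i) :: real) = (\<Sum>i\<in>{a}. of_bool (ok i))"
    using a(1) finPN other by (intro sum.mono_neutral_right) auto
  finally have R: "(\<Sum>i\<in>I. sgn (\<gamma> i) * of_bool (ok i)) = of_bool (ok a) - (\<Sum>i\<in>N. of_bool (ok i) :: real)"
    by simp
  show ?thesis
  proof (cases "N = {}")
    case True
    then show ?thesis unfolding R L oka using a by force
  next
    case False
    define b where "b = arg_min_on (\<lambda>k. - t k) N"
    have b: "b \<in> N" "\<And>k. k \<in> N \<Longrightarrow> t k \<le> t b"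
      using arg_min_if_finite(1)[OF finPN(2) False, of "\<lambda>k. - t k"]
        arg_min_least[OF finPN(2) False, of _ "\<lambda>k. - t k"]
      by (auto simp: b_def)
    have okb: "ok b \<longleftrightarrow> 0 \<le> t b \<and> (\<forall>k\<in>P. t b \<le> t k) \<and> (\<forall>k\<in>Z. 0 \<le> u k)"
      using ok[of b] b by auto
    have "\<not> ok i" if "i \<in> N" "i \<noteq> b" for i
      using ok[of i] b that tne[of i b] by force
    then have "(\<Sum>i\<in>N. of_bool (ok i) :: real) = (\<Sum>i\<in>{b}. of_bool (ok i))"
      using b(1) finPN by (intro sum.mono_neutral_right) auto
    then have R': "(\<Sum>i\<in>I. sgn (\<gamma> i) * of_bool (ok i)) = of_bool (ok a) - (of_bool (ok b) :: real)"
      using R by simp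
    have A: "(\<forall>k\<in>P. c \<le> t k) \<longleftrightarrow> c \<le> t a" for c using a order_trans by blast
    have B: "(\<forall>k\<in>N. t k \<le> c) \<longleftrightarrow> t b \<le> c" for c using b order_trans by blast
    \<comment> \<open>Given the common condition on \<open>Z\<close>: if
      \<open>t b \<le> t a\<close>, the two terms differ by 1 exactly when
      \<open>t b < 0 \<le> t a\<close>, and otherwise both vanish. Since \<open>t b\<close> is
      nonzero, this matches \<open>t b \<le> 0 \<le> t a\<close> on the left.\<close>
    have "t b \<noteq> 0" using t0 b(1) by simp
    then show ?thesis unfolding R' L oka okb A B by (auto simp: of_bool_def)
  qed
qed

text \<open>The indicator identity is applied with weights \<open>g i w\<close> and values
  \<open>g i (x, z)\<close> for almost every \<open>z\<close>, then integrated over the fibre.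
  Conditions \<open>c1\<close> and \<open>c2\<close> make the excluded sets of heights negligible.
  If \<open>g i w = 0\<close>, the simplex with \<open>w\<close> in place of \<open>v i\<close> is
  flat, and \<open>sgn\<close> removes it.\<close>

lemma fibre_measure_insertion:
  fixes v :: "nat \<Rightarrow> (real^2) \<times> (real^3)"
  assumes b: "barycentric n v g"
    and c1: "\<And>i. i < n \<Longrightarrow> g i w \<noteq> 0 \<Longrightarrow> \<not> collinear (insert x (fst ` v ` ({..<n} - {i})))"
    and c2: "\<And>i k. i < n \<Longrightarrow> k < n \<Longrightarrow> i \<noteq> k \<Longrightarrow> g i w \<noteq> 0 \<Longrightarrow> g k w \<noteq> 0 \<Longrightarrow>
       \<not> collinear (insert x (fst ` insert w (v ` ({..<n} - {i, k}))))"
  shows "measure lborel {z. (x, z) \<in> convex hull (v ` {..<n})} =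
     (\<Sum>i<n. sgn (g i w) * measure lborel {z. (x, z) \<in> convex hull ((v(i := w)) ` {..<n})})"
proof -
  let ?F = "\<lambda>u :: nat \<Rightarrow> (real^2) \<times> (real^3). {z. (x, z) \<in> convex hull (u ` {..<n})}"
  have "\<exists>c a. \<forall>p. g i p = c + a \<bullet> p" if "i < n" for i using barycentricD(1)[OF b that] .
  then obtain c a where g: "\<And>i p. i < n \<Longrightarrow> g i p = c i + a i \<bullet> p" by metis
  have comp: "compact (?F u)" for u by (intro compact_fibre compact_vertex_hull)
  have Fsets [measurable]: "?F u \<in> sets borel" for u
    using comp by (simp add: compact_imp_closed)
  have int: "integrable lborel (indicat_real (?F u))" for u
    using emeasure_compact_finite[OF comp[of u]] by (intro integrable_real_indicator) auto
  have intF: "(\<integral>z. indicat_real (?F u) z \<partial>lborel) = measure lborel (?F u)" for u by simp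
  have n1: "negligible {z. g i (x, z) = 0}" if "i < n" "g i w \<noteq> 0" for i
  proof (rule negligible_affine_zero_fibre[OF g[OF that(1)] _ that(2) c1[OF that]])
    fix p assume "p \<in> v ` ({..<n} - {i})"
    then show "g i p = 0" using barycentricD(4)[OF b] that by (auto split: if_splits)
  qed
  \<comment> \<open>This function vanishes at \<open>w\<close> and at all vertices except
    \<open>v i\<close> and \<open>v k\<close>: on the common facet of the two simplices in which
    \<open>w\<close> replaces \<open>v i\<close> or \<open>v k\<close>.\<close>
  have n2: "negligible {z. g k w * g i (x, z) - g i w * g k (x, z) = 0}"
    if ik: "i < n" "k < n" "i \<noteq> k" "g i w \<noteq> 0" "g k w \<noteq> 0" for i k
  proof (rule negligible_affine_zero_fibre[where h = "\<lambda>p. g k w * g i p - g i w * g k p" and x = x, OF _ _ _ c2[OF ik]])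
    show "g k w * g i p - g i w * g k p =
      (g k w * c i - g i w * c k) + (g k w *\<^sub>R a i - g i w *\<^sub>R a k) \<bullet> p" for p
      unfolding inner_diff_left inner_scaleR_left g[OF ik(1), of p] g[OF ik(2), of p]
      by (simp only: algebra_simps)
    show "g k w * g i p - g i w * g k p = 0" if "p \<in> insert w (v ` ({..<n} - {i, k}))" for p
      using that barycentricD(4)[OF b] ik by (auto split: if_splits)
    show "g k w * g i (v i) - g i w * g k (v i) \<noteq> 0"
      using barycentricD(4)[OF b] ik by auto
  qed
  have ae1: "AE z in lborel. g i w \<noteq> 0 \<longrightarrow> g i (x, z) \<noteq> 0" if "i < n" for i
  proof (cases "g i w = 0")
    case False
    then have "{z. g i (x, z) = 0} \<in> null_sets lebesgue"
      using n1[OF that] negligible_iff_null_sets by blast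
    from AE_not_in[OF this] show ?thesis by (simp add: AE_completion_iff)
  qed simp
  have ae2: "AE z in lborel. i \<noteq> k \<longrightarrow> g i w \<noteq> 0 \<longrightarrow> g k w \<noteq> 0 \<longrightarrow> g k w * g i (x, z) \<noteq> g i w * g k (x, z)"
    if "i < n" "k < n" for i k
  proof (cases "i \<noteq> k \<and> g i w \<noteq> 0 \<and> g k w \<noteq> 0")
    case True
    then have "{z. g k w * g i (x, z) - g i w * g k (x, z) = 0} \<in> null_sets lebesgue"
      using n2[OF that] negligible_iff_null_sets by blast
    from AE_not_in[OF this] show ?thesis by (simp add: AE_completion_iff)
  qed auto
  have "AE z in lborel. (\<forall>i\<in>{..<n}. g i w \<noteq> 0 \<longrightarrow> g i (x, z) \<noteq> 0) \<and>
     (\<forall>i\<in>{..<n}. \<forall>k\<in>{..<n}. i \<noteq> k \<longrightarrow> g i w \<noteq> 0 \<longrightarrow> g k w \<noteq> 0 \<longrightarrow> g k w * g i (x, z) \<noteq> g i w * g k (x, z))"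
    using ae1 ae2 by (intro AE_conjI AE_finite_allI) auto
  then have ae: "AE z in lborel. indicat_real (?F v) z = (\<Sum>i<n. sgn (g i w) * indicat_real (?F (v(i := w))) z)"
  proof eventually_elim
    case (elim z)
    have mem: "(x, z) \<in> convex hull ((v(i := w)) ` {..<n}) \<longleftrightarrow> 0 \<le> g i (x, z) / g i w \<and>
        (\<forall>k\<in>{..<n} - {i}. 0 \<le> g k (x, z) - g k w * (g i (x, z) / g i w))"
      if "i < n" "g i w \<noteq> 0" for i
      unfolding barycentric_convex_hull[OF barycentric_replace_vertex[where w = w, OF b that]]
      using that by auto
    have "of_bool (\<forall>i\<in>{..<n}. 0 \<le> g i (x, z)) = (\<Sum>i<n. sgn (g i w) *
        of_bool (0 \<le> g i (x, z) / g i w \<and> (\<forall>k\<in>{..<n} - {i}. 0 \<le> g k (x, z) - g k w * (g i (x, z) / g i w))) :: real)"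
      by (rule signed_indicator_identity) (use elim barycentricD(2)[OF b] in auto)
    also have "\<dots> = (\<Sum>i<n. sgn (g i w) * indicat_real (?F (v(i := w))) z)"
    proof (intro sum.cong refl)
      fix i assume "i \<in> {..<n}"
      then have i: "i < n" by simp
      show "sgn (g i w) * of_bool (0 \<le> g i (x, z) / g i w \<and>
          (\<forall>k\<in>{..<n} - {i}. 0 \<le> g k (x, z) - g k w * (g i (x, z) / g i w)))
          = sgn (g i w) * indicat_real (?F (v(i := w))) z"
      proof (cases "g i w = 0")
        case False
        show ?thesis by (simp only: indicator_def mem_Collect_eq mem[OF i False])
      qed simp
    qed
    finally show ?case
      by (simp add: indicator_def barycentric_convex_hull[OF b] Ball_def)
  qed
  have "measure lborel (?F v) = (\<integral>z. indicat_real (?F v) z \<partial>lborel)" by simp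
  also have "\<dots> = (\<integral>z. (\<Sum>i<n. sgn (g i w) * indicat_real (?F (v(i := w))) z) \<partial>lborel)"
    using ae by (intro integral_cong_AE) (measurable)
  also have "\<dots> = (\<Sum>i<n. \<integral>z. sgn (g i w) * indicat_real (?F (v(i := w))) z \<partial>lborel)"
    by (intro Bochner_Integration.integral_sum integrable_mult_right int)
  also have "\<dots> = (\<Sum>i<n. sgn (g i w) * measure lborel (?F (v(i := w))))"
    by (simp only: integral_mult_right_zero intF)
  finally show ?thesis .
qed

text \<open>Three noncollinear knots stay at height 0 and the other three are raised along the three
  axes; no hyperplane of R^5 contains these six points.\<close>

lemma lift_exists:
  fixes Xs :: "(real^2) list"
  assumes len: "length Xs = 6" and nc: "\<not> collinear (set Xs)"
  obtains v :: "nat \<Rightarrow> (real^2) \<times> (real^3)" and g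
  where "barycentric 6 v g" "\<And>i. i < 6 \<Longrightarrow> fst (v i) = Xs ! i"
proof -
  obtain p q where pq: "p \<in> set Xs" "q \<in> set Xs" "p \<noteq> q"
    using nc by (metis collinear_empty collinear_sing is_singletonI' is_singleton_def)
  have "\<not> (\<forall>x\<in>set Xs. collinear {p, q, x})"
    using nc collinear_triples[OF pq(3), of "set Xs"] pq by (simp add: insert_absorb)
  then obtain s where s: "s \<in> set Xs" "\<not> collinear {p, q, s}" by blast
  obtain i j k where ijk: "i < 6" "j < 6" "k < 6" "Xs ! i = p" "Xs ! j = q" "Xs ! k = s"
    using pq s len by (metis in_set_conv_nth)
  have d: "i \<noteq> j" "i \<noteq> k" "j \<noteq> k"
    using ijk s(2) by (auto simp: collinear_2 insert_commute)
  have "card ({..<6} - {i, j, k}) = CARD(3)" using ijk d by (simp add: card_Diff_subset)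
  then obtain f :: "nat \<Rightarrow> 3" where f: "bij_betw f ({..<6} - {i, j, k}) UNIV"
    using finite_same_card_bij[of "{..<6} - {i, j, k}" "UNIV :: 3 set"] by auto
  define v where "v = (\<lambda>l. (Xs ! l, if l \<in> {i, j, k} then 0 else axis (f l) (1::real)))"
  have "\<exists>g. barycentric 6 v g"
  proof (rule barycentric_exists)
    fix a b assume ab: "\<And>l. l < 6 \<Longrightarrow> a \<bullet> v l = b"
    have e: "fst a \<bullet> p = b" "fst a \<bullet> q = b" "fst a \<bullet> s = b"
      using ab[of i] ab[of j] ab[of k] ijk by (auto simp: v_def inner_prod_def)
    have a0: "fst a = 0"
    proof (rule ccontr)
      assume "fst a \<noteq> 0"
      moreover have "{p, q, s} \<subseteq> {u. fst a \<bullet> u = b}" using e by auto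
      ultimately show False using collinear_hyperplane2 collinear_subset s(2) by blast
    qed
    then have "b = 0" using e by simp
    have "snd a $ r = 0" for r
    proof -
      have "r \<in> f ` ({..<6} - {i, j, k})" by (simp add: bij_betw_imp_surj_on[OF f])
      then obtain l where l: "l < 6" "l \<notin> {i, j, k}" "f l = r" by auto
      then show ?thesis using ab[of l] a0 \<open>b = 0\<close> by (simp add: v_def inner_prod_def inner_axis)
    qed
    then show "a = 0" using a0 by (simp add: prod_eq_iff vec_eq_iff)
  qed simp
  then show thesis using that[of v] by (auto simp: v_def)
qed

text \<open>Knot insertion: both sides are volumes of fibres of simplices, and the simplices on the
  right, counted with the signs of the \<open>\<gamma> i\<close>, make up the one on the left.\<close>
lemma simplex_spline_insertion:
  fixes Xs :: "(real^2) list"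
  assumes len: "length Xs = 6" and nc: "\<not> collinear (set Xs)"
    and sum: "(\<Sum>i<6. \<gamma> i) = 1" and \<eta>: "\<eta> = (\<Sum>i<6. \<gamma> i *\<^sub>R Xs ! i)"
    and c1: "\<And>i. i < 6 \<Longrightarrow> \<gamma> i \<noteq> 0 \<Longrightarrow> \<not> collinear (insert x ((!) Xs ` ({..<6} - {i})))"
    and c2: "\<And>i k. i < 6 \<Longrightarrow> k < 6 \<Longrightarrow> i \<noteq> k \<Longrightarrow> \<gamma> i \<noteq> 0 \<Longrightarrow> \<gamma> k \<noteq> 0 \<Longrightarrow>
       \<not> collinear (insert x (insert \<eta> ((!) Xs ` ({..<6} - {i, k}))))"
  shows "simplex_spline Xs x = (\<Sum>i<6. \<gamma> i * simplex_spline (Xs[i := \<eta>]) x)"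
proof -
  obtain v :: "nat \<Rightarrow> (real^2) \<times> (real^3)" and g
    where b: "barycentric 6 v g" and v: "\<And>i. i < 6 \<Longrightarrow> fst (v i) = Xs ! i"
    using lift_exists[OF len nc] by blast
  \<comment> \<open>Lifting the inserted knot with the same weights makes \<open>\<gamma> i\<close>
    its barycentric coordinates.\<close>
  define w where "w = (\<Sum>i<6. \<gamma> i *\<^sub>R v i)"
  have gw: "g i w = \<gamma> i" if "i < 6" for i
    unfolding w_def by (rule barycentric_coordinate_of_sum[OF b that sum])
  have w: "fst w = \<eta>" by (simp add: w_def fst_sum \<eta> v)
  have fv: "fst ` v ` ({..<6} - A) = (!) Xs ` ({..<6} - A)" for A
    unfolding image_image by (intro image_cong) (auto simp: v)
  let ?F = "\<lambda>u :: nat \<Rightarrow> (real^2) \<times> (real^3). measure lborel {z. (x, z) \<in> convex hull (u ` {..<6})}"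
  let ?V = "\<lambda>u :: nat \<Rightarrow> (real^2) \<times> (real^3). measure lborel (convex hull (u ` {..<6}))"
  have F: "?F v = (\<Sum>i<6. sgn (g i w) * ?F (v(i := w)))"
    by (rule fibre_measure_insertion[OF b]) (use c1 c2 gw w fv in \<open>simp_all\<close>)
  obtain B :: "5 \<Rightarrow> (real^2) \<times> (real^3)" where B: "bij_betw B UNIV Basis"
    using finite_same_card_bij[of "UNIV :: 5 set" "Basis :: ((real^2) \<times> (real^3)) set"] by auto
  have S: "\<gamma> i * simplex_spline (Xs[i := \<eta>]) x = sgn (\<gamma> i) * ?F (v(i := w)) / ?V v" if i: "i < 6" for i
  proof (cases "\<gamma> i = 0")
    case False
    have nz: "g i w \<noteq> 0" using False gw[OF i] by simp
    have "simplex_spline (Xs[i := \<eta>]) x = ?F (v(i := w)) / ?V (v(i := w))"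
      by (rule simplex_spline_eq[OF barycentric_replace_vertex[OF b i nz]])
        (use len v w in \<open>auto simp: nth_list_update\<close>)
    \<comment> \<open>The factor \<open>\<bar>\<gamma> i\<bar>\<close> in the denominator reduces
      the weight \<open>\<gamma> i\<close> of the spline to the sign that belongs to the
      fibre.\<close>
    also have "?V (v(i := w)) = \<bar>\<gamma> i\<bar> * ?V v"
      using measure_simplex_replace_vertex[OF B _ b i nz] gw[OF i] by simp
    finally show ?thesis
      using False by (simp add: sgn_real_def)
  qed simp
  have "simplex_spline Xs x = ?F v / ?V v"
    by (rule simplex_spline_eq[OF b len]) (simp add: v)
  also have "\<dots> = (\<Sum>i<6. sgn (\<gamma> i) * ?F (v(i := w)) / ?V v)"
    unfolding F sum_divide_distrib by (intro sum.cong) (simp_all add: gw)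
  also have "\<dots> = (\<Sum>i<6. \<gamma> i * simplex_spline (Xs[i := \<eta>]) x)"
    by (intro sum.cong) (simp_all add: S)
  finally show ?thesis .
qed

section \<open>Limits of a spline at the boundary of a region\<close>

text \<open>As \<open>y\<close> in \<open>U\<close> tends to \<open>x\<close>, an inequality
  \<open>0 \<le> g i (y, z)\<close> that involves \<open>z\<close> settles for almost every
  \<open>z\<close>. One that does not involve \<open>z\<close> has a zero line which avoids
  \<open>U\<close> by hypothesis \<open>c\<close>, so by connectedness its sign is constant on
  \<open>U\<close>. Hence the fibres converge almost everywhere.\<close>

lemma simplex_spline_interior_limit:
  fixes Xs :: "(real^2) list" and U :: "(real^2) set"
  assumes len: "length Xs = 6" and nc: "\<not> collinear (set Xs)" and U: "connected U"
    and c: "\<And>i y. i < 6 \<Longrightarrow> y \<in> U \<Longrightarrow> \<not> collinear (insert y ((!) Xs ` ({..<6} - {i})))"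
  shows "\<exists>l. (simplex_spline Xs \<longlongrightarrow> l) (at x within U)"
proof -
  obtain v :: "nat \<Rightarrow> (real^2) \<times> (real^3)" and g
    where b: "barycentric 6 v g" and v: "\<And>i. i < 6 \<Longrightarrow> fst (v i) = Xs ! i"
    using lift_exists[OF len nc] by blast
  have fv: "fst ` v ` ({..<6} - A) = (!) Xs ` ({..<6} - A)" for A
    unfolding image_image by (intro image_cong) (auto simp: v)
  have "\<exists>c a. \<forall>p. g i p = c + a \<bullet> p" if "i < 6" for i using barycentricD(1)[OF b that] .
  then obtain c a where g: "\<And>i p. i < 6 \<Longrightarrow> g i p = c i + a i \<bullet> p" by metis
  let ?S = "convex hull (v ` {..<6})"
  let ?F = "\<lambda>y. {z. (y, z) \<in> ?S}"
  have comp: "compact (?F y)" for y by (intro compact_fibre compact_vertex_hull)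
  have Fsets [measurable]: "?F y \<in> sets borel" for y
    using comp by (simp add: compact_imp_closed)
  define pos where "pos = (\<lambda>i. \<forall>y\<in>U. 0 < g i (y, 0))"
  \<comment> \<open>The limit of the fibres, up to a null set. It can differ from the fibre over
    \<open>x\<close>, because a vertical facet is judged by its sign on \<open>U\<close> and not at
    \<open>x\<close>.\<close>
  define E where "E = (\<Inter>i\<in>{..<6}. if snd (a i) = 0 then (if pos i then UNIV else {}) else {z. 0 \<le> g i (x, z)})"
  have [measurable]: "E \<in> sets borel"
  proof -
    have "closed {z. 0 \<le> g i (x, z)}" if "i < 6" for i
      unfolding g[OF that] by (intro closed_Collect_le continuous_intros)
    then have "closed E" unfolding E_def by (intro closed_INT) auto
    then show ?thesis by simp
  qed
  have vert: "0 \<le> g i (y, z) \<longleftrightarrow> pos i" if i: "i < 6" and a0: "snd (a i) = 0" and y: "y \<in> U" for i y z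
  proof -
    have gi: "g i (y, z) = c i + fst (a i) \<bullet> y" for y z
      using a0 by (simp add: g[OF i] inner_prod_def)
    have nz: "g i (y, z) \<noteq> 0" if "y \<in> U" for y z
    proof
      assume "g i (y, z) = 0"
      then have "{z. g i (y, z) = 0} = UNIV" by (simp add: gi)
      moreover have "negligible {z. g i (y, z) = 0}"
      proof (rule negligible_affine_zero_fibre[OF g[OF i], where S = "v ` ({..<6} - {i})"])
        show "g i p = 0" if "p \<in> v ` ({..<6} - {i})" for p
          using that barycentricD(4)[OF b] i by (auto split: if_splits)
        show "g i (v i) \<noteq> 0" using barycentricD(4)[OF b] i by simp
        show "\<not> collinear (insert y (fst ` v ` ({..<6} - {i})))"
          unfolding fv using assms(4)[OF i that] .
      qed
      ultimately show False using open_not_negligible[of "UNIV :: (real^3) set"] by simp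
    qed
    show ?thesis
    proof
      assume ge: "0 \<le> g i (y, z)"
      show "pos i"
        unfolding pos_def
      proof (rule ballI, rule ccontr)
        fix y' assume y': "y' \<in> U" "\<not> 0 < g i (y', 0)"
        then have "fst (a i) \<bullet> y' \<le> - c i" "- c i \<le> fst (a i) \<bullet> y" using ge by (auto simp: gi)
        from connected_ivt_hyperplane[OF U y'(1) y this]
        obtain u where "u \<in> U" "fst (a i) \<bullet> u = - c i" by blast
        then show False using nz[of u 0] by (simp add: gi)
      qed
    next
      assume "pos i"
      then show "0 \<le> g i (y, z)" using y gi[of y z] gi[of y 0] by (auto simp: pos_def less_imp_le)
    qed
  qed
  have ae: "AE z in lborel. \<forall>i\<in>{..<6}. snd (a i) \<noteq> 0 \<longrightarrow> g i (x, z) \<noteq> 0"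
  proof (intro AE_finite_allI)
    fix i :: nat assume "i \<in> {..<6}"
    then have i: "i < 6" by simp
    show "AE z in lborel. snd (a i) \<noteq> 0 \<longrightarrow> g i (x, z) \<noteq> 0"
    proof (cases "snd (a i) = 0")
      case False
      have "{z. g i (x, z) = 0} = {z. snd (a i) \<bullet> z = - (c i + fst (a i) \<bullet> x)}"
        by (auto simp: g[OF i] inner_prod_def)
      then have "negligible {z. g i (x, z) = 0}"
        using negligible_hyperplane[of "snd (a i)" "- (c i + fst (a i) \<bullet> x)"] False by (simp only: simp_thms)
      then have "{z. g i (x, z) = 0} \<in> null_sets lebesgue"
        using negligible_iff_null_sets by blast
      from AE_not_in[OF this] show ?thesis by (simp add: AE_completion_iff)
    qed simp
  qed simp
  \<comment> \<open>One ball contains the heights of the whole simplex; its indicator dominates all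
    fibres.\<close>
  obtain R where R: "\<And>p. p \<in> ?S \<Longrightarrow> norm p \<le> R"
    using compact_imp_bounded[OF compact_vertex_hull[of v 6]] unfolding bounded_iff by blast
  have dom: "norm (indicat_real (?F y) z) \<le> indicat_real (cball 0 R) z" for y z
  proof -
    have "norm z \<le> R" if "(y, z) \<in> ?S" using R[OF that] norm_snd_le[of z y] by linarith
    then show ?thesis by (auto simp: indicator_def)
  qed
  have lim: "(\<lambda>k. measure lborel (?F (X k))) \<longlonglongrightarrow> (\<integral>z. indicat_real E z \<partial>lborel)"
    if XU: "\<And>k. X k \<in> U" and X: "X \<longlonglongrightarrow> x" for X :: "nat \<Rightarrow> real^2"
  proof -
    have "(\<lambda>k. \<integral>z. indicat_real (?F (X k)) z \<partial>lborel) \<longlonglongrightarrow> (\<integral>z. indicat_real E z \<partial>lborel)"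
    proof (rule integral_dominated_convergence)
      show "integrable lborel (indicat_real (cball 0 R :: (real^3) set))"
        using emeasure_compact_finite[of "cball 0 R :: (real^3) set"]
        by (intro integrable_real_indicator) auto
      show "AE z in lborel. (\<lambda>k. indicat_real (?F (X k)) z) \<longlonglongrightarrow> indicat_real E z"
        using ae
      proof eventually_elim
        case (elim z)
        have "eventually (\<lambda>k. \<forall>i\<in>{..<6}. 0 \<le> g i (X k, z) \<longleftrightarrow>
            z \<in> (if snd (a i) = 0 then (if pos i then UNIV else {}) else {z. 0 \<le> g i (x, z)})) sequentially"
        proof (intro eventually_ball_finite ballI)
          fix i :: nat assume "i \<in> {..<6}"
          then have i: "i < 6" by simp
          show "eventually (\<lambda>k. 0 \<le> g i (X k, z) \<longleftrightarrow>
            z \<in> (if snd (a i) = 0 then (if pos i then UNIV else {}) else {z. 0 \<le> g i (x, z)})) sequentially"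
          proof (cases "snd (a i) = 0")
            case True
            then show ?thesis using vert[OF i True XU] by simp
          next
            case False
            then have nz: "g i (x, z) \<noteq> 0" using elim i by auto
            have t: "(\<lambda>k. g i (X k, z)) \<longlonglongrightarrow> g i (x, z)"
              unfolding g[OF i] by (intro tendsto_intros X)
            show ?thesis
            proof (cases "g i (x, z) > 0")
              case True
              from order_tendstoD(1)[OF t True] show ?thesis
                by eventually_elim (use True False in auto)
            next
              case F2: False
              then have "g i (x, z) < 0" using nz by simp
              from order_tendstoD(2)[OF t this] show ?thesis
                by eventually_elim (use F2 False nz in auto)
            qed
          qed
        qed simp
        then have "eventually (\<lambda>k. indicat_real (?F (X k)) z = indicat_real E z) sequentially"
          by eventually_elim (auto simp: indicator_def E_def barycentric_convex_hull[OF b])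
        then show ?case by (rule tendsto_eventually)
      qed
      show "AE z in lborel. norm (indicat_real (?F (X k)) z) \<le> indicat_real (cball 0 R) z" for k
        using dom by simp
    qed auto
    then show ?thesis by simp
  qed
  let ?l = "(\<integral>z. indicat_real E z \<partial>lborel) / measure lborel ?S"
  have "(simplex_spline Xs \<longlongrightarrow> ?l) (at x within U)"
    unfolding tendsto_at_iff_sequentially
  proof (intro allI impI)
    fix X :: "nat \<Rightarrow> real^2" assume X: "\<forall>i. X i \<in> U - {x}" "X \<longlonglongrightarrow> x"
    have "(\<lambda>k. measure lborel (?F (X k)) / measure lborel ?S) \<longlonglongrightarrow> ?l"
      using barycentric_measure_pos[OF b] lim[of X] X by (intro tendsto_divide tendsto_const) auto
    moreover have "simplex_spline Xs y = measure lborel (?F y) / measure lborel ?S" for y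
      by (rule simplex_spline_eq[OF b len]) (simp add: v)
    ultimately show "(simplex_spline Xs \<circ> X) \<longlonglongrightarrow> ?l"
      by (simp add: o_def)
  qed
  then show ?thesis by blast
qed

section \<open>Bernstein polynomials as simplex splines\<close>

lemma prod_UNIV_3: "prod f (UNIV :: 3 set) = f 1 * f 2 * f 3"
  unfolding UNIV_3 by (simp add: ac_simps)

text \<open>The standard simplex, of volume 1 / 3!, scaled by \<open>l\<close>; for
  \<open>l = 0\<close> it shrinks to a point.\<close>

lemma measure_corner_simplex:
  assumes "0 \<le> l"
  shows "measure lborel {z :: real^3. 0 \<le> z $ 1 \<and> 0 \<le> z $ 2 \<and> 0 \<le> z $ 3 \<and> z $ 1 + z $ 2 + z $ 3 \<le> l}
       = l ^ 3 / 6" (is "measure lborel ?C = _")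
proof (cases "l = 0")
  case True
  have "z = 0" if "z \<in> ?C" for z
    using that True by (auto simp: vec_eq_iff forall_3)
  moreover have "0 \<in> ?C" using True by simp
  ultimately have "?C = {0}" by blast
  then show ?thesis using True by simp
next
  case False
  then have l: "l > 0" using assms by simp
  let ?S = "convex hull (insert 0 Basis) :: (real^3) set"
  have bas: "(\<forall>c\<in>Basis. P c) \<longleftrightarrow> (\<forall>i::3. P (axis i (1::real)))" for P
    by (auto simp: Basis_vec_def)
  have inj: "inj (\<lambda>i::3. axis i (1::real))" by (auto simp: inj_on_def axis_eq_axis)
  have bs: "(\<Sum>c\<in>Basis. z \<bullet> c) = (\<Sum>i\<in>UNIV. z $ i)" for z :: "real^3"
  proof -
    have eq: "Basis = range (\<lambda>i::3. axis i (1::real))" by (auto simp: Basis_vec_def)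
    show ?thesis unfolding eq by (simp add: sum.reindex[OF inj] inner_axis)
  qed
  have S: "?S = {z. 0 \<le> z $ 1 \<and> 0 \<le> z $ 2 \<and> 0 \<le> z $ 3 \<and> z $ 1 + z $ 2 + z $ 3 \<le> 1}"
    unfolding std_simplex bas bs by (auto simp: inner_axis forall_3 sum_3)
  have "?C = (\<lambda>z. l *\<^sub>R z + 0) ` ?S"
  proof (intro equalityI subsetI)
    fix z assume z: "z \<in> ?C"
    have "(1 / l) *\<^sub>R z \<in> ?S" using z l by (auto simp: S field_simps)
    moreover have "z = l *\<^sub>R ((1 / l) *\<^sub>R z) + 0" using l by simp
    ultimately show "z \<in> (\<lambda>z. l *\<^sub>R z + 0) ` ?S" by blast
  next
    fix z assume "z \<in> (\<lambda>z. l *\<^sub>R z + 0) ` ?S"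
    then obtain y where y: "y \<in> ?S" "z = l *\<^sub>R y" by auto
    have "l * (y $ 1 + y $ 2 + y $ 3) \<le> l * 1" using y l unfolding S by (intro mult_left_mono) auto
    then show "z \<in> ?C" using y l unfolding S by (auto simp: algebra_simps)
  qed
  moreover have "compact ?S" by (intro finite_imp_compact_convex_hull) auto
  then have "compact ((\<lambda>z. l *\<^sub>R z + 0) ` ?S)" "measure lebesgue ?S = 1 / 6"
    using content_std_simplex[where 'a = "real^3"]
    by (auto intro!: compact_continuous_image continuous_intros simp: measure_lebesgue_compact fact_numeral)
  ultimately show ?thesis
    using measure_lebesgue_compact[of ?C] measure_lebesgue_affine[of l 0 ?S] l by simp
qed

text \<open>Reflection in the centre of the box with edges \<open>a\<close>, \<open>a\<close>,
  \<open>b\<close> maps the prism to the complementary one. The two overlap only in a plane, so each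
  has half the volume of the box.\<close>

lemma measure_corner_prism:
  assumes a: "0 \<le> a" and b: "0 \<le> b"
  shows "measure lborel {z :: real^3. 0 \<le> z $ 1 \<and> 0 \<le> z $ 2 \<and> 0 \<le> z $ 3 \<and> z $ 1 + z $ 2 \<le> a \<and> z $ 3 \<le> b}
       = a\<^sup>2 * b / 2" (is "measure lborel ?C = _")
proof -
  define w :: "real^3" where "w = vector [a, a, b]"
  have w: "w $ 1 = a" "w $ 2 = a" "w $ 3 = b" by (simp_all add: w_def)
  let ?C' = "(\<lambda>z. (-1) *\<^sub>R z + w) ` ?C"
  have Ceq: "?C = {z. 0 \<le> z $ 1} \<inter> {z. 0 \<le> z $ 2} \<inter> {z. 0 \<le> z $ 3} \<inter> {z. z $ 1 + z $ 2 \<le> a} \<inter> {z. z $ 3 \<le> b}"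
    by auto
  have "closed ?C" unfolding Ceq
    by (intro closed_Int closed_Collect_le continuous_intros)
  moreover have "?C \<subseteq> cbox 0 w" by (auto simp: mem_box_cart forall_3 w)
  ultimately have comp: "compact ?C"
    using bounded_subset[OF bounded_cbox] compact_eq_bounded_closed by blast
  have comp': "compact ?C'" by (intro compact_continuous_image continuous_intros comp)
  have C': "?C' = {z :: real^3. z $ 1 \<le> a \<and> z $ 2 \<le> a \<and> z $ 3 \<le> b \<and> a \<le> z $ 1 + z $ 2 \<and> 0 \<le> z $ 3}"
  proof (intro equalityI subsetI)
    fix z assume z: "z \<in> {z :: real^3. z $ 1 \<le> a \<and> z $ 2 \<le> a \<and> z $ 3 \<le> b \<and> a \<le> z $ 1 + z $ 2 \<and> 0 \<le> z $ 3}"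
    then have "w - z \<in> ?C" by (auto simp: w)
    moreover have "z = (-1) *\<^sub>R (w - z) + w" by simp
    ultimately show "z \<in> ?C'" by blast
  qed (auto simp: w)
  have un: "?C \<union> ?C' = cbox 0 w"
    unfolding C' by (auto simp: mem_box_cart forall_3 w)
  define n :: "real^3" where "n = axis 1 1 + axis 2 1"
  have n: "n \<bullet> z = z $ 1 + z $ 2" for z by (simp add: n_def inner_add_left inner_axis')
  have "n \<noteq> 0" using n[of "axis 1 1"] by (auto simp: axis_def)
  moreover have "?C \<inter> ?C' \<subseteq> {z. n \<bullet> z = a}" unfolding C' by (auto simp: n)
  ultimately have neg: "negligible (?C \<inter> ?C')"
    using negligible_hyperplane negligible_subset by blast
  have "measure lebesgue (cbox 0 w) = measure lebesgue ?C + measure lebesgue ?C' + measure lebesgue ({} :: (real^3) set)"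
    by (rule measure_Un3_negligible[OF lmeasurable_compact[OF comp] lmeasurable_compact[OF comp'] _ neg])
      (simp_all only: un Un_empty_right Int_empty_right negligible_empty fmeasurable.empty_sets)
  moreover have "measure lebesgue ?C' = measure lebesgue ?C"
    using measure_lebesgue_affine[of "-1" w ?C] by simp
  moreover have "measure lebesgue (cbox 0 w) = a * a * b"
  proof -
    have ne: "cbox 0 w \<noteq> {}" using a b by (simp only: interval_ne_empty_cart forall_3 w zero_index simp_thms)
    have "measure lebesgue (cbox 0 w) = measure lborel (cbox 0 w)"
      by (rule measure_lebesgue_compact[OF compact_cbox])
    also have "\<dots> = a * a * b"
      unfolding content_cbox_cart[OF ne] prod_UNIV_3 w zero_index by simp
    finally show ?thesis .
  qed
  moreover have "measure lebesgue ({} :: (real^3) set) = 0" by simp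
  ultimately have "a * a * b = 2 * measure lebesgue ?C" by linarith
  then show ?thesis
    unfolding measure_lebesgue_compact[OF comp] power2_eq_square by linarith
qed

lemma measure_corner_box:
  assumes "0 \<le> a" "0 \<le> b" "0 \<le> c"
  shows "measure lborel {z :: real^3. 0 \<le> z $ 1 \<and> 0 \<le> z $ 2 \<and> 0 \<le> z $ 3 \<and> z $ 1 \<le> a \<and> z $ 2 \<le> b \<and> z $ 3 \<le> c}
       = a * b * c"
proof -
  have eq: "{z :: real^3. 0 \<le> z $ 1 \<and> 0 \<le> z $ 2 \<and> 0 \<le> z $ 3 \<and> z $ 1 \<le> a \<and> z $ 2 \<le> b \<and> z $ 3 \<le> c}
      = cbox 0 (vector [a, b, c])"
    by (auto simp: mem_box_cart forall_3)
  have ne: "cbox 0 (vector [a, b, c] :: real^3) \<noteq> {}"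
    using assms by (simp only: interval_ne_empty_cart forall_3 vector_3 zero_index simp_thms)
  show ?thesis
    unfolding eq content_cbox_cart[OF ne] prod_UNIV_3 vector_3 zero_index by simp
qed

lemma measure_fibres:
  fixes S :: "('a::euclidean_space \<times> 'b::euclidean_space) set"
  assumes "compact S"
  shows "measure lborel S = (\<integral>x. measure lborel {z. (x, z) \<in> S} \<partial>lborel)"
proof -
  have "S \<in> sets (lborel \<Otimes>\<^sub>M lborel)"
    unfolding lborel_prod using assms by (simp add: compact_imp_closed)
  from lborel.measurable_emeasure_Pair[OF this]
  have "(\<lambda>x. ennreal (measure lborel {z. (x, z) \<in> S})) \<in> borel_measurable lborel"
    unfolding vimage_def emeasure_fibre[OF assms, symmetric] .
  then have "(\<lambda>x. enn2real (ennreal (measure lborel {z. (x, z) \<in> S}))) \<in> borel_measurable lborel"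
    by (rule borel_measurable_enn2real)
  then have "(\<integral>x. measure lborel {z. (x, z) \<in> S} \<partial>lborel)
      = enn2real (\<integral>\<^sup>+x. ennreal (measure lborel {z. (x, z) \<in> S}) \<partial>lborel)"
    by (intro integral_eq_nn_integral) auto
  then show ?thesis
    by (simp only: emeasure_fibres[OF assms, symmetric] measure_def[of lborel S])
qed

definition unit3 :: "nat \<Rightarrow> real^3" where
  "unit3 r = [axis 1 1, axis 2 1, axis 3 1] ! r"

lemma unit3_simps: "unit3 0 = axis 1 1" "unit3 (Suc 0) = axis 2 1" "unit3 (Suc (Suc 0)) = axis 3 1"
  by (simp_all add: unit3_def)

lemma unit3_inner: "r < 3 \<Longrightarrow> s < 3 \<Longrightarrow> unit3 r \<bullet> unit3 s = (if r = s then 1 else 0)"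
  by (auto simp: less_Suc_eq numeral_3_eq_3 unit3_simps inner_axis_axis)

lemma unit3_expansion: "(\<Sum>r<3. (unit3 r \<bullet> z) *\<^sub>R unit3 r) = z"
proof -
  have "(\<Sum>r<3. (unit3 r \<bullet> z) *\<^sub>R unit3 r) = z $ 1 *\<^sub>R axis 1 1 + z $ 2 *\<^sub>R axis 2 1 + z $ 3 *\<^sub>R axis 3 1"
    by (simp add: numeral_3_eq_3 unit3_simps inner_axis')
  then show ?thesis by (simp add: vec_eq_iff axis_def forall_3)
qed

text \<open>A lift of the knots \<open>p 0, p 1, p 2, p (k 0), p (k 1), p (k 2)\<close> whose fibres are products
  of corner simplices, with the barycentric coordinates of the triangle as edge lengths.\<close>
definition corner_lift :: "(nat \<Rightarrow> real^2) \<Rightarrow> (nat \<Rightarrow> nat) \<Rightarrow> nat \<Rightarrow> (real^2) \<times> (real^3)" where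
  "corner_lift p k i = (if i < 3 then (p i, 0) else (p (k (i - 3)), unit3 (i - 3)))"

text \<open>Only the vertices \<open>3 + r\<close> have heights, so their coordinates are the
  heights. The coordinate of \<open>p i\<close> at height 0 is what remains of \<open>l i\<close>
  after the share of the raised copies of \<open>p i\<close>.\<close>

definition corner_coord :: "(nat \<Rightarrow> real^2 \<Rightarrow> real) \<Rightarrow> (nat \<Rightarrow> nat) \<Rightarrow> nat \<Rightarrow> (real^2) \<times> (real^3) \<Rightarrow> real" where
  "corner_coord l k i q = (if i < 3 then l i (fst q) - (\<Sum>r<3. if k r = i then unit3 r \<bullet> snd q else 0)
                           else unit3 (i - 3) \<bullet> snd q)"

lemma sum_less_6: "(\<Sum>i<6. f i) = (\<Sum>i<3. f i) + (\<Sum>r<3. f (3 + r))"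
  for f :: "nat \<Rightarrow> 'a::comm_monoid_add"
  by (simp add: eval_nat_numeral add_ac)

lemma barycentric_corner_lift:
  assumes l: "barycentric 3 p l" and k: "\<forall>r<3. k r < 3"
  shows "barycentric 6 (corner_lift p k) (corner_coord l k)"
  unfolding barycentric_def
proof (intro conjI allI impI)
  fix i :: nat assume i: "i < 6"
  show "\<exists>c a. \<forall>q. corner_coord l k i q = c + a \<bullet> q"
  proof (cases "i < 3")
    case True
    obtain c a where la: "\<And>x. l i x = c + a \<bullet> x" using barycentricD(1)[OF l True] by blast
    have "(\<Sum>r<3. if k r = i then unit3 r \<bullet> z else 0) = (\<Sum>r<3. if k r = i then unit3 r else 0) \<bullet> z" for z
      unfolding inner_sum_left by (intro sum.cong) auto
    then have "corner_coord l k i q = c + (a, - (\<Sum>r<3. if k r = i then unit3 r else 0)) \<bullet> q" for q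
      using True by (simp add: corner_coord_def la inner_prod_def)
    then show ?thesis by blast
  next
    case False
    then have "corner_coord l k i q = 0 + (0, unit3 (i - 3)) \<bullet> q" for q
      by (simp add: corner_coord_def inner_prod_def)
    then show ?thesis by blast
  qed
next
  fix q :: "(real^2) \<times> (real^3)"
  have ex: "(\<Sum>i<3. (\<Sum>r<3. if k r = i then h r else 0) *\<^sub>R f i) = (\<Sum>r<3. h r *\<^sub>R f (k r))"
    for h and f :: "nat \<Rightarrow> 'b::real_vector"
  proof -
    have "(\<Sum>i<3. (\<Sum>r<3. if k r = i then h r else 0) *\<^sub>R f i) = (\<Sum>r<3. \<Sum>i<3. if k r = i then h r *\<^sub>R f i else 0)"
      unfolding scaleR_sum_left by (subst sum.swap) (intro sum.cong, auto)
    also have "\<dots> = (\<Sum>r<3. h r *\<^sub>R f (k r))"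
      using k by (intro sum.cong) auto
    finally show ?thesis .
  qed
  show "(\<Sum>i<6. corner_coord l k i q) = 1"
    using ex[of "\<lambda>r. unit3 r \<bullet> snd q" "\<lambda>_. 1 :: real"] barycentricD(2)[OF l]
    by (simp add: sum_less_6 corner_coord_def sum_subtractf)
  have "(\<Sum>i<6. corner_coord l k i q *\<^sub>R corner_lift p k i) =
     (\<Sum>i<3. l i (fst q) *\<^sub>R (p i, 0)) - (\<Sum>i<3. (\<Sum>r<3. if k r = i then unit3 r \<bullet> snd q else 0) *\<^sub>R (p i, 0))
      + (\<Sum>r<3. (unit3 r \<bullet> snd q) *\<^sub>R (p (k r), unit3 r))"
    by (simp add: sum_less_6 corner_coord_def corner_lift_def scaleR_left_diff_distrib sum_subtractf
        del: scaleR_Pair)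
  also have "(\<Sum>i<3. (\<Sum>r<3. if k r = i then unit3 r \<bullet> snd q else 0) *\<^sub>R (p i, 0 :: real^3))
      = (\<Sum>r<3. (unit3 r \<bullet> snd q) *\<^sub>R (p (k r), 0))" by (rule ex)
  finally show "(\<Sum>i<6. corner_coord l k i q *\<^sub>R corner_lift p k i) = q"
    using barycentricD(3)[OF l, of "fst q"] unit3_expansion[of "snd q"]
    by (simp add: prod_eq_iff fst_sum snd_sum)
next
  fix i j :: nat assume ij: "i < 6" "j < 6"
  show "corner_coord l k i (corner_lift p k j) = (if i = j then 1 else 0)"
  proof (cases "j < 3")
    case True
    then show ?thesis
      using ij barycentricD(4)[OF l] by (simp add: corner_coord_def corner_lift_def cong: if_cong)
  next
    case False
    then have j: "j - 3 < 3" using ij by simp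
    have "(\<Sum>r<3. if k r = i then unit3 r \<bullet> unit3 (j - 3) else 0)
        = (\<Sum>r<3. if r = j - 3 then (if k r = i then 1 else 0) else 0)"
      using j by (intro sum.cong) (auto simp: unit3_inner)
    also have "\<dots> = (if k (j - 3) = i then 1 else 0)" using j by simp
    finally show ?thesis using False ij j k barycentricD(4)[OF l]
      by (auto simp: corner_coord_def corner_lift_def unit3_inner cong: if_cong)
  qed
qed

text \<open>Moving a raised vertex at constant height keeps its barycentric coordinate equal to 1,
  so the volume is multiplied by 1.\<close>

lemma corner_lift_volume_step:
  assumes l: "barycentric 3 p l" and k: "\<forall>r<3. k r < 3" and s: "s < 3" "i < 3"
  shows "measure lborel (convex hull (corner_lift p (k(s := i)) ` {..<6}))
       = measure lborel (convex hull (corner_lift p k ` {..<6}))"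
proof -
  obtain B :: "5 \<Rightarrow> (real^2) \<times> (real^3)" where B: "bij_betw B UNIV Basis"
    using finite_same_card_bij[of "UNIV :: 5 set" "Basis :: ((real^2) \<times> (real^3)) set"] by auto
  have g: "corner_coord l k (3 + s) (p i, unit3 s) = 1"
    using s by (simp add: corner_coord_def unit3_inner)
  have eq: "corner_lift p (k(s := i)) = (corner_lift p k)(3 + s := (p i, unit3 s))"
    by (auto simp: corner_lift_def fun_eq_iff)
  have bc: "barycentric 6 (corner_lift p k) (corner_coord l k)"
    by (rule barycentric_corner_lift[OF l k])
  show ?thesis
    unfolding eq by (subst measure_simplex_replace_vertex[OF B _ bc]) (use g s in auto)
qed

lemma corner_lift_volume:
  assumes l: "barycentric 3 p l" and k: "\<forall>r<3. k r < 3"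
  shows "measure lborel (convex hull (corner_lift p k ` {..<6}))
       = measure lborel (convex hull (corner_lift p (\<lambda>_. 0) ` {..<6}))"
proof -
  let ?V = "\<lambda>k. measure lborel (convex hull (corner_lift p k ` {..<6}))"
  have c: "corner_lift p k i = corner_lift p k' i" if "\<And>r. r < 3 \<Longrightarrow> k r = k' r" "i < 6" for k k' i
    using that by (simp add: corner_lift_def)
  have "?V k = ?V ((\<lambda>_. 0)(0 := k 0, 1 := k 1, 2 := k 2))"
    by (intro arg_cong[where f = "\<lambda>S. measure lborel (convex hull S)"] image_cong refl c)
      (auto simp: less_Suc_eq numeral_3_eq_3)
  also have "\<dots> = ?V (\<lambda>_. 0)"
    using k by (simp add: corner_lift_volume_step[OF l])
  finally show ?thesis .
qed

lemma corner_lift_fibre: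
  assumes l: "barycentric 3 p l" and k: "\<forall>r<3. k r < 3"
  shows "{z. (x, z) \<in> convex hull (corner_lift p k ` {..<6})} =
    {z. 0 \<le> z $ 1 \<and> 0 \<le> z $ 2 \<and> 0 \<le> z $ 3 \<and>
      (\<forall>i<3. (if k 0 = i then z $ 1 else 0) + (if k 1 = i then z $ 2 else 0) + (if k 2 = i then z $ 3 else 0) \<le> l i x)}"
proof -
  have all: "(\<forall>i<6. P i) \<longleftrightarrow> (\<forall>i<3. P i) \<and> P 3 \<and> P 4 \<and> P 5" for P :: "nat \<Rightarrow> bool"
  proof -
    have "i < 6 \<longleftrightarrow> i < 3 \<or> i = 3 \<or> i = 4 \<or> i = 5" for i :: nat by linarith
    then show ?thesis by auto
  qed
  have sum3: "(\<Sum>r<3. f r) = f 0 + f 1 + f 2" for f :: "nat \<Rightarrow> real"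
    by (simp add: eval_nat_numeral)
  have u: "unit3 0 \<bullet> z = z $ 1" "unit3 1 \<bullet> z = z $ 2" "unit3 2 \<bullet> z = z $ 3" for z
    by (simp_all add: unit3_def inner_axis')
  have cs: "corner_coord l k 3 (x, z) = z $ 1" "corner_coord l k 4 (x, z) = z $ 2"
    "corner_coord l k 5 (x, z) = z $ 3" for z
    by (simp_all add: corner_coord_def u[unfolded One_nat_def])
  have ci: "0 \<le> corner_coord l k i (x, z) \<longleftrightarrow>
      (if k 0 = i then z $ 1 else 0) + (if k 1 = i then z $ 2 else 0) + (if k 2 = i then z $ 3 else 0) \<le> l i x"
    if "i < 3" for i z
    unfolding corner_coord_def sum3 snd_conv u using that by simp
  have "(\<forall>i<3. 0 \<le> corner_coord l k i (x, z)) \<longleftrightarrow>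
      (\<forall>i<3. (if k 0 = i then z $ 1 else 0) + (if k 1 = i then z $ 2 else 0) + (if k 2 = i then z $ 3 else 0) \<le> l i x)"
    for z
    using ci by blast
  then show ?thesis
    unfolding barycentric_convex_hull[OF barycentric_corner_lift[OF l k]] all mem_Collect_eq cs by blast
qed

text \<open>Heights over the same knot share one bound \<open>l i x\<close>. So the fibre is a
  corner simplex, a prism or a box according as the three extra knots are equal, two of them equal,
  or all different.\<close>

lemma corner_lift_fibre_measure:
  fixes p :: "nat \<Rightarrow> real^2"
  assumes l: "barycentric 3 p l" and ij: "i < 3" "j < 3" "i \<noteq> j"
  defines "T \<equiv> convex hull (p ` {..<3})"
  shows "measure lborel {z. (x, z) \<in> convex hull (corner_lift p (\<lambda>_. i) ` {..<6})}
       = (if x \<in> T then l i x ^ 3 / 6 else 0)"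
    and "measure lborel {z. (x, z) \<in> convex hull (corner_lift p ((\<lambda>_. i)(2 := j)) ` {..<6})}
       = (if x \<in> T then (l i x)\<^sup>2 * l j x / 2 else 0)"
    and "measure lborel {z. (x, z) \<in> convex hull (corner_lift p id ` {..<6})}
       = (if x \<in> T then l 0 x * l 1 x * l 2 x else 0)"
proof -
  have T: "x \<in> T \<longleftrightarrow> (\<forall>i<3. 0 \<le> l i x)"
    unfolding T_def barycentric_convex_hull[OF l] by simp
  \<comment> \<open>Outside the triangle some \<open>l i x\<close> is negative, whereas it bounds a
    sum of nonnegative heights.\<close>
  have emp: "{z. (x, z) \<in> convex hull (corner_lift p k ` {..<6})} = {}"
    if "x \<notin> T" "\<forall>r<3. k r < 3" for k
  proof -
    obtain i where i: "i < 3" "l i x < 0" using \<open>x \<notin> T\<close> T by (auto simp: not_le)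
    have False if "z \<in> {z. (x, z) \<in> convex hull (corner_lift p k ` {..<6})}" for z
    proof -
      have z: "0 \<le> z $ 1" "0 \<le> z $ 2" "0 \<le> z $ 3"
        "(if k 0 = i then z $ 1 else 0) + (if k 1 = i then z $ 2 else 0) + (if k 2 = i then z $ 3 else 0) \<le> l i x"
        using that i(1) unfolding corner_lift_fibre[OF l \<open>\<forall>r<3. k r < 3\<close>] by blast+
      then have "0 \<le> l i x" by (auto split: if_splits)
      then show False using i(2) by simp
    qed
    then show ?thesis by blast
  qed
  have ifs: "(if i = m then a else 0) + (if i = m then b else 0) + (if i = m then c else 0)
      = (if i = m then a + b + c else (0::real))"
    "(if i = m then a else 0) + (if i = m then b else 0) + (if j = m then c else 0)
      = (if i = m then a + b else if j = m then c else (0::real))" for m a b c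
    using ij(3) by auto
  have A: "measure lborel {z. (x, z) \<in> convex hull (corner_lift p (\<lambda>_. i) ` {..<6})} = l i x ^ 3 / 6" if "x \<in> T"
  proof -
    have nn: "0 \<le> l m x" if "m < 3" for m using \<open>x \<in> T\<close> T that by blast
    have all: "(\<forall>m<3. (if i = m then s else 0) \<le> l m x) \<longleftrightarrow> s \<le> l i x" for s
      using nn ij(1) by auto
    have k: "\<forall>r<3::nat. i < 3" using ij by simp
    show ?thesis
      unfolding corner_lift_fibre[OF l k] ifs all by (rule measure_corner_simplex[OF nn[OF ij(1)]])
  qed
  have B: "measure lborel {z. (x, z) \<in> convex hull (corner_lift p ((\<lambda>_. i)(2 := j)) ` {..<6})}
      = (l i x)\<^sup>2 * l j x / 2" if "x \<in> T"
  proof -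
    have nn: "0 \<le> l m x" if "m < 3" for m using \<open>x \<in> T\<close> T that by blast
    have all: "(\<forall>m<3. (if i = m then s else if j = m then t else 0) \<le> l m x) \<longleftrightarrow> s \<le> l i x \<and> t \<le> l j x" for s t
      using nn ij by auto
    have k: "\<forall>r<3::nat. ((\<lambda>_. i)(2 := j)) r < 3" using ij by simp
    have u: "((\<lambda>_. i)(2 := j)) (0::nat) = i" "((\<lambda>_. i)(2 := j)) (1::nat) = i" "((\<lambda>_. i)(2 := j)) (2::nat) = j"
      by simp_all
    show ?thesis
      unfolding corner_lift_fibre[OF l k] u ifs all by (rule measure_corner_prism[OF nn[OF ij(1)] nn[OF ij(2)]])
  qed
  have C: "measure lborel {z. (x, z) \<in> convex hull (corner_lift p id ` {..<6})}
      = l 0 x * l 1 x * l 2 x" if "x \<in> T"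
  proof -
    have "{z. (x, z) \<in> convex hull (corner_lift p id ` {..<6})} =
      {z. 0 \<le> z $ 1 \<and> 0 \<le> z $ 2 \<and> 0 \<le> z $ 3 \<and> z $ 1 \<le> l 0 x \<and> z $ 2 \<le> l 1 x \<and> z $ 3 \<le> l 2 x}"
    proof -
      have "(\<forall>i<3. P i) \<longleftrightarrow> P 0 \<and> P 1 \<and> P 2" for P :: "nat \<Rightarrow> bool"
        by (auto simp: eval_nat_numeral less_Suc_eq)
      then show ?thesis by (subst corner_lift_fibre[OF l]) auto
    qed
    then show ?thesis using measure_corner_box[of "l 0 x" "l 1 x" "l 2 x"] that T by simp
  qed
  show "measure lborel {z. (x, z) \<in> convex hull (corner_lift p (\<lambda>_. i) ` {..<6})}
       = (if x \<in> T then l i x ^ 3 / 6 else 0)"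
    using A emp[of "\<lambda>_. i"] ij by simp
  show "measure lborel {z. (x, z) \<in> convex hull (corner_lift p ((\<lambda>_. i)(2 := j)) ` {..<6})}
       = (if x \<in> T then (l i x)\<^sup>2 * l j x / 2 else 0)"
    using B emp[of "(\<lambda>_. i)(2 := j)"] ij by simp
  show "measure lborel {z. (x, z) \<in> convex hull (corner_lift p id ` {..<6})}
       = (if x \<in> T then l 0 x * l 1 x * l 2 x else 0)"
    using C emp[of id] by simp
qed

text \<open>Integrating \<open>(l 0 + l 1 + l 2) ^ 3 = 1\<close> over the triangle gives the common volume of
  all the corner lifts, by Fubini.\<close>
lemma corner_lift_volume_eq:
  fixes p :: "nat \<Rightarrow> real^2"
  assumes l: "barycentric 3 p l" and k: "\<forall>r<3. k r < 3"
  shows "measure lborel (convex hull (corner_lift p k ` {..<6})) = measure lborel (convex hull (p ` {..<3})) / 60"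
proof -
  define T where "T = convex hull (p ` {..<3})"
  define V where "V = measure lborel (convex hull (corner_lift p (\<lambda>_. 0) ` {..<6}))"
  have comp: "compact T" unfolding T_def by (rule compact_vertex_hull)
  define J where "J = (\<lambda>f :: real^2 \<Rightarrow> real. \<integral>x. (if x \<in> T then f x else 0) \<partial>lborel)"
  have I: "integrable lborel (\<lambda>x. if x \<in> T then f x else 0)" if "continuous_on T f" for f :: "real^2 \<Rightarrow> real"
  proof -
    have "(\<lambda>x. indicat_real T x *\<^sub>R f x) = (\<lambda>x. if x \<in> T then f x else 0)"
      by (auto simp: indicator_def fun_eq_iff)
    then show ?thesis using borel_integrable_compact[OF comp that] by simp
  qed
  have Jadd: "J (\<lambda>x. f x + h x) = J f + J h" if "continuous_on T f" "continuous_on T h" for f h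
  proof -
    have "J (\<lambda>x. f x + h x) = (\<integral>x. (if x \<in> T then f x else 0) + (if x \<in> T then h x else 0) \<partial>lborel)"
      unfolding J_def by (intro Bochner_Integration.integral_cong) auto
    then show ?thesis using I[OF that(1)] I[OF that(2)] by (simp add: J_def)
  qed
  have Jmult: "J (\<lambda>x. c * f x) = c * J f" for c f
  proof -
    have "J (\<lambda>x. c * f x) = (\<integral>x. c * (if x \<in> T then f x else 0) \<partial>lborel)"
      unfolding J_def by (intro Bochner_Integration.integral_cong) auto
    then show ?thesis by (simp add: J_def)
  qed
  have fub: "V = J f" if "\<forall>r<3. k r < 3"
    "\<And>x. measure lborel {z. (x, z) \<in> convex hull (corner_lift p k ` {..<6})} = (if x \<in> T then f x else 0)" for k f
  proof -
    have "V = measure lborel (convex hull (corner_lift p k ` {..<6}))"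
      unfolding V_def by (rule corner_lift_volume[OF l that(1), symmetric])
    also have "\<dots> = (\<integral>x. measure lborel {z. (x, z) \<in> convex hull (corner_lift p k ` {..<6})} \<partial>lborel)"
      by (rule measure_fibres[OF compact_vertex_hull])
    also have "\<dots> = J f" by (simp only: that(2) J_def)
    finally show ?thesis .
  qed
  have J1: "J (\<lambda>x. l i x ^ 3) = 6 * V" if "i < 3" for i
  proof -
    define j :: nat where "j = (if i = 0 then 1 else 0)"
    have "j < 3" "i \<noteq> j" by (auto simp: j_def)
    have "V = J (\<lambda>x. l i x ^ 3 / 6)"
      by (rule fub[of "\<lambda>_. i"]) (use corner_lift_fibre_measure(1)[OF l that \<open>j < 3\<close> \<open>i \<noteq> j\<close>] that T_def in auto)
    then show ?thesis using Jmult[of "1/6" "\<lambda>x. l i x ^ 3"] by simp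
  qed
  have J2: "J (\<lambda>x. (l i x)\<^sup>2 * l j x) = 2 * V" if "i < 3" "j < 3" "i \<noteq> j" for i j
  proof -
    have "V = J (\<lambda>x. (l i x)\<^sup>2 * l j x / 2)"
      by (rule fub[of "(\<lambda>_. i)(2 := j)"]) (use corner_lift_fibre_measure(2)[OF l that] that T_def in auto)
    then show ?thesis using Jmult[of "1/2" "\<lambda>x. (l i x)\<^sup>2 * l j x"] by simp
  qed
  have J3: "J (\<lambda>x. l 0 x * l 1 x * l 2 x) = V"
    by (rule fub[of id, symmetric]) (use corner_lift_fibre_measure(3)[OF l, of 0 1] T_def in auto)
  have lc: "continuous_on T (l i)" if "i < 3" for i using barycentric_continuous[OF l that] .
  \<comment> \<open>Continuity, which gives integrability, travels together with the value, so that
    the integral of the expanded cube can be assembled rule by rule.\<close>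
  define H where "H f c \<longleftrightarrow> continuous_on T f \<and> J f = c" for f c
  have Hadd: "H (\<lambda>x. f x + h x) (c + d)" if "H f c" "H h d" for f h c d
    using that Jadd by (auto simp: H_def intro: continuous_on_add)
  have Hmult: "H (\<lambda>x. a * f x) (a * c)" if "H f c" for a f c
    using that Jmult by (auto simp: H_def intro: continuous_on_mult_left)
  have H1: "H (\<lambda>x. l i x ^ 3) (6 * V)" if "i < 3" for i
    using J1 lc that by (auto simp: H_def intro!: continuous_intros)
  have H2: "H (\<lambda>x. (l i x)\<^sup>2 * l j x) (2 * V)" if "i < 3" "j < 3" "i \<noteq> j" for i j
    using J2 lc that by (auto simp: H_def intro!: continuous_intros)
  have H3: "H (\<lambda>x. l 0 x * l 1 x * l 2 x) V"
    using J3 lc by (auto simp: H_def intro!: continuous_intros)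
  have l1: "l 0 x + l 1 x + l 2 x = 1" for x
    using barycentricD(2)[OF l, of x] by (simp add: eval_nat_numeral)
  \<comment> \<open>Nested to the right, so that \<open>Hadd\<close> splits off one monomial at a
    time.\<close>
  have cube: "(a + b + c) ^ 3 = a ^ 3 + (b ^ 3 + (c ^ 3 + (3 * (a\<^sup>2 * b) + (3 * (a\<^sup>2 * c) +
      (3 * (b\<^sup>2 * a) + (3 * (b\<^sup>2 * c) + (3 * (c\<^sup>2 * a) +
      (3 * (c\<^sup>2 * b) + 6 * (a * b * c)))))))))" for a b c :: real
    by (simp add: power2_eq_square power3_eq_cube algebra_simps)
  have "H (\<lambda>x. (l 0 x + l 1 x + l 2 x) ^ 3) (6 * V + (6 * V + (6 * V + (3 * (2 * V) + (3 * (2 * V) +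
      (3 * (2 * V) + (3 * (2 * V) + (3 * (2 * V) + (3 * (2 * V) + 6 * V)))))))))"
    unfolding cube by (intro Hadd Hmult H1 H2 H3) simp_all
  \<comment> \<open>The ten terms contribute 3 * 6 + 6 * 6 + 6 = 60 times \<open>V\<close>.\<close>
  then have J1: "J (\<lambda>_. 1) = 60 * V" by (simp only: l1 power_one H_def)
  have "measure lborel T = (\<integral>x. indicat_real T x \<partial>lborel)"
    using comp by (simp add: compact_imp_closed)
  also have "\<dots> = J (\<lambda>_. 1)"
    unfolding J_def by (intro Bochner_Integration.integral_cong) (auto simp: indicator_def)
  finally have "measure lborel T = 60 * V" using J1 by simp
  then show ?thesis
    using corner_lift_volume[OF l k] unfolding V_def T_def by linarith
qed

text \<open>Dividing by the common volume \<open>A / 60\<close> gives the constants 60 / 6, 60 / 2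
  and 60. They are 10 times the multinomial factors 1, 3 and 6 of the Bernstein polynomials.\<close>

lemma simplex_spline_bernstein:
  fixes p :: "nat \<Rightarrow> real^2"
  assumes l: "barycentric 3 p l" and x: "x \<in> convex hull (p ` {..<3})"
  defines "A \<equiv> measure lborel (convex hull (p ` {..<3}))"
  shows "i < 3 \<Longrightarrow> simplex_spline [p 0, p 1, p 2, p i, p i, p i] x = 10 / A * l i x ^ 3"
    and "i < 3 \<Longrightarrow> j < 3 \<Longrightarrow> i \<noteq> j \<Longrightarrow>
      simplex_spline [p 0, p 1, p 2, p i, p i, p j] x = 30 / A * (l i x)\<^sup>2 * l j x"
    and "simplex_spline [p 0, p 1, p 2, p 0, p 1, p 2] x = 60 / A * l 0 x * l 1 x * l 2 x"
proof -
  have S: "simplex_spline [p 0, p 1, p 2, p (k 0), p (k 1), p (k 2)] x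
      = 60 / A * measure lborel {z. (x, z) \<in> convex hull (corner_lift p k ` {..<6})}"
    if k: "\<forall>r<3. k r < 3" for k
  proof -
    have "simplex_spline [p 0, p 1, p 2, p (k 0), p (k 1), p (k 2)] x
      = measure lborel {z. (x, z) \<in> convex hull (corner_lift p k ` {..<6})}
         / measure lborel (convex hull (corner_lift p k ` {..<6}))"
    proof (rule simplex_spline_eq[OF barycentric_corner_lift[OF l k]])
      fix i :: nat assume "i < 6"
      then have "i = 0 \<or> i = 1 \<or> i = 2 \<or> i = 3 \<or> i = 4 \<or> i = 5" by linarith
      then show "fst (corner_lift p k i) = [p 0, p 1, p 2, p (k 0), p (k 1), p (k 2)] ! i"
        by (elim disjE) (simp_all add: corner_lift_def)
    qed simp
    then show ?thesis unfolding corner_lift_volume_eq[OF l k] A_def[symmetric] by simp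
  qed
  show "simplex_spline [p 0, p 1, p 2, p i, p i, p i] x = 10 / A * l i x ^ 3" if i: "i < 3"
  proof -
    define j :: nat where "j = (if i = 0 then 1 else 0)"
    have j: "j < 3" "i \<noteq> j" by (auto simp: j_def)
    have "\<forall>r<3::nat. i < 3" using i by simp
    from S[OF this] show ?thesis
      unfolding corner_lift_fibre_measure(1)[OF l i j] if_P[OF x] by simp
  qed
  show "simplex_spline [p 0, p 1, p 2, p i, p i, p j] x = 30 / A * (l i x)\<^sup>2 * l j x"
    if ij: "i < 3" "j < 3" "i \<noteq> j"
  proof -
    have "\<forall>r<3::nat. ((\<lambda>_. i)(2 := j)) r < 3" using ij by simp
    from S[OF this] show ?thesis
      unfolding corner_lift_fibre_measure(2)[OF l ij] if_P[OF x] by simp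
  qed
  have "\<forall>r<3. id r < (3::nat)" by simp
  from S[OF this] show "simplex_spline [p 0, p 1, p 2, p 0, p 1, p 2] x = 60 / A * l 0 x * l 1 x * l 2 x"
    unfolding corner_lift_fibre_measure(3)[OF l, of 0 1, simplified] if_P[OF x] by simp
qed

section \<open>Lines in the plane and coordinates of the triangle\<close>

lemma collinear_imp_hyperplane2:
  fixes S :: "(real^2) set"
  assumes "collinear S"
  shows "\<exists>a b. a \<noteq> 0 \<and> S \<subseteq> {u. a \<bullet> u = b}"
proof (cases "S = {}")
  case True
  then show ?thesis by (intro exI[of _ "axis 1 1"]) (auto simp: axis_def vec_eq_iff)
next
  case False
  then obtain s where s: "s \<in> S" by blast
  obtain u where u: "\<And>x y. x \<in> S \<Longrightarrow> y \<in> S \<Longrightarrow> \<exists>c. x - y = c *\<^sub>R u"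
    using assms unfolding collinear_def by blast
  \<comment> \<open>The direction rotated by a right angle is a normal. For \<open>u = 0\<close> all
    points coincide and any normal serves.\<close>
  define a :: "real^2" where "a = (if u = 0 then axis 1 1 else vector [- (u $ 2), u $ 1])"
  have "a \<noteq> 0" by (auto simp: a_def vec_eq_iff forall_2 axis_def)
  have "a \<bullet> u = 0" by (auto simp: a_def inner_vec_def sum_2)
  have "a \<bullet> x = a \<bullet> s" if x: "x \<in> S" for x
  proof -
    obtain c where "x - s = c *\<^sub>R u" using u[OF x s] by blast
    then have "a \<bullet> (x - s) = 0" using \<open>a \<bullet> u = 0\<close> by simp
    then show ?thesis by (simp add: inner_diff_right)
  qed
  then show ?thesis using \<open>a \<noteq> 0\<close> by blast
qed

text \<open>The affine function that vanishes on the common line has values \<open>f1\<close>,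
  \<open>f2\<close>, \<open>f3\<close> at the vertices. They solve a homogeneous system with
  determinant \<open>?d\<close>; were it nonzero, the vertices would lie on the line too.\<close>

lemma collinear_combinations_det:
  fixes p1 p2 p3 :: "real^2"
  assumes nc: "\<not> collinear {p1, p2, p3}"
    and col: "collinear {a1 *\<^sub>R p1 + a2 *\<^sub>R p2 + a3 *\<^sub>R p3, b1 *\<^sub>R p1 + b2 *\<^sub>R p2 + b3 *\<^sub>R p3,
      c1 *\<^sub>R p1 + c2 *\<^sub>R p2 + c3 *\<^sub>R p3}"
    and s: "a1 + a2 + a3 = 1" "b1 + b2 + b3 = 1" "c1 + c2 + c3 = 1"
  shows "a1 * (b2 * c3 - b3 * c2) - a2 * (b1 * c3 - b3 * c1) + a3 * (b1 * c2 - b2 * c1) = 0"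
proof (rule ccontr)
  let ?d = "a1 * (b2 * c3 - b3 * c2) - a2 * (b1 * c3 - b3 * c1) + a3 * (b1 * c2 - b2 * c1)"
  assume d: "?d \<noteq> 0"
  obtain n b where n: "n \<noteq> 0" and sub: "{a1 *\<^sub>R p1 + a2 *\<^sub>R p2 + a3 *\<^sub>R p3,
      b1 *\<^sub>R p1 + b2 *\<^sub>R p2 + b3 *\<^sub>R p3, c1 *\<^sub>R p1 + c2 *\<^sub>R p2 + c3 *\<^sub>R p3} \<subseteq> {u. n \<bullet> u = b}"
    using collinear_imp_hyperplane2[OF col] by blast
  define f1 f2 f3 where f: "f1 = n \<bullet> p1 - b" "f2 = n \<bullet> p2 - b" "f3 = n \<bullet> p3 - b"
  have lin: "x1 * f1 + x2 * f2 + x3 * f3 = n \<bullet> (x1 *\<^sub>R p1 + x2 *\<^sub>R p2 + x3 *\<^sub>R p3) - b"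
    if "x1 + x2 + x3 = 1" for x1 x2 x3
  proof -
    have "x1 * f1 + x2 * f2 + x3 * f3 = n \<bullet> (x1 *\<^sub>R p1 + x2 *\<^sub>R p2 + x3 *\<^sub>R p3) - (x1 + x2 + x3) * b"
      by (simp add: f inner_add_right algebra_simps)
    then show ?thesis by (simp add: that)
  qed
  have e: "a1 * f1 + a2 * f2 + a3 * f3 = 0" "b1 * f1 + b2 * f2 + b3 * f3 = 0" "c1 * f1 + c2 * f2 + c3 * f3 = 0"
    using sub lin[OF s(1)] lin[OF s(2)] lin[OF s(3)] by auto
  have "?d * f1 = 0" "?d * f2 = 0" "?d * f3 = 0" using e by algebra+
  then have "f1 = 0" "f2 = 0" "f3 = 0" using d by auto
  then have "{p1, p2, p3} \<subseteq> {u. n \<bullet> u = b}" by (auto simp: f)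
  then show False using nc collinear_hyperplane2[OF n] collinear_subset by blast
qed

lemma triangle_barycentric:
  fixes p1 p2 p3 :: "real^2"
  assumes nc: "\<not> collinear {p1, p2, p3}"
  obtains l where "barycentric 3 (\<lambda>i. [p1, p2, p3] ! i) l"
proof -
  have "\<exists>g. barycentric 3 (\<lambda>i. [p1, p2, p3] ! i) g"
  proof (rule barycentric_exists)
    fix a b assume ab: "\<And>i. i < 3 \<Longrightarrow> a \<bullet> [p1, p2, p3] ! i = b"
    show "a = 0"
    proof (rule ccontr)
      assume "a \<noteq> 0"
      have "{p1, p2, p3} \<subseteq> {u. a \<bullet> u = b}"
        using ab[of 0] ab[of 1] ab[of 2] by auto
      then show False using nc collinear_hyperplane2[OF \<open>a \<noteq> 0\<close>] collinear_subset by blast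
    qed
  qed simp
  then show thesis using that by blast
qed

text \<open>\<open>g i\<close> takes different values at two vertices, so it is nonconstant, and it
  is strictly positive on the interior of its half-space.\<close>

lemma barycentric_interior_pos:
  assumes b: "barycentric n v g" and i: "i < n" "1 < n" and x: "x \<in> interior (convex hull (v ` {..<n}))"
  shows "0 < g i x"
proof -
  obtain c a where g: "\<And>p. g i p = c + a \<bullet> p" using barycentricD(1)[OF b i(1)] by blast
  have "a \<noteq> 0"
  proof
    assume a: "a = 0"
    define j where "j = (if i = 0 then 1 else 0 :: nat)"
    have "g i (v i) \<noteq> g i (v j)" using barycentricD(4)[OF b i(1)] i by (auto simp: j_def)
    then show False by (simp add: g a)
  qed
  have "convex hull (v ` {..<n}) \<subseteq> {p. a \<bullet> p \<ge> - c}"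
    unfolding barycentric_convex_hull[OF b] using i by (auto simp: g dest!: spec[of _ i])
  then have "x \<in> interior {p. a \<bullet> p \<ge> - c}" using interior_mono x by blast
  then show ?thesis using \<open>a \<noteq> 0\<close> by (simp add: g)
qed

section \<open>Knots on the triangle\<close>

text \<open>The knot \<open>p\<^sub>i\<close> is coded by the number \<open>i\<close> and \<open>p\<^sub>i\<^sub>,\<^sub>j\<close> by the number with the digits \<open>i j\<close>;
  coordinates are three times the barycentric ones.\<close>
definition coord :: "nat \<Rightarrow> int \<times> int \<times> int" where
  "coord n = (if n = 1 then (3, 0, 0) else if n = 2 then (0, 3, 0) else if n = 3 then (0, 0, 3)
    else if n = 12 then (0, 2, 1) else if n = 13 then (0, 1, 2) else if n = 21 then (2, 0, 1)
    else if n = 23 then (1, 0, 2) else if n = 31 then (2, 1, 0) else (1, 2, 0))"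

definition knot :: "real^2 \<Rightarrow> real^2 \<Rightarrow> real^2 \<Rightarrow> nat \<Rightarrow> real^2" where
  "knot p1 p2 p3 n = (case coord n of (a, b, c) \<Rightarrow>
     (of_int a / 3) *\<^sub>R p1 + (of_int b / 3) *\<^sub>R p2 + (of_int c / 3) *\<^sub>R p3)"

text \<open>For two coordinate triples this gives the coefficients of the line through the points,
  and \<open>dot\<close> with a third triple is the determinant that tests collinearity. Integer
  triples let all such conditions be settled by evaluation.\<close>

definition cross :: "int \<times> int \<times> int \<Rightarrow> int \<times> int \<times> int \<Rightarrow> int \<times> int \<times> int" where
  "cross u v = (case u of (a, b, c) \<Rightarrow> case v of (a', b', c') \<Rightarrow>
     (b * c' - c * b', c * a' - a * c', a * b' - b * a'))"

definition dot :: "int \<times> int \<times> int \<Rightarrow> int \<times> int \<times> int \<Rightarrow> int" where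
  "dot u v = (case u of (a, b, c) \<Rightarrow> case v of (a', b', c') \<Rightarrow> a * a' + b * b' + c * c')"

definition coords :: "nat list \<Rightarrow> (int \<times> int \<times> int) list" where
  "coords L = map coord (remdups L)"

text \<open>A noncollinear set has a noncollinear triple through each of its points, so it is enough
  to try the triples that contain the head.\<close>

primrec noncollinear_coords :: "(int \<times> int \<times> int) list \<Rightarrow> bool" where
  "noncollinear_coords [] = False"
| "noncollinear_coords (u # us) = (\<exists>v\<in>set us. \<exists>w\<in>set us. dot (cross u v) w \<noteq> 0)"

definition noncollinear_knots :: "nat list \<Rightarrow> bool" where
  "noncollinear_knots L = noncollinear_coords (coords L)"

text \<open>A linear form with such coefficients is positive wherever all three barycentric
  coordinates are. The opposite sign is covered by exchanging \<open>u\<close> and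
  \<open>v\<close>.\<close>

definition edge_coords :: "(int \<times> int \<times> int) list \<Rightarrow> bool" where
  "edge_coords us \<longleftrightarrow> (\<exists>u\<in>set us. \<exists>v\<in>set us. case cross u v of (a, b, c) \<Rightarrow>
     0 \<le> a \<and> 0 \<le> b \<and> 0 \<le> c \<and> 0 < a + b + c)"

text \<open>The second alternative says that the knots contain two points of one edge: a line through
  them misses the interior of the triangle.\<close>
definition off_interior :: "nat list \<Rightarrow> bool" where
  "off_interior L \<longleftrightarrow> noncollinear_knots L \<or> edge_coords (coords L)"

text \<open>Positions rather than values are dropped, because a multiple knot has to lose one copy
  only.\<close>

definition omit :: "nat list \<Rightarrow> nat list \<Rightarrow> nat list" where
  "omit L J = map ((!) L) (filter (\<lambda>j. j \<notin> set J) [0..<length L])"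

type_synonym insertion = "int \<times> int list \<times> nat list \<times> nat list \<times> nat"

text \<open>\<open>(d, ks, ds, R, e)\<close> stands for the insertion of the knot \<open>e = (\<Sum>i. (ks ! i / d) *\<^sub>R ds ! i)\<close>
  into the knot list \<open>ds @ R\<close>.\<close>
definition valid_insertion :: "insertion \<Rightarrow> bool" where
  "valid_insertion C = (case C of (d, ks, ds, R, e) \<Rightarrow>
     d \<noteq> 0 \<and> length ks = length ds \<and> length (ds @ R) = 6 \<and> sum_list ks = d \<and>
     noncollinear_knots (ds @ R) \<and>
     d * fst (coord e) = sum_list (map2 (\<lambda>k n. k * fst (coord n)) ks ds) \<and>
     d * fst (snd (coord e)) = sum_list (map2 (\<lambda>k n. k * fst (snd (coord n))) ks ds) \<and>
     d * snd (snd (coord e)) = sum_list (map2 (\<lambda>k n. k * snd (snd (coord n))) ks ds) \<and>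
     (\<forall>i\<in>set [0..<length ds]. off_interior (omit (ds @ R) [i])) \<and>
     (\<forall>k\<in>set [0..<length ds]. \<forall>i\<in>set [0..<k]. off_interior (e # omit (ds @ R) [i, k])))"

text \<open>Sorting gives every multiset of knots one name, and \<open>M\<close> stays abstract, so
  insertions become linear equations between atoms \<open>M L\<close>. The factor \<open>d\<close>
  keeps the coefficients integral.\<close>

definition insertion_eq :: "(nat list \<Rightarrow> real) \<Rightarrow> insertion \<Rightarrow> bool" where
  "insertion_eq M C = (case C of (d, ks, ds, R, e) \<Rightarrow>
     of_int d * M (sort (ds @ R)) = (\<Sum>i<length ds. of_int (ks ! i) * M (sort (ds[i := e] @ R))))"

lemma coord_sum: "coord n = (a, b, c) \<Longrightarrow> a + b + c = 3"
  by (auto simp: coord_def split: if_splits)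

lemma knot_collinear_det:
  assumes nc: "\<not> collinear {p1, p2, p3}" and col: "collinear {knot p1 p2 p3 u, knot p1 p2 p3 v, x}"
    and x: "x = t1 *\<^sub>R p1 + t2 *\<^sub>R p2 + t3 *\<^sub>R p3" "t1 + t2 + t3 = 1"
    and w: "cross (coord u) (coord v) = (w1, w2, w3)"
  shows "of_int w1 * t1 + of_int w2 * t2 + of_int w3 * t3 = (0 :: real)"
proof -
  obtain a b c where u: "coord u = (a, b, c)" by (cases "coord u") auto
  obtain a' b' c' where v: "coord v = (a', b', c')" by (cases "coord v") auto
  have "real_of_int a + real_of_int b + real_of_int c = 3" "real_of_int a' + real_of_int b' + real_of_int c' = 3"
    using coord_sum[OF u] coord_sum[OF v] by linarith+
  then have s: "real_of_int a / 3 + real_of_int b / 3 + real_of_int c / 3 = 1"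
    "real_of_int a' / 3 + real_of_int b' / 3 + real_of_int c' / 3 = 1" by linarith+
  have "collinear {t1 *\<^sub>R p1 + t2 *\<^sub>R p2 + t3 *\<^sub>R p3,
    (of_int a / 3) *\<^sub>R p1 + (of_int b / 3) *\<^sub>R p2 + (of_int c / 3) *\<^sub>R p3,
    (of_int a' / 3) *\<^sub>R p1 + (of_int b' / 3) *\<^sub>R p2 + (of_int c' / 3) *\<^sub>R p3}"
    using col by (simp add: knot_def u v x(1) insert_commute)
  from collinear_combinations_det[OF nc this x(2) s]
  have det: "t1 * (b * c' - c * b') - t2 * (a * c' - c * a') + t3 * (a * b' - b * a') = (0 :: real)"
    by (simp add: field_simps)
  have ws: "w1 = b * c' - c * b'" "w2 = c * a' - a * c'" "w3 = a * b' - b * a'"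
    using w by (auto simp: cross_def u v)
  show ?thesis unfolding ws using det by (simp add: algebra_simps)
qed

lemma noncollinear_knots:
  assumes nc: "\<not> collinear {p1, p2, p3}" and L: "noncollinear_knots L"
  shows "\<not> collinear (knot p1 p2 p3 ` set L)"
proof
  assume col: "collinear (knot p1 p2 p3 ` set L)"
  obtain u v w where uvw: "u \<in> set L" "v \<in> set L" "w \<in> set L" "dot (cross (coord u) (coord v)) (coord w) \<noteq> 0"
  proof -
    have "\<exists>u\<in>set (coords L). \<exists>v\<in>set (coords L). \<exists>w\<in>set (coords L). dot (cross u v) w \<noteq> 0"
      using L unfolding noncollinear_knots_def by (cases "coords L") (simp_all, blast)
    then show thesis using that by (auto simp: coords_def)
  qed
  obtain w1 w2 w3 where c: "cross (coord u) (coord v) = (w1, w2, w3)" by (cases "cross (coord u) (coord v)") auto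
  obtain t1 t2 t3 where t: "coord w = (t1, t2, t3)" by (cases "coord w") auto
  have "collinear {knot p1 p2 p3 u, knot p1 p2 p3 v, knot p1 p2 p3 w}"
    by (rule collinear_subset[OF col]) (use uvw in auto)
  moreover have "real_of_int t1 / 3 + real_of_int t2 / 3 + real_of_int t3 / 3 = 1"
    using coord_sum[OF t] by linarith
  ultimately have "of_int w1 * (of_int t1 / 3) + of_int w2 * (of_int t2 / 3) + of_int w3 * (of_int t3 / 3) = (0::real)"
    by (intro knot_collinear_det[OF nc _ _ _ c]) (auto simp: knot_def t)
  then have "real_of_int (w1 * t1 + w2 * t2 + w3 * t3) = 0" by simp
  then have "w1 * t1 + w2 * t2 + w3 * t3 = 0" by linarith
  then show False using uvw(4) by (simp add: dot_def c t)
qed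

lemma off_interior:
  assumes nc: "\<not> collinear {p1, p2, p3}" and L: "off_interior L"
    and x: "x \<in> interior (convex hull {p1, p2, p3})"
  shows "\<not> collinear (insert x (knot p1 p2 p3 ` set L))"
proof
  assume col: "collinear (insert x (knot p1 p2 p3 ` set L))"
  then have "\<not> noncollinear_knots L"
    using noncollinear_knots[OF nc] collinear_subset by blast
  then obtain u v a b c where uv: "u \<in> set L" "v \<in> set L" "cross (coord u) (coord v) = (a, b, c)"
    "0 \<le> a" "0 \<le> b" "0 \<le> c" "0 < a + b + c"
    using L unfolding off_interior_def edge_coords_def by (auto simp: coords_def)
  obtain l where l: "barycentric 3 (\<lambda>i. [p1, p2, p3] ! i) l" by (rule triangle_barycentric[OF nc])
  have T: "(\<lambda>i. [p1, p2, p3] ! i) ` {..<3} = {p1, p2, p3}"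
    by (auto simp: eval_nat_numeral lessThan_Suc)
  have pos: "0 < l i x" if "i < 3" for i
    using barycentric_interior_pos[OF l that] x by (simp add: T)
  have "collinear {knot p1 p2 p3 u, knot p1 p2 p3 v, x}"
    by (rule collinear_subset[OF col]) (use uv in auto)
  moreover have "x = l 0 x *\<^sub>R p1 + l 1 x *\<^sub>R p2 + l 2 x *\<^sub>R p3"
    using barycentricD(3)[OF l, of x] by (simp add: eval_nat_numeral add_ac)
  moreover have "l 0 x + l 1 x + l 2 x = 1"
    using barycentricD(2)[OF l, of x] by (simp add: eval_nat_numeral add_ac)
  ultimately have 0: "of_int a * l 0 x + of_int b * l 1 x + of_int c * l 2 x = 0"
    by (rule knot_collinear_det[OF nc _ _ _ uv(3)])
  have "0 \<le> of_int a * l 0 x" "0 \<le> of_int b * l 1 x" "0 \<le> of_int c * l 2 x"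
    using uv pos[of 0] pos[of 1] pos[of 2] by auto
  moreover have "0 < a \<or> 0 < b \<or> 0 < c" using uv by linarith
  then have "0 < of_int a * l 0 x \<or> 0 < of_int b * l 1 x \<or> 0 < of_int c * l 2 x"
    using pos[of 0] pos[of 1] pos[of 2] by auto
  ultimately show False using 0 by linarith
qed

lemma set_omit:
  assumes "length L = n"
  shows "f ` set (omit L J) = (!) (map f L) ` ({..<n} - set J)"
  using assms by (force simp: omit_def)

lemma valid_insertion_imp_eq:
  assumes nc: "\<not> collinear {p1, p2, p3}" and C: "valid_insertion C"
    and x: "x \<in> interior (convex hull {p1, p2, p3})"
  shows "insertion_eq (\<lambda>L. simplex_spline (map (knot p1 p2 p3) L) x) C"
proof -
  let ?k = "knot p1 p2 p3"
  obtain d ks ds R e where Ceq: "C = (d, ks, ds, R, e)" by (cases C) auto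
  note V = C[unfolded valid_insertion_def Ceq prod.case]
  define n where "n = length ds"
  have n: "n \<le> 6" "length ks = n" "length (ds @ R) = 6" "d \<noteq> 0" "sum_list ks = d"
    using V by (auto simp: n_def)
  \<comment> \<open>Only the knots in \<open>ds\<close> carry weight. Those in \<open>R\<close> get
    weight 0, so the conditions of the insertion lemma concern positions below \<open>n\<close>
    alone.\<close>
  define \<gamma> where "\<gamma> i = (if i < n then real_of_int (ks ! i) / of_int d else 0)" for i
  have sum6: "(\<Sum>i<6. if i < n then f i else 0) = (\<Sum>i<n. f i)" for f :: "nat \<Rightarrow> 'a::comm_monoid_add"
  proof -
    have "(\<Sum>i<6. if i < n then f i else 0) = (\<Sum>i\<in>{i\<in>{..<6}. i < n}. f i)"
      by (rule sum.inter_filter[symmetric]) simp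
    also have "{i\<in>{..<6}. i < n} = {..<n}" using n(1) by auto
    finally show ?thesis .
  qed
  have sl: "sum_list (map2 (\<lambda>k q. k * f q) ks ds) = (\<Sum>i<n. ks ! i * f (ds ! i))" for f :: "nat \<Rightarrow> int"
    using n(2) by (simp add: sum_list_sum_nth n_def atLeast0LessThan)
  have sk: "(\<Sum>i<n. ks ! i) = d" using n(2,5) by (simp add: sum_list_sum_nth atLeast0LessThan)
  have k6: "map ?k (ds @ R) ! i = ?k (ds ! i)" if "i < n" for i
    using that by (simp add: n_def nth_append)
  have knot: "real_of_int d *\<^sub>R ?k e = (\<Sum>i<n. real_of_int (ks ! i) *\<^sub>R ?k (ds ! i))"
  proof -
    have k: "?k m = (of_int (fst (coord m)) / 3) *\<^sub>R p1 + (of_int (fst (snd (coord m))) / 3) *\<^sub>R p2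
        + (of_int (snd (snd (coord m))) / 3) *\<^sub>R p3" for m
      by (simp add: knot_def split: prod.splits)
    have c: "real_of_int d * real_of_int (f (coord e)) = (\<Sum>i<n. of_int (ks ! i) * of_int (f (coord (ds ! i))))"
      if "d * f (coord e) = (\<Sum>i<n. ks ! i * f (coord (ds ! i)))" for f :: "int \<times> int \<times> int \<Rightarrow> int"
      using arg_cong[OF that, of real_of_int] by simp
    have "d * fst (coord e) = (\<Sum>i<n. ks ! i * fst (coord (ds ! i)))"
      "d * fst (snd (coord e)) = (\<Sum>i<n. ks ! i * fst (snd (coord (ds ! i))))"
      "d * snd (snd (coord e)) = (\<Sum>i<n. ks ! i * snd (snd (coord (ds ! i))))"
      using V sl by auto
    note cc = c[of fst, OF this(1)] c[of "\<lambda>u. fst (snd u)", OF this(2)] c[of "\<lambda>u. snd (snd u)", OF this(3)]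
    have "real_of_int d *\<^sub>R ?k e = ((real_of_int d * of_int (fst (coord e))) / 3) *\<^sub>R p1
       + ((real_of_int d * of_int (fst (snd (coord e)))) / 3) *\<^sub>R p2
       + ((real_of_int d * of_int (snd (snd (coord e)))) / 3) *\<^sub>R p3"
      by (simp add: k scaleR_right_distrib)
    also have "\<dots> = (\<Sum>i<n. real_of_int (ks ! i) *\<^sub>R ?k (ds ! i))"
      unfolding cc k by (simp add: sum_divide_distrib scaleR_left.sum scaleR_right_distrib sum.distrib)
    finally show ?thesis .
  qed
  have "simplex_spline (map ?k (ds @ R)) x = (\<Sum>i<6. \<gamma> i * simplex_spline ((map ?k (ds @ R))[i := ?k e]) x)"
  proof (rule simplex_spline_insertion)
    show "length (map ?k (ds @ R)) = 6" using n(3) by simp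
    show "\<not> collinear (set (map ?k (ds @ R)))"
      using noncollinear_knots[OF nc, of "ds @ R"] V by (simp add: image_Un)
    show "(\<Sum>i<6. \<gamma> i) = 1"
      unfolding \<gamma>_def sum6 sum_divide_distrib[symmetric] of_int_sum[symmetric] sk using n(4) by simp
    have "(\<Sum>i<6. \<gamma> i *\<^sub>R map ?k (ds @ R) ! i) = (\<Sum>i<6. if i < n then (real_of_int (ks ! i) / of_int d) *\<^sub>R ?k (ds ! i) else 0)"
      by (intro sum.cong) (auto simp: \<gamma>_def k6 simp del: map_append)
    also have "\<dots> = (1 / of_int d) *\<^sub>R (\<Sum>i<n. real_of_int (ks ! i) *\<^sub>R ?k (ds ! i))"
      unfolding sum6 scaleR_sum_right by simp
    also have "\<dots> = ?k e" unfolding knot[symmetric] using n(4) by simp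
    finally show "?k e = (\<Sum>i<6. \<gamma> i *\<^sub>R map ?k (ds @ R) ! i)" ..
  next
    fix i assume "i < 6" "\<gamma> i \<noteq> 0"
    then have "i < n" by (auto simp: \<gamma>_def split: if_splits)
    then have "off_interior (omit (ds @ R) [i])" using V by (auto simp: n_def)
    from off_interior[OF nc this x] show "\<not> collinear (insert x ((!) (map ?k (ds @ R)) ` ({..<6} - {i})))"
      unfolding set_omit[OF n(3)] by simp
  next
    fix i k assume ik: "i < 6" "k < 6" "i \<noteq> k" "\<gamma> i \<noteq> 0" "\<gamma> k \<noteq> 0"
    then have lt: "i < n" "k < n" by (auto simp: \<gamma>_def split: if_splits)
    have *: "off_interior (e # omit (ds @ R) [i, k])" if "i < k" "k < n" for i k
      using V that by (auto simp: n_def)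
    \<comment> \<open>The validity check covers only pairs with \<open>i < k\<close>; omission is
      symmetric in the two positions.\<close>
    have "omit (ds @ R) [k, i] = omit (ds @ R) [i, k]"
      by (simp add: omit_def insert_commute)
    then have "off_interior (e # omit (ds @ R) [i, k])"
      using *[of i k] *[of k i] lt ik(3) by (cases "i < k") auto
    from off_interior[OF nc this x]
    have "\<not> collinear (insert x (insert (?k e) (?k ` set (omit (ds @ R) [i, k]))))" by simp
    then show "\<not> collinear (insert x (insert (?k e) ((!) (map ?k (ds @ R)) ` ({..<6} - {i, k}))))"
      unfolding set_omit[OF n(3)] by simp
  qed
  also have "\<dots> = (\<Sum>i<6. if i < n then of_int (ks ! i) / of_int d * simplex_spline (map ?k (ds[i := e] @ R)) x else 0)"
    by (intro sum.cong) (auto simp: \<gamma>_def n_def map_update list_update_append)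
  also have "\<dots> = (\<Sum>i<n. of_int (ks ! i) * simplex_spline (map ?k (ds[i := e] @ R)) x) / of_int d"
    unfolding sum6 sum_divide_distrib by simp
  finally have eq: "of_int d * simplex_spline (map ?k (ds @ R)) x
      = (\<Sum>i<n. of_int (ks ! i) * simplex_spline (map ?k (ds[i := e] @ R)) x)"
    using n(4) by (simp add: field_simps)
  have srt: "simplex_spline (map ?k (sort L)) = simplex_spline (map ?k L)" for L
    by (rule simplex_spline_mset) simp
  show ?thesis
    unfolding insertion_eq_def Ceq prod.case srt n_def[symmetric] by (rule eq)
qed

section \<open>Tables of knots, dual coefficients and insertions\<close>

text \<open>The labels increase, to agree with the sorted lists in \<open>insertion_eq\<close>;
  \<open>mset_knot_lists\<close> matches them with \<open>knot_lists\<close>.\<close>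

definition spline_knots :: "nat list list" where
  "spline_knots =
    [[1, 1, 1, 1, 21, 31],
     [2, 2, 2, 2, 12, 32],
     [3, 3, 3, 3, 13, 23],
     [1, 1, 1, 21, 31, 32],
     [1, 1, 1, 21, 23, 31],
     [2, 2, 2, 12, 13, 32],
     [2, 2, 2, 12, 31, 32],
     [3, 3, 3, 13, 21, 23],
     [3, 3, 3, 12, 13, 23],
     [1, 1, 2, 21, 31, 32],
     [1, 1, 3, 21, 23, 31],
     [2, 2, 3, 12, 13, 32],
     [1, 2, 2, 12, 31, 32],
     [1, 3, 3, 13, 21, 23],
     [2, 3, 3, 12, 13, 23],
     [1, 1, 21, 23, 31, 32],
     [2, 2, 12, 13, 31, 32],
     [3, 3, 12, 13, 21, 23],
     [1, 2, 12, 21, 31, 32],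
     [2, 3, 12, 13, 23, 32],
     [1, 3, 13, 21, 23, 31],
     [1, 12, 21, 23, 31, 32],
     [1, 13, 21, 23, 31, 32],
     [2, 12, 13, 23, 31, 32],
     [2, 12, 13, 21, 31, 32],
     [3, 12, 13, 21, 23, 31],
     [3, 12, 13, 21, 23, 32],
     [12, 13, 21, 23, 31, 32]]"

text \<open>The knots of the cubic Bernstein polynomials, in the order of \<open>bernstein_monomials\<close> below.\<close>
definition bernstein_knots :: "nat list list" where
  "bernstein_knots =
    [[1, 1, 1, 1, 2, 3],
     [1, 2, 2, 2, 2, 3],
     [1, 2, 3, 3, 3, 3],
     [1, 1, 1, 2, 2, 3],
     [1, 1, 1, 2, 3, 3],
     [1, 1, 2, 2, 2, 3],
     [1, 2, 2, 2, 3, 3],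
     [1, 1, 2, 3, 3, 3],
     [1, 2, 2, 3, 3, 3],
     [1, 1, 2, 2, 3, 3]]"

text \<open>Row \<open>i\<close> lists the coefficients of \<open>162 * coeffs ! i * psis p1 p2 p3 y ! i\<close>, written as a
  polynomial in the values of \<open>ell y\<close> at the three vertices.\<close>
definition dual_coeffs :: "real list list" where
  "dual_coeffs =
    [[27, 0, 0, 0, 0, 0, 0, 0, 0, 0],
     [0, 27, 0, 0, 0, 0, 0, 0, 0, 0],
     [0, 0, 27, 0, 0, 0, 0, 0, 0, 0],
     [36, 0, 0, 18, 0, 0, 0, 0, 0, 0],
     [36, 0, 0, 0, 18, 0, 0, 0, 0, 0],
     [0, 36, 0, 0, 0, 0, 18, 0, 0, 0],
     [0, 36, 0, 0, 0, 18, 0, 0, 0, 0],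
     [0, 0, 36, 0, 0, 0, 0, 18, 0, 0],
     [0, 0, 36, 0, 0, 0, 0, 0, 18, 0],
     [18, 0, 0, 45, 0, 18, 0, 0, 0, 0],
     [18, 0, 0, 0, 45, 0, 0, 18, 0, 0],
     [0, 18, 0, 0, 0, 0, 45, 0, 18, 0],
     [0, 18, 0, 18, 0, 45, 0, 0, 0, 0],
     [0, 0, 18, 0, 18, 0, 0, 45, 0, 0],
     [0, 0, 18, 0, 0, 0, 18, 0, 45, 0],
     [48, 0, 0, 24, 24, 0, 0, 0, 0, 12],
     [0, 48, 0, 0, 0, 24, 24, 0, 0, 12],
     [0, 0, 48, 0, 0, 0, 0, 24, 24, 12],
     [12, 12, 0, 42, 6, 42, 6, 0, 0, 15],
     [0, 12, 12, 0, 0, 6, 42, 6, 42, 15],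
     [12, 0, 12, 6, 42, 0, 0, 42, 6, 15],
     [16, 0, 0, 40, 8, 16, 8, 0, 0, 20],
     [16, 0, 0, 8, 40, 0, 0, 16, 8, 20],
     [0, 16, 0, 0, 0, 8, 40, 8, 16, 20],
     [0, 16, 0, 16, 8, 40, 8, 0, 0, 20],
     [0, 0, 16, 8, 16, 0, 0, 40, 8, 20],
     [0, 0, 16, 0, 0, 8, 16, 8, 40, 20],
     [4, 4, 4, 18, 18, 18, 18, 18, 18, 42]]"

text \<open>Chains of insertions that reduce the Bernstein polynomials with exponents \<open>(3, 0, 0)\<close>,
  \<open>(0, 1, 2)\<close> and \<open>(1, 1, 1)\<close> to the 28 splines; they were found by linear algebra. The other
  Bernstein polynomials follow by permuting the vertices.\<close>
definition insertions_300 :: "insertion list" where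
  "insertions_300 =
    [(6, [3, -1, 4], [23, 1, 2], [21, 31, 32], 12),
     (3, [1, 2], [2, 3], [1, 21, 23, 31], 13),
     (3, [2, 1], [1, 3], [1, 1, 1, 2], 21),
     (3, [2, 1], [1, 2], [1, 3, 21, 23], 31),
     (3, [1, 2], [1, 2], [1, 1, 21, 31], 32),
     (3, [1, 2], [1, 2], [13, 21, 23, 31], 32),
     (3, [2, 1], [1, 2], [1, 1, 1, 21], 31),
     (3, [2, 1], [1, 2], [1, 1, 21, 23], 31),
     (3, [-1, 2, 2], [21, 23, 2], [13, 31, 32], 12),
     (3, [1, 2], [1, 3], [1, 1, 2, 21], 23),
     (3, [1, 2], [1, 2], [1, 21, 23, 31], 32),
     (3, [-2, 4, 1], [21, 23, 2], [12, 31, 32], 13)]"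

definition insertions_012 :: "insertion list" where
  "insertions_012 =
    [(3, [2, 1], [1, 3], [3, 12, 13, 23], 21),
     (3, [1, 2], [2, 3], [1, 2, 3, 12], 13),
     (3, [1, 2], [2, 3], [1, 3, 3, 12], 13),
     (4, [2, 3, -1], [13, 32, 1], [21, 23, 31], 12),
     (3, [1, 2], [1, 2], [3, 12, 13, 23], 32),
     (1, [2, -3, 2], [13, 21, 1], [23, 31, 32], 12),
     (2, [1, 3, -2], [13, 31, 1], [21, 23, 32], 12),
     (3, [2, 1], [1, 2], [12, 13, 23, 32], 31),
     (3, [6, -4, 1], [31, 1, 3], [13, 21, 23], 12),
     (3, [2, 1], [2, 3], [1, 2, 3, 3], 12),
     (3, [1, 2], [1, 3], [2, 12, 13, 32], 23),
     (3, [1, 2], [1, 2], [2, 3, 12, 13], 32),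
     (3, [1, 2], [1, 3], [2, 3, 12, 13], 23),
     (3, [1, 2], [1, 3], [3, 3, 12, 13], 23),
     (3, [2, 1], [1, 3], [12, 13, 23, 32], 21)]"

definition insertions_111 :: "insertion list" where
  "insertions_111 =
    [(3, [2, 1], [1, 3], [1, 2, 3, 32], 21),
     (3, [1, 2], [1, 3], [12, 13, 21, 32], 23),
     (4, [2, 3, -1], [13, 32, 1], [21, 23, 31], 12),
     (3, [6, -4, 1], [21, 1, 2], [12, 31, 32], 13),
     (3, [1, 2], [1, 3], [1, 21, 31, 32], 23),
     (3, [1, 2], [2, 3], [1, 12, 21, 32], 13),
     (3, [2, 1], [1, 2], [2, 12, 13, 32], 31),
     (3, [1, 2], [1, 3], [3, 12, 13, 21], 23),
     (1, [2, -3, 2], [13, 21, 1], [23, 31, 32], 12),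
     (3, [1, 2], [2, 3], [1, 2, 3, 32], 13),
     (3, [2, 1], [1, 2], [1, 3, 21, 32], 31),
     (6, [3, -1, 4], [32, 1, 3], [21, 23, 31], 13),
     (3, [-2, 4, 1], [31, 32, 3], [13, 21, 23], 12),
     (3, [1, 2], [1, 2], [1, 2, 3, 3], 32),
     (3, [1, 2], [1, 3], [2, 12, 13, 32], 23),
     (3, [-1, 2, 2], [31, 32, 3], [12, 21, 23], 13),
     (3, [2, 1], [2, 3], [1, 21, 31, 32], 12),
     (3, [2, 1], [2, 3], [1, 2, 13, 32], 12),
     (3, [2, 1], [2, 3], [1, 3, 13, 32], 12),
     (3, [1, 2], [1, 3], [12, 21, 31, 32], 23),
     (3, [6, -4, 1], [31, 1, 3], [13, 21, 23], 12),
     (2, [1, 3, -2], [13, 31, 1], [21, 23, 32], 12),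
     (3, [2, 1], [1, 2], [12, 13, 21, 32], 31),
     (4, [-1, 2, 3], [21, 32, 3], [1, 3, 12], 13),
     (3, [2, 1], [2, 3], [1, 3, 21, 32], 12),
     (3, [2, 1], [1, 2], [12, 13, 23, 32], 31),
     (2, [4, -3, 1], [13, 23, 1], [21, 31, 32], 12)]"

text \<open>The knot with label digits i j lies on the edge opposite vertex i, nearer to vertex j.
  Hence a permutation of the vertices acts on labels digit by digit.\<close>

definition permute_label :: "nat list \<Rightarrow> nat \<Rightarrow> nat" where
  "permute_label s n = (if n < 10 then s ! (n - 1) else 10 * s ! (n div 10 - 1) + s ! (n mod 10 - 1))"

definition permute_insertion :: "nat list \<Rightarrow> insertion \<Rightarrow> insertion" where
  "permute_insertion s C = (case C of (d, ks, ds, R, e) \<Rightarrow>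
     (d, ks, map (permute_label s) ds, map (permute_label s) R, permute_label s e))"

text \<open>Evaluated separately for each permutation used: the vertex permutations give 3 images of
  the exponents (3, 0, 0), 6 of (0, 1, 2) and 1 of (1, 1, 1).\<close>

lemma valid_insertions:
  "\<forall>s\<in>{[1, 2, 3], [2, 1, 3], [3, 1, 2]}. \<forall>C\<in>set insertions_300. valid_insertion (permute_insertion s C)"
  "\<forall>s\<in>{[1, 2, 3], [1, 3, 2], [2, 1, 3], [2, 3, 1], [3, 1, 2], [3, 2, 1]}.
     \<forall>C\<in>set insertions_012. valid_insertion (permute_insertion s C)"
  "\<forall>C\<in>set insertions_111. valid_insertion C"
  by code_simp+

lemma sum_lessThan_numeral:
  fixes f :: "nat \<Rightarrow> 'a::comm_monoid_add"
  shows "(\<Sum>i<numeral n. f i) = (\<Sum>i<pred_numeral n. f i) + f (pred_numeral n)"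
  by (simp add: numeral_eq_Suc)

text \<open>For each monomial the equation is a linear combination of the insertions in its chain,
  in which the intermediate splines cancel. The constant is 243 = 162 * 15 / 10: the table carries
  162, the weights carry 1 / 15, and the Bernstein splines carry 10 over the area.\<close>

lemma bernstein_coefficients:
  assumes M: "\<And>C. valid_insertion C \<Longrightarrow> insertion_eq M C"
  shows "\<forall>t<10. (\<Sum>i<28. dual_coeffs ! i ! t * M (spline_knots ! i)) = 243 * M (bernstein_knots ! t)"
proof -
  have E300: "list_all (insertion_eq M) (map (permute_insertion s) insertions_300)"
    if "s \<in> {[1, 2, 3], [2, 1, 3], [3, 1, 2]}" for s
    unfolding list_all_iff set_map using valid_insertions(1) M that by blast
  have E012: "list_all (insertion_eq M) (map (permute_insertion s) insertions_012)"
    if "s \<in> {[1, 2, 3], [1, 3, 2], [2, 1, 3], [2, 3, 1], [3, 1, 2], [3, 2, 1]}" for s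
    unfolding list_all_iff set_map using valid_insertions(2) M that by blast
  have E111: "list_all (insertion_eq M) insertions_111"
    unfolding list_all_iff using valid_insertions(3) M by blast
  note defs = insertions_300_def insertions_012_def insertions_111_def permute_insertion_def permute_label_def
    insertion_eq_def list.map list.pred_inject prod.case
  note data = spline_knots_def dual_coeffs_def bernstein_knots_def
  \<comment> \<open>The first entry of \<open>s\<close> is the vertex with exponent 3.\<close>
  have e0: "(\<Sum>i<28. dual_coeffs ! i ! 0 * M (spline_knots ! i)) = 243 * M (bernstein_knots ! 0)"
    using E300[of "[1, 2, 3]", unfolded defs, simplified] unfolding data by (simp add: sum_lessThan_numeral)
  have e1: "(\<Sum>i<28. dual_coeffs ! i ! 1 * M (spline_knots ! i)) = 243 * M (bernstein_knots ! 1)"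
    using E300[of "[2, 1, 3]", unfolded defs, simplified] unfolding data by (simp add: sum_lessThan_numeral)
  have e2: "(\<Sum>i<28. dual_coeffs ! i ! 2 * M (spline_knots ! i)) = 243 * M (bernstein_knots ! 2)"
    using E300[of "[3, 1, 2]", unfolded defs, simplified] unfolding data by (simp add: sum_lessThan_numeral)
  \<comment> \<open>The entries of \<open>s\<close> are the vertices with exponents 0, 1 and 2, in
    this order.\<close>
  have e3: "(\<Sum>i<28. dual_coeffs ! i ! 3 * M (spline_knots ! i)) = 243 * M (bernstein_knots ! 3)"
    using E012[of "[3, 2, 1]", unfolded defs, simplified] unfolding data by (simp add: sum_lessThan_numeral)
  have e4: "(\<Sum>i<28. dual_coeffs ! i ! 4 * M (spline_knots ! i)) = 243 * M (bernstein_knots ! 4)"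
    using E012[of "[2, 3, 1]", unfolded defs, simplified] unfolding data by (simp add: sum_lessThan_numeral)
  have e5: "(\<Sum>i<28. dual_coeffs ! i ! 5 * M (spline_knots ! i)) = 243 * M (bernstein_knots ! 5)"
    using E012[of "[3, 1, 2]", unfolded defs, simplified] unfolding data by (simp add: sum_lessThan_numeral)
  have e6: "(\<Sum>i<28. dual_coeffs ! i ! 6 * M (spline_knots ! i)) = 243 * M (bernstein_knots ! 6)"
    using E012[of "[1, 3, 2]", unfolded defs, simplified] unfolding data by (simp add: sum_lessThan_numeral)
  have e7: "(\<Sum>i<28. dual_coeffs ! i ! 7 * M (spline_knots ! i)) = 243 * M (bernstein_knots ! 7)"
    using E012[of "[2, 1, 3]", unfolded defs, simplified] unfolding data by (simp add: sum_lessThan_numeral)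
  have e8: "(\<Sum>i<28. dual_coeffs ! i ! 8 * M (spline_knots ! i)) = 243 * M (bernstein_knots ! 8)"
    using E012[of "[1, 2, 3]", unfolded defs, simplified] unfolding data by (simp add: sum_lessThan_numeral)
  have e9: "(\<Sum>i<28. dual_coeffs ! i ! 9 * M (spline_knots ! i)) = 243 * M (bernstein_knots ! 9)"
    using E111[unfolded defs, simplified] unfolding data by (simp add: sum_lessThan_numeral)
  show ?thesis
  proof (intro allI impI)
    fix t :: nat assume "t < 10"
    then have "t = 0 \<or> t = 1 \<or> t = 2 \<or> t = 3 \<or> t = 4 \<or> t = 5 \<or> t = 6 \<or> t = 7 \<or> t = 8 \<or> t = 9"
      by presburger
    then show "(\<Sum>i<28. dual_coeffs ! i ! t * M (spline_knots ! i)) = 243 * M (bernstein_knots ! t)"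
      by (elim disjE) (simp_all only: e0 e1 e2 e3 e4 e5 e6 e7 e8 e9)
  qed
qed

section \<open>The dual polynomials\<close>

text \<open>The multinomial factors 1, 3 and 6 are left out, since the splines with Bernstein knots
  already contain them.\<close>

definition bernstein_monomials :: "real \<Rightarrow> real \<Rightarrow> real \<Rightarrow> real list" where
  "bernstein_monomials a b c =
     [a ^ 3, b ^ 3, c ^ 3, a\<^sup>2 * b, a\<^sup>2 * c, a * b\<^sup>2, b\<^sup>2 * c, a * c\<^sup>2, b * c\<^sup>2, a * b * c]"

lemma all_less_numeral:
  "(\<forall>i<numeral n. P i) \<longleftrightarrow> P (pred_numeral n) \<and> (\<forall>i<pred_numeral n. P i)"
  by (auto simp: numeral_eq_Suc less_Suc_eq)

lemma ell_tp: "ell y (tp p q) = (2 * ell y p + ell y q) / 3"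
  by (simp add: ell_def tp_def inner_add_right field_simps)

lemma replicate_numeral: "replicate (numeral n) x = x # replicate (pred_numeral n) x"
  by (simp add: numeral_eq_Suc)

text \<open>\<open>ell y\<close> is affine, so its values at the knots, at \<open>m1\<close>,
  \<open>m2\<close>, \<open>m3\<close> and at \<open>q\<close> are weighted means of its values
  \<open>a\<close>, \<open>b\<close>, \<open>c\<close> at the vertices. Each row then is an identity
  of cubic forms in \<open>a\<close>, \<open>b\<close>, \<open>c\<close>.\<close>

lemma dual_coeffs_expansion:
  "\<forall>i<28. 162 * (psis p1 p2 p3 y ! i * coeffs ! i) =
     (\<Sum>t<10. dual_coeffs ! i ! t * bernstein_monomials (ell y p1) (ell y p2) (ell y p3) ! t)"
proof -
  define a b c where abc: "a = ell y p1" "b = ell y p2" "c = ell y p3"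
  have m: "ell y ((2/5) *\<^sub>R p1 + (2/5) *\<^sub>R p2 + (1/5) *\<^sub>R p3) = (2 * a + 2 * b + c) / 5"
    "ell y ((1/5) *\<^sub>R p1 + (2/5) *\<^sub>R p2 + (2/5) *\<^sub>R p3) = (a + 2 * b + 2 * c) / 5"
    "ell y ((2/5) *\<^sub>R p1 + (1/5) *\<^sub>R p2 + (2/5) *\<^sub>R p3) = (2 * a + b + 2 * c) / 5"
    "ell y ((1/3) *\<^sub>R (p1 + p2 + p3)) = (a + b + c) / 3"
    by (simp_all add: abc ell_def inner_add_right field_simps)
  have cs: "coeffs = [1/6, 1/6, 1/6, 1/3, 1/3, 1/3, 1/3, 1/3, 1/3, 1/2, 1/2, 1/2, 1/2, 1/2, 1/2, 2/3, 2/3, 2/3,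
      5/6, 5/6, 5/6, 2/3, 2/3, 2/3, 2/3, 2/3, 2/3, 1]"
    by (simp add: coeffs_def replicate_numeral)
  show ?thesis
    unfolding cs psis_def Let_def ell_tp m abc[symmetric] bernstein_monomials_def dual_coeffs_def
    by (simp add: all_less_numeral sum_lessThan_numeral, intro conjI)
      (simp_all add: power2_eq_square power3_eq_cube field_simps)
qed

lemma knot_simps:
  "knot p1 p2 p3 1 = p1" "knot p1 p2 p3 2 = p2" "knot p1 p2 p3 3 = p3"
  "knot p1 p2 p3 12 = tp p2 p3" "knot p1 p2 p3 13 = tp p3 p2" "knot p1 p2 p3 21 = tp p1 p3"
  "knot p1 p2 p3 23 = tp p3 p1" "knot p1 p2 p3 31 = tp p1 p2" "knot p1 p2 p3 32 = tp p2 p1"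
  by (simp_all add: knot_def coord_def tp_def add.commute)

lemma mset_knot_lists:
  "\<forall>i<28. mset (knot_lists p1 p2 p3 ! i) = mset (map (knot p1 p2 p3) (spline_knots ! i))"
  unfolding knot_lists_def Let_def spline_knots_def
  by (simp add: all_less_numeral knot_simps knot_simps[unfolded One_nat_def] replicate_numeral add_mset_commute)

text \<open>The hypotheses of \<open>simplex_spline_interior_limit\<close> in a form that can be
  evaluated: any five of the knots are noncollinear or include two points of one edge.\<close>

definition regular_knots :: "nat list \<Rightarrow> bool" where
  "regular_knots L \<longleftrightarrow> length L = 6 \<and> noncollinear_knots L \<and> (\<forall>j\<in>set [0..<6]. off_interior (omit L [j]))"

lemma regular_spline_knots: "\<forall>L\<in>set spline_knots. regular_knots L"
  by code_simp

lemma spline_knots_simps: "length spline_knots = 28"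
  by (simp add: spline_knots_def)

lemma simplex_spline_knot_lists:
  assumes "i < 28"
  shows "simplex_spline (knot_lists p1 p2 p3 ! i) = simplex_spline (map (knot p1 p2 p3) (spline_knots ! i))"
  using mset_knot_lists assms by (intro simplex_spline_mset) blast

lemma spline_interior_limit:
  assumes nc: "\<not> collinear {p1, p2, p3}" and i: "i < 28"
  shows "\<exists>l. (simplex_spline (knot_lists p1 p2 p3 ! i) \<longlongrightarrow> l)
               (at x within interior (convex hull {p1, p2, p3}))"
proof -
  define L where "L = spline_knots ! i"
  have "regular_knots L"
    using regular_spline_knots i by (simp add: L_def spline_knots_simps)
  then have L: "length L = 6" "noncollinear_knots L" "\<And>j. j < 6 \<Longrightarrow> off_interior (omit L [j])"
    unfolding regular_knots_def by auto
  show ?thesis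
    unfolding simplex_spline_knot_lists[OF i] L_def[symmetric]
  proof (rule simplex_spline_interior_limit)
    show "length (map (knot p1 p2 p3) L) = 6" using L(1) by simp
    show "\<not> collinear (set (map (knot p1 p2 p3) L))" using noncollinear_knots[OF nc L(2)] by simp
    show "connected (interior (convex hull {p1, p2, p3}))"
      by (intro convex_connected convex_interior convex_convex_hull)
    show "\<not> collinear (insert y ((!) (map (knot p1 p2 p3) L) ` ({..<6} - {j})))"
      if "j < 6" "y \<in> interior (convex hull {p1, p2, p3})" for j y
      using off_interior[OF nc L(3)[OF that(1)] that(2)] unfolding set_omit[OF L(1)] by simp
  qed
qed

section \<open>The identity inside the triangle and on its boundary\<close>

text \<open>Exchanging the sums over splines and over monomials collects, for each monomial, the
  combination that equals one Bernstein spline. What remains is the expansion of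
  \<open>(l1 * a + l2 * b + l3 * c) ^ 3\<close>, whose base is the value of the affine function
  \<open>ell y\<close> at \<open>x\<close>.\<close>

lemma spline_identity_interior:
  assumes nc: "\<not> collinear {p1, p2, p3}" and x: "x \<in> interior (convex hull {p1, p2, p3})"
  shows "(1 + y \<bullet> x) ^ 3 = (\<Sum>i<28. psis p1 p2 p3 y ! i *
     (measure lborel (convex hull {p1, p2, p3}) / 15 * coeffs ! i * simplex_spline (knot_lists p1 p2 p3 ! i) x))"
proof -
  define A where "A = measure lborel (convex hull {p1, p2, p3})"
  define M where "M L = simplex_spline (map (knot p1 p2 p3) L) x" for L
  define a b c where abc: "a = ell y p1" "b = ell y p2" "c = ell y p3"
  let ?m = "\<lambda>t. bernstein_monomials a b c ! t"
  define p where "p i = [p1, p2, p3] ! i" for i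
  obtain l where l: "barycentric 3 p l"
    using triangle_barycentric[OF nc] unfolding p_def[abs_def] by blast
  have T: "p ` {..<3} = {p1, p2, p3}"
    by (auto simp: p_def eval_nat_numeral lessThan_Suc)
  have xT: "x \<in> convex hull (p ` {..<3})" unfolding T using x interior_subset by blast
  have Apos: "A > 0" unfolding A_def using barycentric_measure_pos[OF l] by (simp only: T)
  have p: "p 0 = p1" "p 1 = p2" "p 2 = p3" by (simp_all add: p_def)
  \<comment> \<open>\<open>simplex_spline_bernstein\<close> lists the three vertices first, whereas
    the tables are sorted.\<close>
  have Mp: "M L = simplex_spline (map (knot p1 p2 p3) L') x" if "mset L = mset L'" for L L'
    unfolding M_def using that by (intro fun_cong[OF simplex_spline_mset]) simp
  note B = simplex_spline_bernstein[OF l xT, unfolded T A_def[symmetric]]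
  define l1 l2 l3 where ls: "l1 = l 0 x" "l2 = l 1 x" "l3 = l 2 x"
  note K = knot_simps[unfolded One_nat_def]
  have Mb: "M [1, 1, 1, 1, 2, 3] = 10 / A * l1 ^ 3" "M [1, 2, 2, 2, 2, 3] = 10 / A * l2 ^ 3"
    "M [1, 2, 3, 3, 3, 3] = 10 / A * l3 ^ 3"
    "M [1, 1, 1, 2, 2, 3] = 30 / A * l1\<^sup>2 * l2" "M [1, 1, 1, 2, 3, 3] = 30 / A * l1\<^sup>2 * l3"
    "M [1, 1, 2, 2, 2, 3] = 30 / A * l2\<^sup>2 * l1" "M [1, 2, 2, 2, 3, 3] = 30 / A * l2\<^sup>2 * l3"
    "M [1, 1, 2, 3, 3, 3] = 30 / A * l3\<^sup>2 * l1" "M [1, 2, 2, 3, 3, 3] = 30 / A * l3\<^sup>2 * l2"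
    "M [1, 1, 2, 2, 3, 3] = 60 / A * l1 * l2 * l3"
    unfolding ls
    using B(1)[of 0] B(1)[of 1] B(1)[of 2] B(2)[of 0 1] B(2)[of 0 2] B(2)[of 1 0] B(2)[of 1 2] B(2)[of 2 0] B(2)[of 2 1] B(3)
      Mp[of "[1, 1, 1, 1, 2, 3]" "[1, 2, 3, 1, 1, 1]"] Mp[of "[1, 2, 2, 2, 2, 3]" "[1, 2, 3, 2, 2, 2]"]
      Mp[of "[1, 2, 3, 3, 3, 3]" "[1, 2, 3, 3, 3, 3]"]
      Mp[of "[1, 1, 1, 2, 2, 3]" "[1, 2, 3, 1, 1, 2]"] Mp[of "[1, 1, 1, 2, 3, 3]" "[1, 2, 3, 1, 1, 3]"]
      Mp[of "[1, 1, 2, 2, 2, 3]" "[1, 2, 3, 2, 2, 1]"] Mp[of "[1, 2, 2, 2, 3, 3]" "[1, 2, 3, 2, 2, 3]"]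
      Mp[of "[1, 1, 2, 3, 3, 3]" "[1, 2, 3, 3, 3, 1]"] Mp[of "[1, 2, 2, 3, 3, 3]" "[1, 2, 3, 3, 3, 2]"]
      Mp[of "[1, 1, 2, 2, 3, 3]" "[1, 2, 3, 1, 2, 3]"]
    by (simp_all add: p[unfolded One_nat_def] K)
  have "\<forall>t<10. (\<Sum>i<28. dual_coeffs ! i ! t * M (spline_knots ! i)) = 243 * M (bernstein_knots ! t)"
    unfolding M_def by (rule bernstein_coefficients[OF valid_insertion_imp_eq[OF nc _ x]])
  then have E: "(\<Sum>i<28. dual_coeffs ! i ! t * M (spline_knots ! i)) = 243 * M (bernstein_knots ! t)" if "t < 10" for t
    using that by blast
  have "(\<Sum>i<28. psis p1 p2 p3 y ! i * (A / 15 * coeffs ! i * simplex_spline (knot_lists p1 p2 p3 ! i) x))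
      = (\<Sum>i<28. A / (15 * 162) * (\<Sum>t<10. ?m t * (dual_coeffs ! i ! t * M (spline_knots ! i))))"
  proof (intro sum.cong refl)
    fix i :: nat assume "i \<in> {..<28}"
    then have i: "i < 28" by simp
    have "psis p1 p2 p3 y ! i * (A / 15 * coeffs ! i * simplex_spline (knot_lists p1 p2 p3 ! i) x)
        = A / (15 * 162) * ((162 * (psis p1 p2 p3 y ! i * coeffs ! i)) * M (spline_knots ! i))"
      by (simp add: M_def simplex_spline_knot_lists[OF i])
    also have "162 * (psis p1 p2 p3 y ! i * coeffs ! i) = (\<Sum>t<10. dual_coeffs ! i ! t * ?m t)"
      unfolding abc using dual_coeffs_expansion i by blast
    also have "(\<Sum>t<10. dual_coeffs ! i ! t * ?m t) * M (spline_knots ! i)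
        = (\<Sum>t<10. ?m t * (dual_coeffs ! i ! t * M (spline_knots ! i)))"
      unfolding sum_distrib_right by (intro sum.cong) simp_all
    finally show "psis p1 p2 p3 y ! i * (A / 15 * coeffs ! i * simplex_spline (knot_lists p1 p2 p3 ! i) x)
        = A / (15 * 162) * (\<Sum>t<10. ?m t * (dual_coeffs ! i ! t * M (spline_knots ! i)))" .
  qed
  also have "\<dots> = A / (15 * 162) * (\<Sum>t<10. ?m t * (\<Sum>i<28. dual_coeffs ! i ! t * M (spline_knots ! i)))"
    unfolding sum_distrib_left[symmetric] by (subst sum.swap) (simp only: sum_distrib_left)
  also have "\<dots> = A / (15 * 162) * (\<Sum>t<10. ?m t * (243 * M (bernstein_knots ! t)))"
    by (intro arg_cong[where f = "\<lambda>z. A / (15 * 162) * z"] sum.cong) (auto simp: E)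
  \<comment> \<open>243 / (15 * 162) = 1 / 10, which will cancel the factor \<open>10 / A\<close> of
    the Bernstein splines.\<close>
  also have "\<dots> = A / 10 * (\<Sum>t<10. ?m t * M (bernstein_knots ! t))"
    by (simp add: sum_distrib_left mult_ac)
  also have "(\<Sum>t<10. ?m t * M (bernstein_knots ! t)) = 10 / A * (l1 * a + l2 * b + l3 * c) ^ 3"
  proof -
    have "(\<Sum>t<10. ?m t * M (bernstein_knots ! t)) = a ^ 3 * M [1, 1, 1, 1, 2, 3] + b ^ 3 * M [1, 2, 2, 2, 2, 3] +
      c ^ 3 * M [1, 2, 3, 3, 3, 3] + a\<^sup>2 * b * M [1, 1, 1, 2, 2, 3] + a\<^sup>2 * c * M [1, 1, 1, 2, 3, 3] +
      a * b\<^sup>2 * M [1, 1, 2, 2, 2, 3] + b\<^sup>2 * c * M [1, 2, 2, 2, 3, 3] + a * c\<^sup>2 * M [1, 1, 2, 3, 3, 3] +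
      b * c\<^sup>2 * M [1, 2, 2, 3, 3, 3] + a * b * c * M [1, 1, 2, 2, 3, 3]"
      by (simp add: sum_lessThan_numeral bernstein_monomials_def bernstein_knots_def)
    also have "\<dots> = 10 / A * (l1 * a + l2 * b + l3 * c) ^ 3"
      unfolding Mb using Apos by (simp add: power2_eq_square power3_eq_cube field_simps)
    finally show ?thesis .
  qed
  also have "l1 * a + l2 * b + l3 * c = 1 + y \<bullet> x"
  proof -
    have "x = l1 *\<^sub>R p1 + l2 *\<^sub>R p2 + l3 *\<^sub>R p3" "l1 + l2 + l3 = 1"
      using barycentricD(3)[OF l, of x] barycentricD(2)[OF l, of x]
      by (simp_all add: ls p_def eval_nat_numeral add_ac)
    moreover have "l1 * a + l2 * b + l3 * c = (l1 + l2 + l3) + y \<bullet> (l1 *\<^sub>R p1 + l2 *\<^sub>R p2 + l3 *\<^sub>R p3)"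
      by (simp add: abc ell_def inner_add_right algebra_simps)
    ultimately show ?thesis by simp
  qed
  finally show ?thesis using Apos by (simp add: A_def)
qed

theorem theorem3p5:
  fixes p1 p2 p3 y x :: "real^2"
  assumes "\<not> collinear {p1, p2, p3}"
    and "x \<in> convex hull {p1, p2, p3}"
  shows "(1 + y \<bullet> x) ^ 3 = (\<Sum>i<28. psis p1 p2 p3 y ! i * Bspl p1 p2 p3 i x)"
proof (cases "x \<in> interior (convex hull {p1, p2, p3})")
  case True
  then show ?thesis
    using spline_identity_interior[OF assms(1) True, of y] by (simp add: Bspl_def interior_ext_def)
next
  case False
  let ?T = "convex hull {p1, p2, p3}"
  let ?U = "interior ?T"
  let ?S = "\<lambda>i. simplex_spline (knot_lists p1 p2 p3 ! i)"
  let ?w = "\<lambda>i. measure lborel ?T / 15 * coeffs ! i"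
  have U: "?U \<noteq> {}"
  proof
    assume "?U = {}"
    then have "negligible ?T" using negligible_convex_interior convex_convex_hull by blast
    then have "measure lebesgue ?T = 0" by (rule negligible_imp_measure0)
    moreover have "compact ?T" by (intro finite_imp_compact_convex_hull) simp
    ultimately have "measure lborel ?T = 0" using measure_lebesgue_compact by metis
    moreover obtain l where l: "barycentric 3 (\<lambda>i. [p1, p2, p3] ! i) l" by (rule triangle_barycentric[OF assms(1)])
    have "(\<lambda>i. [p1, p2, p3] ! i) ` {..<3} = {p1, p2, p3}"
      by (auto simp: eval_nat_numeral lessThan_Suc)
    ultimately show False using barycentric_measure_pos[OF l] by simp
  qed
  have "x \<in> closure ?U"
    using assms(2) convex_closure_interior[OF convex_convex_hull U] closure_subset by blast
  \<comment> \<open>The interior clusters at \<open>x\<close>, so limits along it are unique and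
    \<open>Lim\<close> returns them.\<close>
  then have ntl: "at x within ?U \<noteq> bot"
    using False by (simp add: trivial_limit_within closure_def)
  have "\<forall>i. \<exists>l. i < 28 \<longrightarrow> (?S i \<longlongrightarrow> l) (at x within ?U)"
    using spline_interior_limit[OF assms(1)] by blast
  from choice[OF this] obtain l where l: "\<And>i. i < 28 \<Longrightarrow> (?S i \<longlongrightarrow> l i) (at x within ?U)"
    by blast
  have Bspl: "Bspl p1 p2 p3 i x = ?w i * l i" if "i < 28" for i
    using tendsto_Lim[OF ntl l[OF that]] False by (simp add: Bspl_def interior_ext_def)
  \<comment> \<open>The limit is taken summand by summand: every spline converges on its own, and
    the numbers \<open>l i\<close> are the boundary values that enter \<open>Bspl\<close>.\<close>
  have "((\<lambda>u. \<Sum>i<28. psis p1 p2 p3 y ! i * (?w i * ?S i u)) \<longlongrightarrow> (\<Sum>i<28. psis p1 p2 p3 y ! i * (?w i * l i))) (at x within ?U)"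
    by (intro tendsto_sum tendsto_mult tendsto_const l) simp
  moreover have "eventually (\<lambda>u. (\<Sum>i<28. psis p1 p2 p3 y ! i * (?w i * ?S i u)) = (1 + y \<bullet> u) ^ 3) (at x within ?U)"
    using spline_identity_interior[OF assms(1), of _ y] by (auto simp: eventually_at_filter)
  ultimately have "((\<lambda>u. (1 + y \<bullet> u) ^ 3) \<longlongrightarrow> (\<Sum>i<28. psis p1 p2 p3 y ! i * (?w i * l i))) (at x within ?U)"
    by (rule Lim_transform_eventually)
  moreover have "((\<lambda>u. (1 + y \<bullet> u) ^ 3) \<longlongrightarrow> (1 + y \<bullet> x) ^ 3) (at x within ?U)"
    by (intro tendsto_intros)
  ultimately have "(1 + y \<bullet> x) ^ 3 = (\<Sum>i<28. psis p1 p2 p3 y ! i * (?w i * l i))"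
    using tendsto_unique[OF ntl] by blast
  also have "\<dots> = (\<Sum>i<28. psis p1 p2 p3 y ! i * Bspl p1 p2 p3 i x)"
    by (intro sum.cong refl) (simp only: Bspl lessThan_iff)
  finally show ?thesis .
qed

end
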